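(* Let $n\ge 1$ be an integer and let $0\le\bar n_{\min}\le\bar n_{\max}<\infty$ be real numbers. For $\bar n\ge 0$ let $\rho_{\bar n}$ be the $n$-mode isotropic thermal state with mean photon number $\bar n$ on $L^2(\mathbb{R}^n)$, i.e. the operator whose quantum characteristic function is $\chi_{\rho_{\bar n}}(z)=e^{-(\bar n+\frac12)\|z\|^2}$, $z\in\mathbb{R}^{2n}$. Then the family $F=\{\rho_{\bar n}:\bar n\in[\bar n_{\min},\bar n_{\max}]\}$ is precompact in $\big(\mathcal{T}^2(L^2(\mathbb{R}^n)),\|\cdot\|_{\mathcal{T}^2}\big)$.
   Context: $\mathcal{T}^2(L^2(\mathbb{R}^n))$ is the space of Hilbert-Schmidt operators on $L^2(\mathbb{R}^n)$; precompact means having compact closure. The phase space is $\Xi=\mathbb{R}^{2n}$, and $U$ is the Weyl displacement-operator (projective unitary, irreducible) representation of $\mathbb{R}^{2n}$ on $L^2(\mathbb{R}^n)$. The quantum characteristic function of a trace class operator $A$ is $\chi_A(z)=\operatorname{tr}(AU_z^* )$; the map $A\mapsto\chi_A$ (the Fourier-Weyl transform) extends to a unitary operator from $\mathcal{T}^2(L^2(\mathbb{R}^n))$ onto $L^2(\mathbb{R}^{2n})$ for a suitable normalization of Lebesgue measure, so $\rho_{\bar n}$ is uniquely determined by its characteristic function. The coordinates on $\mathbb{R}^{2n}$ are those for which the formula for $\chi_{\rho_{\bar n}}$ holds: $z=(\operatorname{Re}\beta,\operatorname{Im}\beta)$ with $\beta\in\mathbb{C}^n\cong\mathbb{R}^{2n}$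 and $U_z=\exp\big(\sum_j(\beta_ja_j^*-\overline{\beta_j}a_j)\big)$, where $a_j,a_j^*$ are the standard annihilation and creation operators of the $j$-th mode. Concretely, $\rho_{\bar n}$ is the $n$-fold tensor power of the one-mode state $\frac{1}{\bar n+1}\sum_{k\ge0}\big(\frac{\bar n}{\bar n+1}\big)^k|k\rangle\langle k|$, with $(|k\rangle)_{k\ge 0}$ the Hermite (number) basis of $L^2(\mathbb{R})$ (and $\rho_0$ the projection onto the vacuum). *)

theory Defs
  imports "HOL-Analysis.Analysis"
begin

section \<open>Complex Hilbert spaces\<close>

text \<open>A complex inner product space is presented as a real one with a compatible complex
  structure; the sesquilinear form is conjugate linear in the first argument.\<close>

class complex_inner = real_inner +
  fixes scaleC :: "complex \<Rightarrow> 'a \<Rightarrow> 'a" (infixr "*\<^sub>C" 75)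
    and cinner :: "'a \<Rightarrow> 'a \<Rightarrow> complex"
  assumes scaleC_add_right: "c *\<^sub>C (x + y) = c *\<^sub>C x + c *\<^sub>C y"
    and scaleC_add_left: "(c + d) *\<^sub>C x = c *\<^sub>C x + d *\<^sub>C x"
    and scaleC_scaleC: "c *\<^sub>C d *\<^sub>C x = (c * d) *\<^sub>C x"
    and scaleC_of_real: "complex_of_real r *\<^sub>C x = r *\<^sub>R x"
    and cinner_add_right: "cinner x (y + z) = cinner x y + cinner x z"
    and cinner_scaleC_right: "cinner x (c *\<^sub>C y) = c * cinner x y"
    and cinner_commute: "cinner x y = cnj (cinner y x)"
    and inner_eq_Re_cinner: "inner x y = Re (cinner x y)"

class chilbert_space = complex_inner + complete_space

interpretation complex_vector: vector_space "scaleC :: complex \<Rightarrow> 'a \<Rightarrow> 'a::complex_inner"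
proof
  fix x :: 'a
  show "1 *\<^sub>C x = x"
    using scaleC_of_real[of 1 x] by simp
qed (simp_all add: scaleC_add_right scaleC_add_left scaleC_scaleC)

definition is_onb :: "'a::complex_inner set \<Rightarrow> bool" where
  "is_onb E \<longleftrightarrow> (\<forall>e\<in>E. \<forall>f\<in>E. cinner e f = (if e = f then 1 else 0)) \<and>
    closure (complex_vector.span E) = UNIV"

definition some_onb :: "'a::complex_inner set" where
  "some_onb = (SOME E. is_onb E)"

definition bounded_clinear :: "('a::complex_inner \<Rightarrow> 'b::complex_inner) \<Rightarrow> bool" where
  "bounded_clinear A \<longleftrightarrow> bounded_linear A \<and> (\<forall>c x. A (c *\<^sub>C x) = c *\<^sub>C A x)"

definition cadjoint :: "('a::complex_inner \<Rightarrow> 'b::complex_inner) \<Rightarrow> 'b \<Rightarrow> 'a" where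
  "cadjoint A = (THE B. bounded_clinear B \<and> (\<forall>x y. cinner (A x) y = cinner x (B y)))"

definition positive_op :: "('a::complex_inner \<Rightarrow> 'a) \<Rightarrow> bool" where
  "positive_op A \<longleftrightarrow> bounded_clinear A \<and> (\<forall>x. cinner x (A x) \<in> \<real> \<and> 0 \<le> Re (cinner x (A x)))"

subsection \<open>Trace class and Hilbert--Schmidt operators\<close>

text \<open>In \<open>trace_class\<close>, the operator \<open>B\<close> is the absolute value of \<open>A\<close>, the positive square
  root of \<open>A\<^sup>*A\<close>. None of the notions below depends on which orthonormal basis is used;
  one exists by \<open>ex_onb\<close>. By \<open>Metric_space_hs\<close>, \<open>hs_topology\<close> is a genuine metric topology.\<close>

definition trace_class :: "('a::complex_inner \<Rightarrow> 'a) \<Rightarrow> bool" where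
  "trace_class A \<longleftrightarrow> bounded_clinear A \<and>
    (\<exists>B. positive_op B \<and> B \<circ> B = cadjoint A \<circ> A \<and> (\<lambda>e. cinner e (B e)) summable_on some_onb)"

definition op_trace :: "('a::complex_inner \<Rightarrow> 'a) \<Rightarrow> complex" where
  "op_trace A = (\<Sum>\<^sub>\<infinity>e\<in>some_onb. cinner e (A e))"

definition hilbert_schmidt :: "('a::complex_inner \<Rightarrow> 'a) \<Rightarrow> bool" where
  "hilbert_schmidt A \<longleftrightarrow> bounded_clinear A \<and> (\<lambda>e. (norm (A e))\<^sup>2) summable_on some_onb"

definition hs_norm :: "('a::complex_inner \<Rightarrow> 'a) \<Rightarrow> real" where
  "hs_norm A = sqrt (\<Sum>\<^sub>\<infinity>e\<in>some_onb. (norm (A e))\<^sup>2)"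

definition hs_topology :: "('a::complex_inner \<Rightarrow> 'a) topology" where
  "hs_topology = Metric_space.mtopology {A. hilbert_schmidt A} (\<lambda>A B. hs_norm (\<lambda>x. A x - B x))"

definition precompact_in :: "'a topology \<Rightarrow> 'a set \<Rightarrow> bool" where
  "precompact_in X S \<longleftrightarrow> S \<subseteq> topspace X \<and> compactin X (X closure_of S)"

lemma closed_subspace_orthogonal:
  fixes S :: "'a::chilbert_space set"
  assumes "complex_vector.subspace S" "closed S" "x \<notin> S"
  shows "\<exists>u. u \<noteq> 0 \<and> (\<forall>s\<in>S. cinner s u = 0)"
proof -
  have S0: "0 \<in> S" and Sadd: "\<And>a b. a \<in> S \<Longrightarrow> b \<in> S \<Longrightarrow> a + b \<in> S"
    and Sc: "\<And>c a. a \<in> S \<Longrightarrow> c *\<^sub>C a \<in> S"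
    using assms(1) unfolding complex_vector.subspace_def by auto
  have Sr: "r *\<^sub>R a \<in> S" if "a \<in> S" for r a
    using Sc[OF that, of "complex_of_real r"] by (simp add: scaleC_of_real)
  define d where "d = infdist x S"
  have dle: "d \<le> dist x y" if "y \<in> S" for y
    unfolding d_def using that by (rule infdist_le)
  have d0: "0 \<le> d" unfolding d_def by (rule infdist_nonneg)
  have "\<exists>y\<in>S. dist x y < d + 1 / real (Suc n)" for n
  proof (rule ccontr)
    assume "\<not> ?thesis"
    then have "d + 1 / real (Suc n) \<le> dist x y" if "y \<in> S" for y using that by force
    moreover have "S \<noteq> {}" using S0 by auto
    ultimately have "d + 1 / real (Suc n) \<le> infdist x S"
      unfolding infdist_def by (auto intro!: cINF_greatest)
    then show False unfolding d_def by (simp add: field_simps)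
  qed
  then obtain y where yS: "\<And>n. y n \<in> S" and yd: "\<And>n. dist x (y n) < d + 1 / real (Suc n)"
    by metis
  have lim: "(\<lambda>n. dist x (y n)) \<longlonglongrightarrow> d"
  proof (rule tendsto_sandwich[of "\<lambda>_. d"])
    show "(\<lambda>n. d + 1 / real (Suc n)) \<longlonglongrightarrow> d"
      using tendsto_add[OF tendsto_const LIMSEQ_inverse_real_of_nat, of d]
      by (simp add: inverse_eq_divide)
    show "\<forall>\<^sub>F n in sequentially. dist x (y n) \<le> d + 1 / real (Suc n)"
      using yd by (intro always_eventually allI less_imp_le)
  qed (use yS dle in auto)
  have par: "(dist (y m) (y n))\<^sup>2 \<le> 2 * (dist x (y m))\<^sup>2 + 2 * (dist x (y n))\<^sup>2 - 4 * d\<^sup>2" for m n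
  proof -
    define a b where "a = x - y m" and "b = x - y n"
    have "(1/2) *\<^sub>R (y m + y n) \<in> S" using Sr Sadd yS by blast
    then have "d \<le> norm (x - (1/2) *\<^sub>R (y m + y n))" using dle by (simp add: dist_norm)
    also have "x - (1/2) *\<^sub>R (y m + y n) = (1/2) *\<^sub>R (a + b)"
      unfolding a_def b_def by (simp add: algebra_simps flip: scaleR_add_left)
    finally have "d\<^sup>2 \<le> (norm ((1/2) *\<^sub>R (a + b)))\<^sup>2" using d0 by (rule power_mono)
    also have "\<dots> = (norm (a + b))\<^sup>2 / 4" by (simp add: power_divide)
    finally have "4 * d\<^sup>2 \<le> (norm (a + b))\<^sup>2" by simp
    moreover have "(norm (a + b))\<^sup>2 + (norm (b - a))\<^sup>2 = 2 * (norm a)\<^sup>2 + 2 * (norm b)\<^sup>2"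
      by (simp add: power2_norm_eq_inner inner_diff_left inner_diff_right inner_add_left
          inner_add_right inner_commute)
    moreover have "b - a = y m - y n" unfolding a_def b_def by simp
    ultimately show ?thesis by (simp add: dist_norm a_def b_def)
  qed
  have "Cauchy y"
  proof (rule metric_CauchyI)
    fix e :: real assume e: "0 < e"
    have "(\<lambda>n. (dist x (y n))\<^sup>2) \<longlonglongrightarrow> d\<^sup>2" using lim by (intro tendsto_intros)
    moreover have "d\<^sup>2 < d\<^sup>2 + e\<^sup>2 / 4" using e by simp
    ultimately have "\<forall>\<^sub>F n in sequentially. (dist x (y n))\<^sup>2 < d\<^sup>2 + e\<^sup>2 / 4"
      by (rule order_tendstoD)
    then obtain N where N: "\<And>n. n \<ge> N \<Longrightarrow> (dist x (y n))\<^sup>2 < d\<^sup>2 + e\<^sup>2 / 4"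
      by (auto simp: eventually_sequentially)
    have "dist (y m) (y n) < e" if "m \<ge> N" "n \<ge> N" for m n
    proof -
      have "(dist (y m) (y n))\<^sup>2 < e\<^sup>2" using par[of m n] N[OF that(1)] N[OF that(2)] by simp
      then show ?thesis using e by (simp add: power2_less_imp_less)
    qed
    then show "\<exists>M. \<forall>m\<ge>M. \<forall>n\<ge>M. dist (y m) (y n) < e" by blast
  qed
  then obtain p where p: "y \<longlonglongrightarrow> p" using Cauchy_convergent convergent_def by blast
  have pS: "p \<in> S" using closed_sequentially[OF assms(2) _ p] yS by blast
  have pd: "dist x p = d"
    using LIMSEQ_unique[OF tendsto_dist[OF tendsto_const p] lim] .
  define u where "u = x - p"
  have u0: "u \<noteq> 0" using pS assms(3) unfolding u_def by auto
  have re: "inner s u = 0" if s: "s \<in> S" for s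
  proof (rule ccontr)
    assume ne: "inner s u \<noteq> 0"
    then have s0: "0 < inner s s" by (metis inner_gt_zero_iff inner_zero_left)
    define t where "t = inner s u / inner s s"
    have "p + t *\<^sub>R s \<in> S" using Sadd Sr pS s by blast
    then have "d \<le> norm (u - t *\<^sub>R s)"
      using dle unfolding u_def by (simp add: dist_norm algebra_simps)
    then have "d\<^sup>2 \<le> (norm (u - t *\<^sub>R s))\<^sup>2" using d0 by (rule power_mono)
    also have "\<dots> = (norm u)\<^sup>2 - 2 * t * inner s u + t\<^sup>2 * inner s s"
      unfolding power2_norm_eq_inner
      by (simp add: inner_diff_left inner_diff_right inner_commute[of u s] power2_eq_square
          algebra_simps)
    also have "(norm u)\<^sup>2 = d\<^sup>2" using pd by (simp add: u_def dist_norm)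
    also have "d\<^sup>2 - 2 * t * inner s u + t\<^sup>2 * inner s s = d\<^sup>2 - (inner s u)\<^sup>2 / inner s s"
      unfolding t_def using s0 by (simp add: power2_eq_square field_simps)
    finally show False using ne s0 by (simp add: divide_le_0_iff)
  qed
  have "cinner s u = 0" if s: "s \<in> S" for s
  proof (rule complex_eqI)
    show "Re (cinner s u) = Re 0" using re[OF s] by (simp add: inner_eq_Re_cinner)
    have "cinner (\<i> *\<^sub>C s) u = cnj \<i> * cinner s u"
      by (metis cinner_commute cinner_scaleC_right complex_cnj_mult)
    moreover have "Re (cinner (\<i> *\<^sub>C s) u) = 0"
      using re[OF Sc[OF s, of \<i>]] by (simp add: inner_eq_Re_cinner)
    ultimately show "Im (cinner s u) = Im 0" by simp
  qed
  then show ?thesis using u0 by blast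
qed

lemma closure_span_subspace:
  "complex_vector.subspace (closure (complex_vector.span (E :: 'a::complex_inner set)))"
  unfolding complex_vector.subspace_def
proof (intro conjI ballI allI)
  have normC: "norm (c *\<^sub>C x) = cmod c * norm x" for c and x :: 'a
  proof -
    have "cinner (c *\<^sub>C x) (c *\<^sub>C x) = c * cnj (c * cinner x x)"
      by (metis cinner_commute cinner_scaleC_right)
    also have "\<dots> = of_real ((cmod c)\<^sup>2) * cinner x x"
      by (metis cinner_commute complex_cnj_mult complex_norm_square mult.assoc)
    finally have "(norm (c *\<^sub>C x))\<^sup>2 = (cmod c * norm x)\<^sup>2"
      by (simp add: power2_norm_eq_inner inner_eq_Re_cinner power_mult_distrib)
    then show ?thesis by (simp add: power2_eq_iff_nonneg)
  qed
  show "0 \<in> closure (complex_vector.span E)"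
    using closure_subset complex_vector.span_zero by blast
  fix x assume x: "x \<in> closure (complex_vector.span E)"
  then obtain xs where xs: "\<And>n. xs n \<in> complex_vector.span E" "xs \<longlonglongrightarrow> x"
    unfolding closure_sequential by blast
  show "x + y \<in> closure (complex_vector.span E)" if y: "y \<in> closure (complex_vector.span E)" for y
  proof -
    from y obtain ys where ys: "\<And>n. ys n \<in> complex_vector.span E" "ys \<longlonglongrightarrow> y"
      unfolding closure_sequential by blast
    show ?thesis unfolding closure_sequential
      by (rule exI[of _ "\<lambda>n. xs n + ys n"])
        (use xs ys in \<open>auto intro: tendsto_add complex_vector.span_add\<close>)
  qed
  show "c *\<^sub>C x \<in> closure (complex_vector.span E)" for c
  proof -
    have "bounded_linear (\<lambda>x :: 'a. c *\<^sub>C x)"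
      by (rule bounded_linear_intro[where K = "cmod c"])
        (simp_all add: scaleC_add_right normC mult.commute scaleC_scaleC flip: scaleC_of_real)
    from bounded_linear.tendsto[OF this xs(2)] show ?thesis
      unfolding closure_sequential
      by (intro exI[of _ "\<lambda>n. c *\<^sub>C xs n"]) (use xs in \<open>auto intro: complex_vector.span_scale\<close>)
  qed
qed

lemma ex_onb: "\<exists>E :: 'a::chilbert_space set. is_onb E"
proof -
  define ON where "ON E \<longleftrightarrow> (\<forall>e\<in>E. \<forall>f\<in>E. cinner e f = (if e = f then 1 else 0))"
    for E :: "'a set"
  have "\<exists>M\<in>{E. ON E}. \<forall>X\<in>{E. ON E}. M \<subseteq> X \<longrightarrow> X = M"
  proof (rule subset_Zorn')
    fix C assume C: "subset.chain {E. ON E} C"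
    have "ON (\<Union>C)" unfolding ON_def
    proof (intro ballI)
      fix e f assume "e \<in> \<Union>C" "f \<in> \<Union>C"
      then obtain A B where AB: "A \<in> C" "B \<in> C" "e \<in> A" "f \<in> B" by blast
      then have "A \<subseteq> B \<or> B \<subseteq> A" using C by (meson subset_chain_def)
      then obtain D where "D \<in> C" "e \<in> D" "f \<in> D" using AB by blast
      moreover from this C have "ON D" by (auto simp: subset_chain_def)
      ultimately show "cinner e f = (if e = f then 1 else 0)" unfolding ON_def by blast
    qed
    then show "\<Union>C \<in> {E. ON E}" by simp
  qed
  then obtain E where E: "ON E" and max: "\<And>X. ON X \<Longrightarrow> E \<subseteq> X \<Longrightarrow> X = E" by auto
  have "closure (complex_vector.span E) = UNIV"
  proof (rule ccontr)
    assume "\<not> ?thesis"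
    then obtain x where "x \<notin> closure (complex_vector.span E)" by blast
    from closed_subspace_orthogonal[OF closure_span_subspace closed_closure this]
    obtain u where u: "u \<noteq> 0" "\<And>s. s \<in> closure (complex_vector.span E) \<Longrightarrow> cinner s u = 0"
      by blast
    define v where "v = (1 / norm u) *\<^sub>R u"
    have vC: "v = complex_of_real (1 / norm u) *\<^sub>C u" unfolding v_def by (rule scaleC_of_real[symmetric])
    have ev: "cinner e v = 0" if "e \<in> E" for e
    proof -
      have "e \<in> closure (complex_vector.span E)"
        using that closure_subset complex_vector.span_base by blast
      then show ?thesis using u(2) by (simp add: vC cinner_scaleC_right)
    qed
    have "Re (cinner v v) = 1"
      using u(1) unfolding inner_eq_Re_cinner[symmetric] v_def
      by (simp flip: power2_norm_eq_inner add: power2_eq_square)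
    moreover have "Im (cinner v v) = 0"
      using arg_cong[OF cinner_commute[of v v], of Im] by simp
    ultimately have vv: "cinner v v = 1" by (simp add: complex_eq_iff)
    have "v \<notin> E" using ev vv by fastforce
    moreover have ve: "cinner v e = 0" if "e \<in> E" for e
      using ev[OF that] cinner_commute[of v e] by simp
    have "ON (insert v E)"
      using E ev vv ve unfolding ON_def by auto
    then have "insert v E = E" using max by blast
    ultimately show False by blast
  qed
  then show ?thesis using E unfolding is_onb_def ON_def by blast
qed

lemma is_onb_some_onb: "is_onb (some_onb :: 'a::chilbert_space set)"
  unfolding some_onb_def using ex_onb by (rule someI_ex)

lemma hs_diff:
  fixes A B :: "'a::complex_inner \<Rightarrow> 'a"
  assumes "hilbert_schmidt A" "hilbert_schmidt B"
  shows "hilbert_schmidt (\<lambda>x. A x - B x)"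
    and "hs_norm (\<lambda>x. A x - B x) \<le> hs_norm A + hs_norm B"
proof -
  let ?a = "\<lambda>e. (norm (A e))\<^sup>2" and ?b = "\<lambda>e. (norm (B e))\<^sup>2" and ?c = "\<lambda>e. (norm (A e - B e))\<^sup>2"
  have sA: "?a summable_on some_onb" and sB: "?b summable_on some_onb"
    using assms unfolding hilbert_schmidt_def by auto
  have fin: "sum ?c F \<le> (hs_norm A + hs_norm B)\<^sup>2" if F: "finite F" "F \<subseteq> some_onb" for F
  proof -
    have "L2_set (\<lambda>e. norm (A e - B e)) F \<le> L2_set (\<lambda>e. norm (A e) + norm (B e)) F"
      by (rule L2_set_mono) (auto intro: norm_triangle_ineq4)
    also have "\<dots> \<le> L2_set (\<lambda>e. norm (A e)) F + L2_set (\<lambda>e. norm (B e)) F"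
      by (rule L2_set_triangle_ineq)
    also have "\<dots> \<le> hs_norm A + hs_norm B"
      unfolding L2_set_def hs_norm_def using F
      by (intro add_mono real_sqrt_le_mono finite_sum_le_infsum sA sB) auto
    finally have "(L2_set (\<lambda>e. norm (A e - B e)) F)\<^sup>2 \<le> (hs_norm A + hs_norm B)\<^sup>2"
      by (rule power_mono) (rule L2_set_nonneg)
    then show ?thesis by (simp add: L2_set_def sum_nonneg)
  qed
  have sC: "?c summable_on some_onb"
    by (rule nonneg_bdd_above_summable_on) (use fin in \<open>auto intro!: bdd_aboveI2\<close>)
  have "bounded_clinear (\<lambda>x. A x - B x)"
    using assms unfolding hilbert_schmidt_def bounded_clinear_def
    by (auto intro: bounded_linear_sub simp: complex_vector.scale_right_diff_distrib)
  then show "hilbert_schmidt (\<lambda>x. A x - B x)" using sC unfolding hilbert_schmidt_def by simp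
  have "infsum ?c some_onb \<le> (hs_norm A + hs_norm B)\<^sup>2"
    by (rule infsum_le_finite_sums[OF sC fin])
  moreover have "0 \<le> hs_norm A + hs_norm B"
    unfolding hs_norm_def by (intro add_nonneg_nonneg real_sqrt_ge_zero infsum_nonneg) auto
  ultimately show "hs_norm (\<lambda>x. A x - B x) \<le> hs_norm A + hs_norm B"
    unfolding hs_norm_def[of "\<lambda>x. A x - B x"] by (rule real_le_lsqrt[rotated])
qed

lemma hs_norm_eq_0:
  fixes A :: "'a::chilbert_space \<Rightarrow> 'a"
  assumes "hilbert_schmidt A" "hs_norm A = 0"
  shows "A x = 0"
proof -
  have bl: "bounded_linear A" and C: "\<And>c x. A (c *\<^sub>C x) = c *\<^sub>C A x"
    and s: "(\<lambda>e. (norm (A e))\<^sup>2) summable_on some_onb"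
    using assms(1) unfolding hilbert_schmidt_def bounded_clinear_def by auto
  have E0: "A e = 0" if "e \<in> some_onb" for e
    using nonneg_infsum_le_0D[OF _ s _ that] assms(2) by (simp add: hs_norm_def)
  have sp: "complex_vector.span some_onb \<subseteq> {x. A x = 0}"
  proof (rule complex_vector.span_minimal)
    show "complex_vector.subspace {x. A x = 0}"
      unfolding complex_vector.subspace_def
      by (simp add: linear_simps[OF bl] C)
  qed (use E0 in auto)
  have "closed {x. A x = 0}"
    by (intro closed_Collect_eq continuous_intros linear_continuous_on[OF bl])
  from closure_minimal[OF sp this] show ?thesis
    using is_onb_some_onb[where 'a = 'a] unfolding is_onb_def by auto
qed

lemma Metric_space_hs:
  "Metric_space {A :: 'a::chilbert_space \<Rightarrow> 'a. hilbert_schmidt A} (\<lambda>A B. hs_norm (\<lambda>x. A x - B x))"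
proof
  fix A B C :: "'a \<Rightarrow> 'a"
  show "0 \<le> hs_norm (\<lambda>x. A x - B x)"
    unfolding hs_norm_def by (intro real_sqrt_ge_zero infsum_nonneg) auto
  show "hs_norm (\<lambda>x. A x - B x) = hs_norm (\<lambda>x. B x - A x)"
    unfolding hs_norm_def by (simp add: norm_minus_commute)
  assume "A \<in> {A. hilbert_schmidt A}" "B \<in> {A. hilbert_schmidt A}"
  then have AB: "hilbert_schmidt (\<lambda>x. A x - B x)" using hs_diff by blast
  show "hs_norm (\<lambda>x. A x - B x) = 0 \<longleftrightarrow> A = B"
    using hs_norm_eq_0[OF AB] by (auto simp: fun_eq_iff hs_norm_def)
  assume "C \<in> {A. hilbert_schmidt A}"
  then have CB: "hilbert_schmidt (\<lambda>x. C x - B x)" using hs_diff \<open>B \<in> _\<close> by blast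
  show "hs_norm (\<lambda>x. A x - C x) \<le> hs_norm (\<lambda>x. A x - B x) + hs_norm (\<lambda>x. B x - C x)"
    using hs_diff(2)[OF AB CB] unfolding hs_norm_def by (simp add: norm_minus_commute)
qed

section \<open>The Hilbert space of square integrable functions\<close>

definition square_integrable :: "('a::euclidean_space \<Rightarrow> complex) \<Rightarrow> bool" where
  "square_integrable f \<longleftrightarrow>
    f \<in> borel_measurable lborel \<and> integrable lborel (\<lambda>x. (norm (f x))\<^sup>2)"

definition l2_rel :: "('a::euclidean_space \<Rightarrow> complex) \<Rightarrow> ('a \<Rightarrow> complex) \<Rightarrow> bool" where
  "l2_rel f g \<longleftrightarrow> square_integrable f \<and> square_integrable g \<and> (AE x in lborel. f x = g x)"

lemma square_integrable_0: "square_integrable (\<lambda>_. 0)"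
  by (simp add: square_integrable_def)

quotient_type (overloaded) 'a l2 = "'a::euclidean_space \<Rightarrow> complex" / partial: l2_rel
proof (rule part_equivpI)
  show "\<exists>f :: 'a \<Rightarrow> complex. l2_rel f f"
    using square_integrable_0 by (auto simp: l2_rel_def)
  show "symp (l2_rel :: ('a \<Rightarrow> complex) \<Rightarrow> _)"
    by (intro sympI) (auto simp: l2_rel_def elim: eventually_mono)
  show "transp (l2_rel :: ('a \<Rightarrow> complex) \<Rightarrow> _)"
    by (intro transpI) (auto simp: l2_rel_def elim: eventually_elim2)
qed

lemma square_integrable_add:
  assumes "square_integrable f" "square_integrable g"
  shows "square_integrable (\<lambda>x. f x + g x)"
proof -
  have [measurable]: "f \<in> borel_measurable lborel" "g \<in> borel_measurable lborel"
    using assms by (auto simp: square_integrable_def)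
  have le: "(norm (a + b))\<^sup>2 \<le> 2 * (norm a)\<^sup>2 + 2 * (norm b)\<^sup>2" for a b :: complex
  proof -
    have "(norm (a + b))\<^sup>2 \<le> (norm a + norm b)\<^sup>2"
      by (intro power_mono norm_triangle_ineq) auto
    also have "\<dots> \<le> 2 * (norm a)\<^sup>2 + 2 * (norm b)\<^sup>2"
      using sum_squares_bound[of "norm a" "norm b"] by (simp add: power2_sum)
    finally show ?thesis .
  qed
  have "integrable lborel (\<lambda>x. 2 * (norm (f x))\<^sup>2 + 2 * (norm (g x))\<^sup>2)"
    using assms by (auto simp: square_integrable_def)
  then have "integrable lborel (\<lambda>x. (norm (f x + g x))\<^sup>2)"
    by (rule Bochner_Integration.integrable_bound) (auto intro: order_trans[OF le])
  then show ?thesis by (simp add: square_integrable_def)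
qed

lemma square_integrable_cmult:
  assumes "square_integrable f" shows "square_integrable (\<lambda>x. c * f x)"
  using assms by (auto simp: square_integrable_def norm_mult power_mult_distrib)

lemma integrable_cnj_mult:
  assumes "square_integrable f" "square_integrable g"
  shows "integrable lborel (\<lambda>x. cnj (f x) * g x)"
proof -
  have [measurable]: "f \<in> borel_measurable lborel" "g \<in> borel_measurable lborel"
    using assms by (auto simp: square_integrable_def)
  have "integrable lborel (\<lambda>x. (norm (f x))\<^sup>2 + (norm (g x))\<^sup>2)"
    using assms by (auto simp: square_integrable_def)
  moreover have "(\<lambda>x. cnj (f x) * g x) \<in> borel_measurable lborel"
    by (intro borel_measurable_times borel_measurable_continuous_on[OF continuous_on_cnj[OF continuous_on_id]])
      measurable
  moreover have "norm (cnj (f x) * g x) \<le> norm ((norm (f x))\<^sup>2 + (norm (g x))\<^sup>2)" for x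
  proof -
    have "0 \<le> norm (f x) * norm (g x)" by simp
    then have "norm (f x) * norm (g x) \<le> (norm (f x))\<^sup>2 + (norm (g x))\<^sup>2"
      using sum_squares_bound[of "norm (f x)" "norm (g x)"] by linarith
    then show ?thesis by (simp add: norm_mult)
  qed
  ultimately show ?thesis
    by (rule Bochner_Integration.integrable_bound[OF _ _ AE_I2])
qed

lift_definition l2_cinner :: "'a::euclidean_space l2 \<Rightarrow> 'a l2 \<Rightarrow> complex"
  is "\<lambda>f g. LINT x|lborel. cnj (f x) * g x"
proof -
  fix f f' g g' :: "'a \<Rightarrow> complex"
  assume "l2_rel f f'" "l2_rel g g'"
  moreover from this have "AE x in lborel. cnj (f x) * g x = cnj (f' x) * g' x"
    unfolding l2_rel_def by (auto elim: eventually_elim2)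
  ultimately show "(LINT x|lborel. cnj (f x) * g x) = (LINT x|lborel. cnj (f' x) * g' x)"
    by (intro integral_cong_AE borel_measurable_integrable integrable_cnj_mult)
      (auto simp: l2_rel_def)
qed

lift_definition l2_scale :: "complex \<Rightarrow> 'a::euclidean_space l2 \<Rightarrow> 'a l2" is "\<lambda>c f x. c * f x"
  by (auto simp: l2_rel_def square_integrable_cmult)

instantiation l2 :: (euclidean_space) ab_group_add
begin

lift_definition zero_l2 :: "'a l2" is "\<lambda>_. 0"
  by (simp add: l2_rel_def square_integrable_0)

lift_definition plus_l2 :: "'a l2 \<Rightarrow> 'a l2 \<Rightarrow> 'a l2" is "\<lambda>f g x. f x + g x"
  by (auto simp: l2_rel_def square_integrable_add elim: eventually_elim2)

definition uminus_l2 :: "'a l2 \<Rightarrow> 'a l2" where "uminus_l2 f = l2_scale (-1) f"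

definition minus_l2 :: "'a l2 \<Rightarrow> 'a l2 \<Rightarrow> 'a l2" where "minus_l2 f g = f + - g"

instance
proof
  fix a b c :: "'a l2"
  show "a + b + c = a + (b + c)"
    by transfer (auto simp: l2_rel_def add.assoc intro!: square_integrable_add)
  show "a + b = b + a"
    by transfer (auto simp: l2_rel_def add.commute intro!: square_integrable_add)
  show "0 + a = a" by transfer (auto simp: l2_rel_def)
  show "- a + a = 0" unfolding uminus_l2_def
    by transfer (auto simp: l2_rel_def square_integrable_0)
qed (simp add: minus_l2_def)

end

lemma l2_cinner_self:
  fixes f :: "'a::euclidean_space l2"
  shows "0 \<le> Re (l2_cinner f f)" and "Im (l2_cinner f f) = 0" and "l2_cinner f f = 0 \<longleftrightarrow> f = 0"
proof -
  have eq: "l2_cinner f f = of_real (LINT x|lborel. (norm (g x))\<^sup>2)"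
    if "rep_l2 f = g" for g
  proof -
    have "l2_cinner f f = (LINT x|lborel. complex_of_real ((norm (g x))\<^sup>2))"
      unfolding l2_cinner.rep_eq that by (intro Bochner_Integration.integral_cong) (auto simp: complex_norm_square mult.commute simp del: of_real_power)
    then show ?thesis by (simp only: integral_complex_of_real)
  qed
  show "0 \<le> Re (l2_cinner f f)" "Im (l2_cinner f f) = 0" by (simp_all add: eq[OF refl])
  show "l2_cinner f f = 0 \<longleftrightarrow> f = 0"
  proof transfer
    fix f :: "'a \<Rightarrow> complex" assume f: "l2_rel f f"
    then have int: "integrable lborel (\<lambda>x. (norm (f x))\<^sup>2)"
      by (simp add: l2_rel_def square_integrable_def)
    have "(LINT x|lborel. cnj (f x) * f x) = of_real (LINT x|lborel. (norm (f x))\<^sup>2)"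
      unfolding integral_complex_of_real[symmetric]
      by (intro Bochner_Integration.integral_cong) (auto simp: complex_norm_square mult.commute simp del: of_real_power)
    then have "(LINT x|lborel. cnj (f x) * f x) = 0 \<longleftrightarrow> (AE x in lborel. (norm (f x))\<^sup>2 = 0)"
      using integral_nonneg_eq_0_iff_AE[OF int] by simp
    then show "(LINT x|lborel. cnj (f x) * f x) = 0 \<longleftrightarrow> l2_rel f (\<lambda>_. 0)"
      using f by (simp add: l2_rel_def square_integrable_0)
  qed
qed

instantiation l2 :: (euclidean_space) complex_inner
begin

definition scaleC_l2 :: "complex \<Rightarrow> 'a l2 \<Rightarrow> 'a l2" where "scaleC_l2 = l2_scale"

definition cinner_l2 :: "'a l2 \<Rightarrow> 'a l2 \<Rightarrow> complex" where "cinner_l2 = l2_cinner"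

definition scaleR_l2 :: "real \<Rightarrow> 'a l2 \<Rightarrow> 'a l2" where "scaleR_l2 r = l2_scale (of_real r)"

definition inner_l2 :: "'a l2 \<Rightarrow> 'a l2 \<Rightarrow> real" where "inner_l2 f g = Re (l2_cinner f g)"

definition norm_l2 :: "'a l2 \<Rightarrow> real" where "norm_l2 f = sqrt (inner f f)"

definition sgn_l2 :: "'a l2 \<Rightarrow> 'a l2" where "sgn_l2 f = inverse (norm f) *\<^sub>R f"

definition dist_l2 :: "'a l2 \<Rightarrow> 'a l2 \<Rightarrow> real" where "dist_l2 f g = norm (f - g)"

definition uniformity_l2 :: "('a l2 \<times> 'a l2) filter" where
  "uniformity_l2 = (INF e\<in>{0<..}. principal {(f, g). dist f g < e})"

definition open_l2 :: "'a l2 set \<Rightarrow> bool" where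
  "open_l2 U \<longleftrightarrow> (\<forall>x\<in>U. eventually (\<lambda>(x', y). x' = x \<longrightarrow> y \<in> U) uniformity)"

instance
proof
  fix f g h :: "'a l2" and c d :: complex and r s :: real
  have add_right: "c *\<^sub>C (f + g) = c *\<^sub>C f + c *\<^sub>C g" for c and f g :: "'a l2"
    unfolding scaleC_l2_def
    by transfer (simp add: l2_rel_def distrib_left square_integrable_add square_integrable_cmult)
  have add_left: "(c + d) *\<^sub>C f = c *\<^sub>C f + d *\<^sub>C f" for c d and f :: "'a l2"
    unfolding scaleC_l2_def
    by transfer (simp add: l2_rel_def distrib_right square_integrable_add square_integrable_cmult)
  have scale: "c *\<^sub>C d *\<^sub>C f = (c * d) *\<^sub>C f" for c d and f :: "'a l2"
    unfolding scaleC_l2_def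
    by transfer (simp add: l2_rel_def mult.assoc square_integrable_cmult)
  have one: "1 *\<^sub>C f = f" for f :: "'a l2"
    unfolding scaleC_l2_def by transfer simp
  have of_real: "complex_of_real r *\<^sub>C f = r *\<^sub>R f" for r and f :: "'a l2"
    unfolding scaleC_l2_def scaleR_l2_def ..
  show "c *\<^sub>C (f + g) = c *\<^sub>C f + c *\<^sub>C g" "(c + d) *\<^sub>C f = c *\<^sub>C f + d *\<^sub>C f"
    "c *\<^sub>C d *\<^sub>C f = (c * d) *\<^sub>C f" "complex_of_real r *\<^sub>C f = r *\<^sub>R f"
    by (rule add_right add_left scale of_real)+
  show "r *\<^sub>R (f + g) = r *\<^sub>R f + r *\<^sub>R g" "(r + s) *\<^sub>R f = r *\<^sub>R f + s *\<^sub>R f"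
    "r *\<^sub>R s *\<^sub>R f = (r * s) *\<^sub>R f" "1 *\<^sub>R f = f"
    by (simp_all add: add_right add_left scale one flip: of_real)
  have cadd: "cinner f (g + h) = cinner f g + cinner f h" for f g h :: "'a l2"
    unfolding cinner_l2_def
    by transfer (auto simp: l2_rel_def distrib_left intro!: Bochner_Integration.integral_add integrable_cnj_mult)
  have cscale: "cinner f (c *\<^sub>C g) = c * cinner f g" for c and f g :: "'a l2"
    unfolding cinner_l2_def scaleC_l2_def
    by transfer (simp add: mult.left_commute)
  have ccomm: "cinner f g = cnj (cinner g f)" for f g :: "'a l2"
    unfolding cinner_l2_def
    by transfer (simp add: mult.commute flip: Bochner_Integration.integral_cnj)
  show "cinner f (g + h) = cinner f g + cinner f h" "cinner f (c *\<^sub>C g) = c * cinner f g"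
    by (rule cadd cscale)+
  show "cinner f g = cnj (cinner g f)" by (rule ccomm)
  have re: "inner f g = Re (cinner f g)" for f g :: "'a l2"
    by (simp add: inner_l2_def cinner_l2_def)
  show "inner f g = Re (cinner f g)" by (rule re)
  show comm: "inner f g = inner g f"
    unfolding re ccomm[of f g] by simp
  show "inner (f + g) h = inner f h + inner g h"
    unfolding re ccomm[of "f + g" h] ccomm[of f h] ccomm[of g h] cadd by simp
  show "inner (r *\<^sub>R f) g = r * inner f g"
    unfolding re of_real[symmetric] ccomm[of "complex_of_real r *\<^sub>C f" g] ccomm[of f g] cscale
    by simp
  show "0 \<le> inner f f" by (simp add: inner_l2_def l2_cinner_self)
  show "inner f f = 0 \<longleftrightarrow> f = 0"
    unfolding l2_cinner_self(3)[symmetric] by (simp add: inner_l2_def complex_eq_iff l2_cinner_self(2))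
qed (rule norm_l2_def sgn_l2_def dist_l2_def uniformity_l2_def open_l2_def)+

end

lemma square_integrable_rep: "square_integrable (rep_l2 f)"
  using Quotient_rep_reflp[OF Quotient_l2, of f] by (simp add: l2_rel_def)

lemma l2_rel_refl: "square_integrable f \<Longrightarrow> l2_rel f f"
  by (simp add: l2_rel_def)

lemma norm_abs_l2:
  assumes "square_integrable f"
  shows "(\<integral>\<^sup>+x. ennreal ((norm (f x))\<^sup>2) \<partial>lborel) = ennreal ((norm (abs_l2 f))\<^sup>2)"
proof -
  have "l2_cinner (abs_l2 f) (abs_l2 f) = (LINT x|lborel. complex_of_real ((norm (f x))\<^sup>2))"
    unfolding l2_cinner.abs_eq[OF l2_rel_refl[OF assms] l2_rel_refl[OF assms]]
    by (intro Bochner_Integration.integral_cong)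
      (auto simp: complex_norm_square mult.commute simp del: of_real_power)
  then have "(norm (abs_l2 f))\<^sup>2 = (LINT x|lborel. (norm (f x))\<^sup>2)"
    unfolding integral_complex_of_real by (simp add: norm_l2_def inner_l2_def)
  then show ?thesis
    using assms by (simp add: nn_integral_eq_integral square_integrable_def)
qed

lemma square_integrable_nn:
  assumes "f \<in> borel_measurable lborel" "(\<integral>\<^sup>+x. ennreal ((norm (f x))\<^sup>2) \<partial>lborel) < \<infinity>"
  shows "square_integrable f"
  using assms by (auto simp: square_integrable_def intro!: integrableI_nonneg)

lemma square_integrable_diff:
  "square_integrable f \<Longrightarrow> square_integrable g \<Longrightarrow> square_integrable (\<lambda>x. f x - g x)"
  using square_integrable_add[OF _ square_integrable_cmult[of g "-1"], of f] by simp

lemma abs_l2_diff: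
  assumes "square_integrable f" "square_integrable g"
  shows "abs_l2 (\<lambda>x. f x - g x) = abs_l2 f - abs_l2 g"
  unfolding minus_l2_def uminus_l2_def
  by (simp add: l2_scale.abs_eq plus_l2.abs_eq l2_rel_refl assms square_integrable_cmult[of g "-1", simplified])

instance l2 :: (euclidean_space) chilbert_space
proof
  fix X :: "nat \<Rightarrow> 'a l2"
  assume X: "Cauchy X"
  define F where "F n = rep_l2 (X n)" for n
  have Fsq: "square_integrable (F n)" for n unfolding F_def by (rule square_integrable_rep)
  have [measurable]: "F n \<in> borel_measurable lborel" for n
    using Fsq by (simp add: square_integrable_def)
  have XF: "X n = abs_l2 (F n)" for n unfolding F_def by (simp add: Quotient_abs_rep[OF Quotient_l2])
  have XFd: "abs_l2 (\<lambda>x. F m x - F n x) = X m - X n" for m n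
    unfolding XF by (rule abs_l2_diff[OF Fsq Fsq])
  have "\<exists>N. \<forall>m\<ge>N. \<forall>n\<ge>N. dist (X m) (X n) < (1/2)^k" for k :: nat
    using X by (intro metric_CauchyD) auto
  then obtain N where N: "\<And>k m n. m \<ge> N k \<Longrightarrow> n \<ge> N k \<Longrightarrow> dist (X m) (X n) < (1/2)^k"
    by metis
  define r where "r k = k + (\<Sum>i\<le>k. N i)" for k
  have rN: "N k \<le> r k" for k
    unfolding r_def using member_le_sum[of k "{..k}" N] by simp
  have rS: "N k \<le> r (Suc k)" for k using rN[of k] by (simp add: r_def)
  have rk: "k \<le> r k" for k by (simp add: r_def)
  have step: "norm (X (r (Suc k)) - X (r k)) \<le> (1/2)^k" for k
    using N[OF rS rN] by (simp add: dist_norm less_imp_le)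
  define g where "g k = F (r k)" for k
  have gsq: "square_integrable (g k)" for k unfolding g_def by (rule Fsq)
  have [measurable]: "g k \<in> borel_measurable lborel" for k by (simp add: g_def)
  define G where "G n x = (\<Sum>k<n. norm (g (Suc k) x - g k x))" for n x
  have [measurable]: "G n \<in> borel_measurable lborel" for n unfolding G_def by measurable
  have G: "square_integrable (\<lambda>x. complex_of_real (G n x)) \<and>
      norm (abs_l2 (\<lambda>x. complex_of_real (G n x))) \<le> (\<Sum>k<n. (1/2)^k)" for n
  proof (induction n)
    case 0
    then show ?case
      by (simp add: G_def square_integrable_0 flip: zero_l2_def)
  next
    case (Suc n)
    define h where "h x = complex_of_real (norm (g (Suc n) x - g n x))" for x
    have d: "square_integrable (\<lambda>x. g (Suc n) x - g n x)" by (rule square_integrable_diff[OF gsq gsq])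
    then have h: "square_integrable h"
      by (simp add: h_def[abs_def] square_integrable_def)
    have "ennreal ((norm (abs_l2 h))\<^sup>2) = ennreal ((norm (abs_l2 (\<lambda>x. g (Suc n) x - g n x)))\<^sup>2)"
      unfolding norm_abs_l2[OF d, symmetric] norm_abs_l2[OF h, symmetric] by (simp add: h_def)
    then have "norm (abs_l2 h) = norm (abs_l2 (\<lambda>x. g (Suc n) x - g n x))" by simp
    also have "\<dots> \<le> (1/2)^n" unfolding g_def XFd by (rule step)
    finally have hn: "norm (abs_l2 h) \<le> (1/2)^n" .
    have eq: "(\<lambda>x. complex_of_real (G (Suc n) x)) = (\<lambda>x. complex_of_real (G n x) + h x)"
      by (simp add: G_def h_def)
    have "abs_l2 (\<lambda>x. complex_of_real (G (Suc n) x)) = abs_l2 (\<lambda>x. complex_of_real (G n x)) + abs_l2 h"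
      unfolding eq using Suc.IH h by (intro plus_l2.abs_eq[symmetric] l2_rel_refl) auto
    then have "norm (abs_l2 (\<lambda>x. complex_of_real (G (Suc n) x))) \<le> (\<Sum>k<Suc n. (1/2)^k)"
      using Suc.IH hn by (auto intro: order_trans[OF norm_triangle_ineq])
    then show ?case using Suc.IH h unfolding eq by (auto intro: square_integrable_add)
  qed
  have Gle: "(\<integral>\<^sup>+x. ennreal ((G n x)\<^sup>2) \<partial>lborel) \<le> 4" for n
  proof -
    have "(\<Sum>k<n. (1/2)^k) \<le> (2::real)"
      using geometric_sum_less[of "1/2::real" "{..<n}"] by simp
    then have "norm (abs_l2 (\<lambda>x. complex_of_real (G n x))) \<le> 2" using G[of n] by linarith
    then have "(norm (abs_l2 (\<lambda>x. complex_of_real (G n x))))\<^sup>2 \<le> 2\<^sup>2"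
      by (rule power_mono) simp
    then have "ennreal ((norm (abs_l2 (\<lambda>x. complex_of_real (G n x))))\<^sup>2) \<le> ennreal 4"
      by (intro ennreal_leI) simp
    then show ?thesis using norm_abs_l2[of "\<lambda>x. complex_of_real (G n x)"] G[of n] by simp
  qed
  have G0: "0 \<le> G n x" for n x by (simp add: G_def sum_nonneg)
  have Gmono: "G m x \<le> G n x" if "m \<le> n" for m n x
    unfolding G_def using that by (intro sum_mono2) auto
  have "(\<integral>\<^sup>+x. (SUP n. ennreal ((G n x)\<^sup>2)) \<partial>lborel) = (SUP n. \<integral>\<^sup>+x. ennreal ((G n x)\<^sup>2) \<partial>lborel)"
    by (intro nn_integral_monotone_convergence_SUP)
      (auto simp: incseq_def le_fun_def intro!: ennreal_leI power_mono Gmono G0)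
  also have "\<dots> \<le> 4" by (rule SUP_least) (rule Gle)
  also have "\<dots> < \<infinity>" by simp
  finally have "AE x in lborel. (SUP n. ennreal ((G n x)\<^sup>2)) \<noteq> \<infinity>"
    by (intro nn_integral_PInf_AE) auto
  then have conv: "AE x in lborel. convergent (\<lambda>k. g k x)"
  proof eventually_elim
    case (elim x)
    then obtain b where b: "b \<ge> 0" "(SUP n. ennreal ((G n x)\<^sup>2)) = ennreal b"
      by (cases "SUP n. ennreal ((G n x)\<^sup>2)") auto
    have "(G n x)\<^sup>2 \<le> b" for n
    proof -
      have "ennreal ((G n x)\<^sup>2) \<le> ennreal b" unfolding b(2)[symmetric] by (rule SUP_upper) simp
      then show ?thesis using b(1) by simp
    qed
    then have "G n x \<le> sqrt b" for n by (rule real_le_rsqrt)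
    then have "summable (\<lambda>k. norm (g (Suc k) x - g k x))"
      unfolding G_def by (intro summableI_nonneg_bounded[where x = "sqrt b"]) auto
    then have "summable (\<lambda>k. g (Suc k) x - g k x)" by (rule summable_norm_cancel)
    then have "convergent (\<lambda>n. \<Sum>k<n. g (Suc k) x - g k x)" by (simp add: summable_iff_convergent)
    then have "convergent (\<lambda>n. g n x - g 0 x)"
      unfolding sum_lessThan_telescope[of "\<lambda>k. g k x"] .
    then have "convergent (\<lambda>n. (g n x - g 0 x) + g 0 x)" by (intro convergent_add convergent_const)
    then show ?case by simp
  qed
  define f where "f x = lim (\<lambda>k. g k x)" for x
  have [measurable]: "f \<in> borel_measurable lborel" unfolding f_def by measurable
  have lim: "AE x in lborel. (\<lambda>k. g k x) \<longlonglongrightarrow> f x"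
    using conv by eventually_elim (simp add: f_def convergent_LIMSEQ_iff)
  have close: "square_integrable (\<lambda>x. f x - g m x) \<and> (norm (abs_l2 (\<lambda>x. f x - g m x)))\<^sup>2 \<le> e\<^sup>2"
    if e: "\<And>k. k \<ge> M \<Longrightarrow> norm (X (r k) - X (r m)) \<le> e" for e M m
  proof -
    have "(\<integral>\<^sup>+x. ennreal ((norm (f x - g m x))\<^sup>2) \<partial>lborel) =
        (\<integral>\<^sup>+x. liminf (\<lambda>k. ennreal ((norm (g k x - g m x))\<^sup>2)) \<partial>lborel)"
    proof (rule nn_integral_cong_AE)
      show "AE x in lborel. ennreal ((norm (f x - g m x))\<^sup>2) = liminf (\<lambda>k. ennreal ((norm (g k x - g m x))\<^sup>2))"
        using lim
      proof eventually_elim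
        case (elim x)
        then have "(\<lambda>k. ennreal ((norm (g k x - g m x))\<^sup>2)) \<longlonglongrightarrow> ennreal ((norm (f x - g m x))\<^sup>2)"
          by (intro tendsto_intros)
        then show ?case by (intro lim_imp_Liminf[symmetric]) auto
      qed
    qed
    also have "\<dots> \<le> liminf (\<lambda>k. \<integral>\<^sup>+x. ennreal ((norm (g k x - g m x))\<^sup>2) \<partial>lborel)"
      by (rule nn_integral_liminf) measurable
    also have "\<dots> \<le> ennreal (e\<^sup>2)"
    proof (rule Liminf_le)
      show "\<forall>\<^sub>F k in sequentially. (\<integral>\<^sup>+x. ennreal ((norm (g k x - g m x))\<^sup>2) \<partial>lborel) \<le> ennreal (e\<^sup>2)"
        using eventually_ge_at_top[of M]
      proof eventually_elim
        case (elim k)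
        show ?case
          unfolding norm_abs_l2[OF square_integrable_diff[OF gsq gsq]]
          unfolding g_def XFd using e[OF elim] by (intro ennreal_leI power_mono) auto
      qed
    qed simp
    finally have le: "(\<integral>\<^sup>+x. ennreal ((norm (f x - g m x))\<^sup>2) \<partial>lborel) \<le> ennreal (e\<^sup>2)" .
    then have sq: "square_integrable (\<lambda>x. f x - g m x)"
      by (intro square_integrable_nn) (auto intro: le_less_trans)
    then show ?thesis using le by (simp add: norm_abs_l2)
  qed
  have fsq: "square_integrable f"
  proof -
    have "square_integrable (\<lambda>x. f x - g 0 x)"
    proof (rule conjunct1[OF close[of "N 0" 0 1]])
      fix k assume "N 0 \<le> k"
      then have "dist (X (r k)) (X (r 0)) < 1" using N[of 0 "r k" "r 0"] rN[of 0] rk[of k] by simp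
      then show "norm (X (r k) - X (r 0)) \<le> 1" by (simp add: dist_norm)
    qed
    from square_integrable_add[OF this gsq[of 0]] show ?thesis by simp
  qed
  have "X \<longlonglongrightarrow> abs_l2 f"
  proof (rule metric_LIMSEQ_I)
    fix e :: real assume e: "0 < e"
    then obtain M where M: "\<And>m n. m \<ge> M \<Longrightarrow> n \<ge> M \<Longrightarrow> dist (X m) (X n) < e / 3"
      using metric_CauchyD[OF X, of "e / 3"] by auto
    have "dist (X n) (abs_l2 f) < e" if n: "n \<ge> M" for n
    proof -
      have "(norm (abs_l2 (\<lambda>x. f x - g n x)))\<^sup>2 \<le> (e / 3)\<^sup>2"
      proof (rule conjunct2[OF close[of M]])
        fix k assume "M \<le> k"
        then have "dist (X (r k)) (X (r n)) < e / 3" using M n rk[of k] rk[of n] by (meson le_trans)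
        then show "norm (X (r k) - X (r n)) \<le> e / 3" by (simp add: dist_norm)
      qed
      then have "norm (abs_l2 f - X (r n)) \<le> e / 3"
        unfolding abs_l2_diff[OF fsq gsq] using e by (simp add: power2_le_iff_abs_le XF g_def)
      moreover have "dist (X n) (X (r n)) < e / 3"
        using M n rk[of n] by (meson le_trans)
      ultimately show ?thesis
        using dist_triangle[of "X n" "abs_l2 f" "X (r n)"] e by (simp add: dist_norm norm_minus_commute)
    qed
    then show "\<exists>no. \<forall>n\<ge>no. dist (X n) (abs_l2 f) < e" by blast
  qed
  then show "convergent X" by (rule convergentI)
qed

section \<open>Weyl operators and thermal states\<close>

text \<open>A point \<open>z = (p, q)\<close> of phase space stands for \<open>\<beta> = p + \<i> q\<close>. With
  \<open>a\<^sub>j = (x\<^sub>j + \<partial>\<^sub>j) / sqrt 2\<close> and \<open>a\<^sub>j\<^sup>* = (x\<^sub>j - \<partial>\<^sub>j) / sqrt 2\<close>, the operator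
  \<open>exp (\<Sum>\<^sub>j \<beta>\<^sub>j a\<^sub>j\<^sup>* - cnj \<beta>\<^sub>j a\<^sub>j)\<close> is the following modulated translation: by
  \<open>displacement_group\<close> and \<open>displacement_generator\<close> below, \<open>t \<mapsto> U\<^bsub>tz\<^esub>\<close> is the
  one-parameter group generated by that exponent.\<close>

definition displacement :: "'a \<times> 'a \<Rightarrow> ('a::euclidean_space \<Rightarrow> complex) \<Rightarrow> 'a \<Rightarrow> complex" where
  "displacement z f x =
    cis (sqrt 2 * (snd z \<bullet> x) - fst z \<bullet> snd z) * f (x - sqrt 2 *\<^sub>R fst z)"

definition annihilation :: "'a \<Rightarrow> ('a::euclidean_space \<Rightarrow> complex) \<Rightarrow> 'a \<Rightarrow> complex" where
  "annihilation j f x = (of_real (x \<bullet> j) * f x + frechet_derivative f (at x) j) / of_real (sqrt 2)"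

definition creation :: "'a \<Rightarrow> ('a::euclidean_space \<Rightarrow> complex) \<Rightarrow> 'a \<Rightarrow> complex" where
  "creation j f x = (of_real (x \<bullet> j) * f x - frechet_derivative f (at x) j) / of_real (sqrt 2)"

lemma displacement_group:
  "displacement (s *\<^sub>R z) (displacement (t *\<^sub>R z) f) = displacement ((s + t) *\<^sub>R z) f"
proof
  fix x :: 'a
  obtain p q where z: "z = (p, q)" by (cases z)
  have phase: "sqrt 2 * (s * (q \<bullet> x)) - s * (s * (p \<bullet> q)) +
      (sqrt 2 * (t * (q \<bullet> (x - (sqrt 2 * s) *\<^sub>R p))) - t * (t * (p \<bullet> q))) =
      sqrt 2 * ((s + t) * (q \<bullet> x)) - (s + t) * ((s + t) * (p \<bullet> q))"
    by (simp add: inner_diff_right inner_commute[of q p] algebra_simps)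
  have shift: "x - (sqrt 2 * s) *\<^sub>R p - (sqrt 2 * t) *\<^sub>R p = x - (sqrt 2 * (s + t)) *\<^sub>R p"
    by (simp add: distrib_left scaleR_add_left)
  have cis: "cis a * (cis b * w) = cis (a + b) * w" for a b w
    by (simp add: cis_mult flip: mult.assoc)
  show "displacement (s *\<^sub>R z) (displacement (t *\<^sub>R z) f) x = displacement ((s + t) *\<^sub>R z) f x"
    by (simp add: displacement_def z cis phase shift)
qed

lemma ladder_combination:
  fixes r P Q X G d :: complex
  assumes "r * r = 2"
  shows "(P + \<i> * Q) * ((X * G - d) / r) - (P - \<i> * Q) * ((X * G + d) / r) =
    \<i> * (r * Q * X) * G - r * P * d"
proof -
  have "r \<noteq> 0" using assms by auto
  then have "inverse r * (r * r) = r" by simp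
  then have "inverse r = r / 2" unfolding assms by simp
  then show ?thesis unfolding divide_inverse by (simp add: algebra_simps)
qed

lemma displacement_generator:
  fixes f :: "'a::euclidean_space \<Rightarrow> complex"
  assumes f: "\<And>x. f differentiable (at x)"
  defines "\<beta> \<equiv> \<lambda>z j. Complex (fst z \<bullet> j) (snd z \<bullet> j)"
  shows "((\<lambda>t. displacement (t *\<^sub>R z) f x) has_vector_derivative
    (\<Sum>j\<in>Basis. \<beta> z j * creation j (displacement (t *\<^sub>R z) f) x
      - cnj (\<beta> z j) * annihilation j (displacement (t *\<^sub>R z) f) x)) (at t)"
proof -
  obtain p q where z: "z = (p, q)" by (cases z)
  define D where "D y = frechet_derivative f (at y)" for y
  have D: "(f has_derivative D y) (at y)" for y
    using f[of y] unfolding D_def frechet_derivative_works .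
  have Dl: "linear (D y)" for y using D has_derivative_linear by blast
  define y where "y = x - sqrt 2 *\<^sub>R (t *\<^sub>R p)"
  define c where "c = cis (sqrt 2 * ((t *\<^sub>R q) \<bullet> x) - (t *\<^sub>R p) \<bullet> (t *\<^sub>R q))"
  define g where "g = displacement (t *\<^sub>R z) f"
  have gx: "g x = c * f y" unfolding g_def displacement_def z c_def y_def by simp
  have gd: "(g has_derivative (\<lambda>h. \<i> * of_real (sqrt 2 * t * (q \<bullet> h)) * g x + c * D y h)) (at x)"
  proof -
    have "((\<lambda>x. f (x - sqrt 2 *\<^sub>R (t *\<^sub>R p))) has_derivative (\<lambda>h. D y h)) (at x)"
    proof -
      have "((\<lambda>x. x - sqrt 2 *\<^sub>R (t *\<^sub>R p)) has_derivative (\<lambda>h. h)) (at x)"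
        by (auto intro!: derivative_eq_intros)
      from has_derivative_compose[OF this D[of y, unfolded y_def]] show ?thesis
        unfolding y_def .
    qed
    moreover have "((\<lambda>x. cis (sqrt 2 * ((t *\<^sub>R q) \<bullet> x) - (t *\<^sub>R p) \<bullet> (t *\<^sub>R q))) has_derivative
        (\<lambda>h. \<i> * of_real (sqrt 2 * t * (q \<bullet> h)) * c)) (at x)"
      unfolding c_def
      by (auto intro!: derivative_eq_intros simp: fun_eq_iff algebra_simps scaleR_conv_of_real)
    ultimately have "((\<lambda>x. cis (sqrt 2 * ((t *\<^sub>R q) \<bullet> x) - (t *\<^sub>R p) \<bullet> (t *\<^sub>R q)) *
        f (x - sqrt 2 *\<^sub>R (t *\<^sub>R p))) has_derivative
        (\<lambda>h. c * D y h + \<i> * of_real (sqrt 2 * t * (q \<bullet> h)) * c * f y)) (at x)"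
      unfolding c_def y_def by (rule has_derivative_mult[rotated])
    then show ?thesis
      unfolding gx unfolding g_def displacement_def[abs_def] z by (simp add: algebra_simps)
  qed
  from frechet_derivative_at[OF gd]
  have gfd: "frechet_derivative g (at x) = (\<lambda>h. \<i> * of_real (sqrt 2 * t * (q \<bullet> h)) * g x + c * D y h)"
    by simp
  have "\<beta> z j * creation j g x - cnj (\<beta> z j) * annihilation j g x =
      \<i> * of_real (sqrt 2 * (q \<bullet> j) * (x \<bullet> j)) * g x
      - of_real (sqrt 2 * (p \<bullet> j)) * frechet_derivative g (at x) j" for j
  proof -
    define r where "r = complex_of_real (sqrt 2)"
    have r: "r * r = 2" unfolding r_def by (simp flip: of_real_mult)
    show ?thesis
      using ladder_combination[OF r, of "of_real (p \<bullet> j)" "of_real (q \<bullet> j)" "of_real (x \<bullet> j)"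
          "g x" "frechet_derivative g (at x) j"]
      unfolding creation_def annihilation_def \<beta>_def z r_def by (simp add: Complex_eq)
  qed
  then have "(\<Sum>j\<in>Basis. \<beta> z j * creation j g x - cnj (\<beta> z j) * annihilation j g x) =
      (\<Sum>j\<in>Basis. \<i> * of_real (sqrt 2 * (q \<bullet> j) * (x \<bullet> j)) * g x
        - of_real (sqrt 2 * (p \<bullet> j)) * frechet_derivative g (at x) j)" by simp
  also have "\<dots> = \<i> * of_real (sqrt 2 * (q \<bullet> x)) * g x - of_real (sqrt 2) * frechet_derivative g (at x) p"
  proof -
    have "linear (frechet_derivative g (at x))"
      using gd gfd has_derivative_linear by metis
    then have "frechet_derivative g (at x) p = (\<Sum>j\<in>Basis. of_real (p \<bullet> j) * frechet_derivative g (at x) j)"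
      by (subst euclidean_representation[of p, symmetric])
        (simp add: linear_sum linear_scale scaleR_conv_of_real del: euclidean_representation)
    moreover have "q \<bullet> x = (\<Sum>j\<in>Basis. (q \<bullet> j) * (x \<bullet> j))" by (rule euclidean_inner)
    ultimately show ?thesis
      by (simp add: sum_subtractf sum_distrib_left sum_distrib_right mult.assoc)
  qed
  also have "\<dots> = \<i> * of_real (sqrt 2 * (q \<bullet> x) - 2 * t * (p \<bullet> q)) * g x - of_real (sqrt 2) * (c * D y p)"
  proof -
    have "complex_of_real (sqrt 2) * complex_of_real (sqrt 2) = 2" by (simp flip: of_real_mult)
    then show ?thesis unfolding gfd by (simp add: algebra_simps inner_commute)
  qed
  finally have eq: "(\<Sum>j\<in>Basis. \<beta> z j * creation j g x - cnj (\<beta> z j) * annihilation j g x) =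
    \<i> * of_real (sqrt 2 * (q \<bullet> x) - 2 * t * (p \<bullet> q)) * g x - of_real (sqrt 2) * (c * D y p)" .
  have "((\<lambda>t. f (x - sqrt 2 *\<^sub>R (t *\<^sub>R p))) has_derivative (\<lambda>h. D y (- sqrt 2 *\<^sub>R (h *\<^sub>R p)))) (at t)"
  proof -
    have "((\<lambda>t. x - sqrt 2 *\<^sub>R (t *\<^sub>R p)) has_derivative (\<lambda>h. - sqrt 2 *\<^sub>R (h *\<^sub>R p))) (at t)"
      by (auto intro!: derivative_eq_intros)
    from has_derivative_compose[OF this D[of y, unfolded y_def]] show ?thesis
      unfolding y_def .
  qed
  then have "((\<lambda>t. f (x - sqrt 2 *\<^sub>R (t *\<^sub>R p))) has_vector_derivative (- of_real (sqrt 2) * D y p)) (at t)"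
    unfolding has_vector_derivative_def
    by (simp add: linear_scale[OF Dl] linear_neg[OF Dl] scaleR_conv_of_real mult_ac)
  moreover have "((\<lambda>t. cis (sqrt 2 * ((t *\<^sub>R q) \<bullet> x) - (t *\<^sub>R p) \<bullet> (t *\<^sub>R q))) has_vector_derivative
      \<i> * of_real (sqrt 2 * (q \<bullet> x) - 2 * t * (p \<bullet> q)) * c) (at t)"
    unfolding c_def has_vector_derivative_def
    by (auto intro!: derivative_eq_intros simp: fun_eq_iff algebra_simps scaleR_conv_of_real)
  ultimately have "((\<lambda>t. cis (sqrt 2 * ((t *\<^sub>R q) \<bullet> x) - (t *\<^sub>R p) \<bullet> (t *\<^sub>R q)) *
      f (x - sqrt 2 *\<^sub>R (t *\<^sub>R p))) has_vector_derivative
      c * (- of_real (sqrt 2) * D y p) + \<i> * of_real (sqrt 2 * (q \<bullet> x) - 2 * t * (p \<bullet> q)) * c * f y) (at t)"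
    unfolding c_def y_def by (rule has_vector_derivative_mult[rotated])
  then show ?thesis
    unfolding g_def[symmetric] eq gx by (simp add: displacement_def z algebra_simps)
qed

lift_definition weyl :: "'a \<times> 'a \<Rightarrow> 'a::euclidean_space l2 \<Rightarrow> 'a l2" is displacement
proof -
  fix z :: "'a \<times> 'a" and f g :: "'a \<Rightarrow> complex"
  assume fg: "l2_rel f g"
  define c where "c = - sqrt 2 *\<^sub>R fst z"
  have meas: "(\<lambda>x. c + x) \<in> measurable lborel borel" by simp
  have sq: "square_integrable (displacement z h)" if "square_integrable h" for h :: "'a \<Rightarrow> complex"
  proof -
    have h [measurable]: "h \<in> borel_measurable borel" and i: "integrable lborel (\<lambda>x. (norm (h x))\<^sup>2)"
      using that by (auto simp: square_integrable_def)
    have "integrable (distr lborel borel (\<lambda>x. c + x)) (\<lambda>x. (norm (h x))\<^sup>2)"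
      unfolding lborel_distr_plus by (rule i)
    then have "integrable lborel (\<lambda>x. (norm (h (c + x)))\<^sup>2)"
      by (subst (asm) integrable_distr_eq) auto
    moreover have "displacement z h \<in> borel_measurable lborel"
      unfolding displacement_def[abs_def] cis_conv_exp by measurable
    ultimately show ?thesis
      by (simp add: square_integrable_def displacement_def norm_mult c_def)
  qed
  have "AE x in distr lborel borel (\<lambda>x. c + x). f x = g x"
    unfolding lborel_distr_plus using fg by (simp add: l2_rel_def)
  then have "AE x in lborel. f (c + x) = g (c + x)"
    by (rule AE_distrD[OF meas])
  then have "AE x in lborel. displacement z f x = displacement z g x"
    by eventually_elim (simp add: displacement_def c_def)
  then show "l2_rel (displacement z f) (displacement z g)"
    using fg sq by (auto simp: l2_rel_def)
qed

definition char_fun :: "('a::euclidean_space l2 \<Rightarrow> 'a l2) \<Rightarrow> 'a \<times> 'a \<Rightarrow> complex" where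
  "char_fun A z = op_trace (A \<circ> cadjoint (weyl z))"

text \<open>\<open>norm z\<close> is the Euclidean norm, \<open>(norm (p, q))\<^sup>2 = (norm p)\<^sup>2 + (norm q)\<^sup>2\<close>.\<close>

definition thermal_state :: "real \<Rightarrow> 'a::euclidean_space l2 \<Rightarrow> 'a l2" where
  "thermal_state m = (THE A. trace_class A \<and>
    (\<forall>z. char_fun A z = complex_of_real (exp (- (m + 1 / 2) * (norm z)\<^sup>2))))"

end

theory Submission
  imports Defs "HOL-Probability.Probability"
begin

text \<open>A thermal state is the Gaussian average of the coherent state projections
  \<open>|\<surd>m \<omega>\<rangle>\<langle>\<surd>m \<omega>|\<close>. Since coherent states depend continuously on their label, dominated convergence
  makes \<open>m \<mapsto> \<rho>\<^sub>m\<close> continuous in Hilbert--Schmidt norm, so the family is the continuous image of a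
  compact interval. That the average is \<open>\<rho>\<^sub>m\<close> needs injectivity of \<open>A \<mapsto> \<chi>\<^sub>A\<close> on trace class
  operators: a Cholesky decomposition of \<open>|A|\<close> gives \<open>A = \<Sum>\<^sub>k |u\<^sub>k\<rangle>\<langle>v\<^sub>k|\<close> with square summable
  norms, and then \<open>\<chi>\<^sub>A (p, q)\<close> is, up to a phase, the Fourier transform in \<open>q\<close> of the diagonal
  \<open>x \<mapsto> K (x + \<surd>2 p, x)\<close> of the integral kernel, which it determines almost everywhere.\<close>

section \<open>Complex Hilbert spaces\<close>

text \<open>The definite description in \<open>thermal_state\<close> gives no handle on the
  operator: a trace class candidate with the right characteristic function has to be produced and
  shown to be the only one. In the mixture, the map
  \<open>\<omega> \<mapsto> \<surd>m \<omega>\<close> puts the whole dependence on \<open>m\<close>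
  into vectors over one fixed probability measure. This is what makes dominated convergence
  applicable, and it includes \<open>m = 0\<close>, where a density depending on \<open>m\<close>
  would degenerate to a point mass. Two obstacles shape the rest. Traces are unordered sums over an
  arbitrary orthonormal basis, so exchanging them with the integral over \<open>\<omega>\<close>
  requires the basis to be countable; this is read off from the coherent states. And
  \<open>trace_class\<close> offers a positive root \<open>B\<close> of \<open>A\<^sup>* A\<close>
  with a summable diagonal and nothing else: Cholesky elimination runs on positivity and on the
  Cauchy-Schwarz inequality for the form \<open>\<langle>x, B y\<rangle>\<close> alone.\<close>

lemma cinner_scaleC_left: "cinner (c *\<^sub>C x) y = cnj c * cinner x y"
  by (metis cinner_commute cinner_scaleC_right complex_cnj_mult)

lemma cinner_add_left: "cinner (x + y) z = cinner x z + cinner y z"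
  by (metis cinner_commute cinner_add_right complex_cnj_add)

lemma cinner_zero_right [simp]: "cinner x 0 = 0"
  using cinner_add_right[of x 0 0] by simp

lemma cinner_zero_left [simp]: "cinner 0 x = 0"
  using cinner_add_left[of 0 0 x] by simp

lemma cinner_minus_right: "cinner x (- y) = - cinner x y"
  using cinner_add_right[of x y "- y"] by (simp add: eq_neg_iff_add_eq_0 add.commute)

lemma cinner_minus_left: "cinner (- x) y = - cinner x y"
  using cinner_add_left[of x "- x" y] by (simp add: eq_neg_iff_add_eq_0 add.commute)

lemma cinner_diff_right: "cinner x (y - z) = cinner x y - cinner x z"
  using cinner_add_right[of x y "- z"] by (simp add: cinner_minus_right)

lemma cinner_diff_left: "cinner (x - y) z = cinner x z - cinner y z"
  using cinner_add_left[of x "- y" z] by (simp add: cinner_minus_left)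

lemma cinner_sum_right: "cinner x (sum f F) = (\<Sum>i\<in>F. cinner x (f i))"
  by (induction F rule: infinite_finite_induct) (simp_all add: cinner_add_right)

lemma cinner_sum_left: "cinner (sum f F) x = (\<Sum>i\<in>F. cinner (f i) x)"
  by (induction F rule: infinite_finite_induct) (simp_all add: cinner_add_left)

lemma cinner_scaleR_right: "cinner x (r *\<^sub>R y) = of_real r * cinner x y"
  by (simp add: cinner_scaleC_right flip: scaleC_of_real)

lemma cinner_scaleR_left: "cinner (r *\<^sub>R x) y = of_real r * cinner x y"
  by (simp add: cinner_scaleC_left flip: scaleC_of_real)

lemmas cinner_simps = cinner_scaleC_left cinner_scaleC_right cinner_add_left cinner_add_right
  cinner_diff_left cinner_diff_right cinner_scaleR_left cinner_scaleR_right

lemma cinner_self: "cinner x x = of_real ((norm x)\<^sup>2)"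
  using arg_cong[OF cinner_commute[of x x], of Im]
  by (simp add: complex_eq_iff power2_norm_eq_inner inner_eq_Re_cinner)

lemma norm_scaleC: "norm (c *\<^sub>C x) = cmod c * norm x"
proof -
  have "complex_of_real ((norm (c *\<^sub>C x))\<^sup>2) = (c * cnj c) * of_real ((norm x)\<^sup>2)"
    unfolding cinner_self[symmetric] by (simp add: cinner_simps)
  also have "\<dots> = of_real ((cmod c * norm x)\<^sup>2)"
    unfolding complex_norm_square[symmetric] by (simp add: power_mult_distrib)
  finally show ?thesis
    by (simp only: of_real_eq_iff power2_eq_iff_nonneg norm_ge_zero mult_nonneg_nonneg)
qed

lemma ex_phase: "\<exists>c. cmod c = 1 \<and> c * z = of_real (cmod z)"
proof (cases "z = 0")
  case True then show ?thesis by (intro exI[of _ 1]) simp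
next
  case False
  then show ?thesis
    by (intro exI[of _ "cnj z / of_real (cmod z)"])
      (simp add: norm_divide field_simps power2_eq_square flip: complex_norm_square)
qed

lemma cinner_eqI: "(\<And>z. cinner z x = cinner z y) \<Longrightarrow> x = y"
  using cinner_self[of "x - y"] by (simp add: cinner_diff_right)

text \<open>A phase moved into \<open>y\<close> makes the complex inner product real and
  nonnegative, so the real Cauchy-Schwarz inequality applies.\<close>

lemma norm_cinner_le: "cmod (cinner x y) \<le> norm x * norm y"
proof -
  obtain c where c: "cmod c = 1" "c * cinner x y = of_real (cmod (cinner x y))"
    using ex_phase by blast
  have "cmod (cinner x y) = inner x (c *\<^sub>C y)"
    using c by (simp add: inner_eq_Re_cinner cinner_scaleC_right)
  also have "\<dots> \<le> norm x * norm (c *\<^sub>C y)" by (rule norm_cauchy_schwarz)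
  finally show ?thesis using c by (simp add: norm_scaleC)
qed

lemma bounded_linear_cinner: "bounded_linear (cinner x)"
proof (rule bounded_linear_intro[where K = "norm x"])
  show "cmod (cinner x y) \<le> norm y * norm x" for y
    using norm_cinner_le[of x y] by (simp only: mult.commute)
qed (simp_all add: cinner_simps scaleR_conv_of_real)

lemma norm_diff_square: "(norm (x - y))\<^sup>2 = (norm x)\<^sup>2 + (norm y)\<^sup>2 - 2 * Re (cinner x y)"
  by (simp add: power2_norm_eq_inner inner_diff_left inner_diff_right inner_commute[of y x]
      inner_eq_Re_cinner[of x y])

lemma norm_add_square: "(norm (x + y))\<^sup>2 = (norm x)\<^sup>2 + (norm y)\<^sup>2 + 2 * Re (cinner x y)"
  using norm_diff_square[of x "- y"] by (simp add: cinner_minus_right)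

lemma norm_cinner_commute: "cmod (cinner x y) = cmod (cinner y x)"
  by (metis cinner_commute complex_mod_cnj)

subsection \<open>Orthonormal bases\<close>

lemma onb_orth: "is_onb E \<Longrightarrow> e \<in> E \<Longrightarrow> f \<in> E \<Longrightarrow> cinner e f = (if e = f then 1 else 0)"
  by (simp add: is_onb_def)

lemma cinner_onb_sum:
  assumes "is_onb E" "finite F" "F \<subseteq> E" "e \<in> F"
  shows "cinner e (\<Sum>f\<in>F. c f *\<^sub>C f) = c e"
proof -
  have "cinner e (\<Sum>f\<in>F. c f *\<^sub>C f) = (\<Sum>f\<in>F. if f = e then c e else 0)"
    unfolding cinner_sum_right using assms
    by (intro sum.cong) (auto simp: cinner_scaleC_right onb_orth subset_iff)
  also have "\<dots> = c e" using assms by simp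
  finally show ?thesis .
qed

text \<open>The residual \<open>r\<close> is orthogonal to the span of \<open>F\<close>, so
  Pythagoras gives both claims. The second one, best approximation, is what upgrades density of the
  span to convergence of the basis expansion.\<close>

lemma onb_bessel:
  assumes "is_onb E" "finite F" "F \<subseteq> E"
  shows "(\<Sum>e\<in>F. (cmod (cinner e x))\<^sup>2) \<le> (norm x)\<^sup>2"
    and "norm (x - (\<Sum>e\<in>F. cinner e x *\<^sub>C e)) \<le> norm (x - (\<Sum>e\<in>F. c e *\<^sub>C e))"
proof -
  let ?P = "\<Sum>e\<in>F. cinner e x *\<^sub>C e"
  define r where "r = x - ?P"
  have orth: "cinner e r = 0" if "e \<in> F" for e
    using cinner_onb_sum[OF assms that] by (simp add: r_def cinner_diff_right)
  then have orth': "cinner (\<Sum>e\<in>F. d e *\<^sub>C e) r = 0" for d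
    by (simp add: cinner_sum_left cinner_scaleC_left)
  have pyth: "(norm (r + (\<Sum>e\<in>F. d e *\<^sub>C e)))\<^sup>2 = (norm r)\<^sup>2 + (norm (\<Sum>e\<in>F. d e *\<^sub>C e))\<^sup>2" for d
    using orth'[of d] norm_add_square[of "\<Sum>e\<in>F. d e *\<^sub>C e" r] by (simp add: add.commute)
  have "cinner ?P ?P = (\<Sum>e\<in>F. complex_of_real ((cmod (cinner e x))\<^sup>2))"
    unfolding cinner_sum_left using cinner_onb_sum[OF assms, of _ "\<lambda>e. cinner e x"]
    by (intro sum.cong) (auto simp: cinner_scaleC_left complex_norm_square mult.commute simp del: of_real_power)
  then have "complex_of_real ((norm ?P)\<^sup>2) = of_real (\<Sum>e\<in>F. (cmod (cinner e x))\<^sup>2)"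
    unfolding cinner_self by simp
  then have "(norm ?P)\<^sup>2 = (\<Sum>e\<in>F. (cmod (cinner e x))\<^sup>2)" by (simp only: of_real_eq_iff)
  moreover have "(norm ?P)\<^sup>2 \<le> (norm x)\<^sup>2"
    using pyth[of "\<lambda>e. cinner e x"] by (simp add: r_def)
  ultimately show "(\<Sum>e\<in>F. (cmod (cinner e x))\<^sup>2) \<le> (norm x)\<^sup>2" by simp
  have "x - (\<Sum>e\<in>F. c e *\<^sub>C e) = r + (\<Sum>e\<in>F. (cinner e x - c e) *\<^sub>C e)"
    by (simp add: r_def complex_vector.scale_left_diff_distrib sum_subtractf)
  then have "(norm r)\<^sup>2 \<le> (norm (x - (\<Sum>e\<in>F. c e *\<^sub>C e)))\<^sup>2" by (simp add: pyth)
  then show "norm (x - ?P) \<le> norm (x - (\<Sum>e\<in>F. c e *\<^sub>C e))"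
    unfolding r_def by (rule power2_le_imp_le) simp
qed

lemma onb_expansion:
  assumes "is_onb E"
  shows "((\<lambda>e. cinner e x *\<^sub>C e) has_sum x) E"
  unfolding has_sum_def tendsto_iff eventually_finite_subsets_at_top
proof (intro allI impI)
  fix \<epsilon> :: real assume \<epsilon>: "\<epsilon> > 0"
  have "x \<in> closure (complex_vector.span E)" using assms by (simp add: is_onb_def)
  then obtain y where y: "y \<in> complex_vector.span E" "dist y x < \<epsilon>"
    using \<epsilon> closure_approachable by blast
  then obtain F0 c where F0: "finite F0" "F0 \<subseteq> E" "y = (\<Sum>e\<in>F0. c e *\<^sub>C e)"
    unfolding complex_vector.span_explicit by blast
  have "dist (\<Sum>e\<in>F. cinner e x *\<^sub>C e) x < \<epsilon>" if F: "finite F" "F \<subseteq> E" "F0 \<subseteq> F" for F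
  proof -
    \<comment> \<open>Padding by zero turns the approximant on \<open>F0\<close> into a competitor
      on every larger \<open>F\<close>.\<close>
    have "y = (\<Sum>e\<in>F. (if e \<in> F0 then c e else 0) *\<^sub>C e)"
      unfolding F0(3) using F by (intro sum.mono_neutral_cong_left) auto
    then have "norm (x - (\<Sum>e\<in>F. cinner e x *\<^sub>C e)) \<le> norm (x - y)"
      using onb_bessel(2)[OF assms F(1,2), of x "\<lambda>e. if e \<in> F0 then c e else 0"] by simp
    then show ?thesis using y(2) by (simp add: dist_norm norm_minus_commute)
  qed
  then show "\<exists>X. finite X \<and> X \<subseteq> E \<and> (\<forall>Y. finite Y \<and> X \<subseteq> Y \<and> Y \<subseteq> E \<longrightarrow>
      dist (\<Sum>e\<in>Y. cinner e x *\<^sub>C e) x < \<epsilon>)"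
    using F0 by blast
qed

lemma onb_parseval:
  assumes "is_onb E"
  shows "((\<lambda>e. cinner x e * cinner e y) has_sum cinner x y) E"
  using has_sum_bounded_linear[OF bounded_linear_cinner[of x] onb_expansion[OF assms, of y]]
  by (simp add: o_def cinner_scaleC_right mult.commute)

lemma onb_parseval_norm:
  assumes "is_onb E"
  shows "((\<lambda>e. (cmod (cinner e x))\<^sup>2) has_sum (norm x)\<^sup>2) E"
proof -
  have "((\<lambda>e. Re (cinner x e * cinner e x)) has_sum Re (cinner x x)) E"
    by (rule has_sum_bounded_linear[OF bounded_linear_Re onb_parseval[OF assms], unfolded o_def])
  moreover have "Re (cinner x e * cinner e x) = (cmod (cinner e x))\<^sup>2" for e
    by (subst cinner_commute)
      (simp add: mult.commute[of "cnj _"] del: of_real_power flip: complex_norm_square)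
  ultimately show ?thesis by (simp add: cinner_self)
qed

text \<open>Arithmetic-geometric mean in each term, then Bessel. The half sum of squares is the
  convenient bound: it is summable along a rank one decomposition, and at most 1 for vectors of the
  unit ball.\<close>

lemma onb_norm_product_le:
  assumes "is_onb E"
  shows "(\<lambda>e. cmod (cinner x e * cinner e y)) summable_on E"
    and "(\<Sum>\<^sub>\<infinity>e\<in>E. cmod (cinner x e * cinner e y)) \<le> ((norm x)\<^sup>2 + (norm y)\<^sup>2) / 2"
    and "finite F \<Longrightarrow> F \<subseteq> E \<Longrightarrow> (\<Sum>e\<in>F. cmod (cinner x e * cinner e y)) \<le> ((norm x)\<^sup>2 + (norm y)\<^sup>2) / 2"
proof -
  have le: "(\<Sum>e\<in>F. cmod (cinner x e * cinner e y)) \<le> ((norm x)\<^sup>2 + (norm y)\<^sup>2) / 2"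
    if F: "finite F" "F \<subseteq> E" for F
  proof -
    have "(\<Sum>e\<in>F. cmod (cinner x e * cinner e y)) \<le>
        (\<Sum>e\<in>F. ((cmod (cinner e x))\<^sup>2 + (cmod (cinner e y))\<^sup>2) / 2)"
    proof (rule sum_mono)
      fix e
      show "cmod (cinner x e * cinner e y) \<le> ((cmod (cinner e x))\<^sup>2 + (cmod (cinner e y))\<^sup>2) / 2"
        using sum_squares_bound[of "cmod (cinner e x)" "cmod (cinner e y)"]
        by (simp add: norm_mult norm_cinner_commute[of x])
    qed
    also have "\<dots> \<le> ((norm x)\<^sup>2 + (norm y)\<^sup>2) / 2"
      using onb_bessel(1)[OF assms F, of x] onb_bessel(1)[OF assms F, of y]
      by (simp add: sum.distrib flip: sum_divide_distrib)
    finally show ?thesis .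
  qed
  show s: "(\<lambda>e. cmod (cinner x e * cinner e y)) summable_on E"
    by (rule nonneg_bdd_above_summable_on) (auto intro!: bdd_aboveI2 le)
  show "(\<Sum>\<^sub>\<infinity>e\<in>E. cmod (cinner x e * cinner e y)) \<le> ((norm x)\<^sup>2 + (norm y)\<^sup>2) / 2"
    by (rule infsum_le_finite_sums[OF s le])
  show "finite F \<Longrightarrow> F \<subseteq> E \<Longrightarrow> (\<Sum>e\<in>F. cmod (cinner x e * cinner e y)) \<le> ((norm x)\<^sup>2 + (norm y)\<^sup>2) / 2"
    by (rule le)
qed

subsection \<open>Bounded operators and adjoints\<close>

lemma bounded_clinearI:
  assumes "\<And>x y. A (x + y) = A x + A y" "\<And>c x. A (c *\<^sub>C x) = c *\<^sub>C A x"
    "\<And>x. norm (A x) \<le> norm x * K"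
  shows "bounded_clinear A"
  unfolding bounded_clinear_def using assms
  by (auto intro!: bounded_linear_intro simp flip: scaleC_of_real)

lemma bounded_clinearD:
  assumes "bounded_clinear A"
  shows "A (x + y) = A x + A y" "A (x - y) = A x - A y" "A (c *\<^sub>C x) = c *\<^sub>C A x"
    "A (r *\<^sub>R x) = r *\<^sub>R A x" "A 0 = 0"
  using assms linear_simps[of A] unfolding bounded_clinear_def by auto

lemma bounded_clinear_bound:
  assumes "bounded_clinear A"
  obtains K where "K \<ge> 0" "\<And>x. norm (A x) \<le> K * norm x"
  using assms bounded_linear.nonneg_bounded[of A] unfolding bounded_clinear_def
  by (metis mult.commute)

lemma riesz:
  fixes f :: "'a::chilbert_space \<Rightarrow> complex"
  assumes add: "\<And>x y. f (x + y) = f x + f y" and scale: "\<And>c x. f (c *\<^sub>C x) = c * f x"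
    and bound: "\<And>x. cmod (f x) \<le> norm x * K"
  shows "\<exists>y. \<forall>x. f x = cinner y x"
proof (cases "\<forall>x. f x = 0")
  case True
  then show ?thesis by (intro exI[of _ 0]) simp
next
  case False
  have bl: "bounded_linear f"
    by (rule bounded_linear_intro[OF add _ bound])
      (simp add: scale scaleR_conv_of_real flip: scaleC_of_real)
  from False obtain x where "x \<notin> {x. f x = 0}" by auto
  moreover have "complex_vector.subspace {x. f x = 0}"
    using linear_simps(3)[OF bl] unfolding complex_vector.subspace_def by (simp add: add scale)
  moreover have "closed {x. f x = 0}"
    by (intro closed_Collect_eq continuous_intros linear_continuous_on[OF bl])
  ultimately obtain u where u: "u \<noteq> 0" "\<And>s. f s = 0 \<Longrightarrow> cinner s u = 0"
    using closed_subspace_orthogonal by blast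
  \<comment> \<open>The kernel of \<open>f\<close> has codimension one:
    \<open>f x *\<^sub>C u - f u *\<^sub>C x\<close> lies in it and is therefore orthogonal to
    \<open>u\<close>.\<close>
  have *: "f x * of_real ((norm u)\<^sup>2) = f u * cinner u x" for x
  proof -
    have "f (f x *\<^sub>C u - f u *\<^sub>C x) = 0" by (simp add: scale linear_simps(2)[OF bl])
    from u(2)[OF this] have "cnj (cinner (f x *\<^sub>C u - f u *\<^sub>C x) u) = 0" by simp
    then have "cinner u (f x *\<^sub>C u - f u *\<^sub>C x) = 0" by (simp flip: cinner_commute)
    then show ?thesis by (simp add: cinner_simps cinner_self)
  qed
  have "f x = cinner ((cnj (f u) / of_real ((norm u)\<^sup>2)) *\<^sub>C u) x" for x
    using *[of x] u(1) by (simp add: cinner_scaleC_left field_simps)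
  then show ?thesis by blast
qed

text \<open>Riesz for each fixed \<open>y\<close> yields \<open>A y\<close>. Two operators arise
  this way: the adjoint, and the weak integral behind \<open>mixture\<close>.\<close>

lemma sesquilinear_op:
  fixes b :: "'a::chilbert_space \<Rightarrow> 'b::complex_inner \<Rightarrow> complex"
  assumes "\<And>x x' y. b (x + x') y = b x y + b x' y" "\<And>c x y. b (c *\<^sub>C x) y = cnj c * b x y"
    and "\<And>x y y'. b x (y + y') = b x y + b x y'" "\<And>c x y. b x (c *\<^sub>C y) = c * b x y"
    and bound: "\<And>x y. cmod (b x y) \<le> K * norm x * norm y"
  shows "\<exists>A. bounded_clinear A \<and> (\<forall>x y. cinner x (A y) = b x y)"
proof -
  have "\<exists>z. \<forall>x. cnj (b x y) = cinner z x" for y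
    by (rule riesz[where K = "K * norm y"]) (use assms in \<open>simp_all add: mult_ac\<close>)
  then obtain A where A: "\<And>x y. cnj (b x y) = cinner (A y) x" by metis
  then have A': "cinner x (A y) = b x y" for x y by (metis cinner_commute complex_cnj_cnj)
  have "norm (A y) \<le> norm y * \<bar>K\<bar>" for y
  proof (cases "A y = 0")
    case False
    have "(norm (A y))\<^sup>2 = cmod (b (A y) y)" unfolding A'[symmetric] cinner_self by (simp add: norm_power)
    also have "\<dots> \<le> K * norm (A y) * norm y" by (rule bound)
    also have "\<dots> \<le> \<bar>K\<bar> * norm (A y) * norm y" by (intro mult_right_mono) auto
    finally show ?thesis using False by (simp add: power2_eq_square mult_ac)
  qed simp
  then have "bounded_clinear A"
    by (intro bounded_clinearI cinner_eqI) (simp_all add: A' assms cinner_simps)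
  then show ?thesis using A' by blast
qed

lemma cadjoint_eqI:
  assumes "bounded_clinear B" "\<And>x y. cinner (A x) y = cinner x (B y)"
  shows "cadjoint A = B"
  unfolding cadjoint_def
proof (rule the_equality)
  fix C assume C: "bounded_clinear C \<and> (\<forall>x y. cinner (A x) y = cinner x (C y))"
  show "C = B"
  proof
    fix y show "C y = B y" by (rule cinner_eqI) (metis C assms(2))
  qed
qed (use assms in blast)

text \<open>Resolves the definite description in \<open>cadjoint\<close>: existence comes from
  \<open>sesquilinear_op\<close>, uniqueness from \<open>cadjoint_eqI\<close>.\<close>

lemma cinner_cadjoint:
  fixes A :: "'a::chilbert_space \<Rightarrow> 'b::complex_inner"
  assumes "bounded_clinear A"
  shows "cinner (A x) y = cinner x (cadjoint A y)"
proof -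
  obtain K where K: "K \<ge> 0" "\<And>x. norm (A x) \<le> K * norm x"
    using assms bounded_clinear_bound by blast
  have "\<exists>B. bounded_clinear B \<and> (\<forall>x y. cinner x (B y) = cinner (A x) y)"
  proof (rule sesquilinear_op[where K = K])
    show "cmod (cinner (A x) y) \<le> K * norm x * norm y" for x y
      by (rule order_trans[OF norm_cinner_le]) (intro mult_right_mono K, simp)
  qed (simp_all add: bounded_clinearD[OF assms] cinner_simps)
  then obtain B where "bounded_clinear B" "\<And>x y. cinner (A x) y = cinner x (B y)" by metis
  then show ?thesis using cadjoint_eqI[of B A] by simp
qed

subsection \<open>Positive operators\<close>

lemma positive_op_cinner:
  assumes "positive_op B"
  shows "cinner x (B x) = of_real (Re (cinner x (B x)))" "0 \<le> Re (cinner x (B x))"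
  using assms unfolding positive_op_def by (auto simp: complex_is_Real_iff complex_eq_iff)

text \<open>Polarisation: the form is real at \<open>x + y\<close> and at
  \<open>x + \<i> *\<^sub>C y\<close>, which settles the imaginary and the real part of the
  off-diagonal values.\<close>

lemma positive_op_selfadjoint:
  assumes "positive_op B"
  shows "cinner (B x) y = cinner x (B y)"
proof -
  have lin: "bounded_clinear B" using assms by (simp add: positive_op_def)
  have im: "Im (cinner z (B z)) = 0" for z
    using assms unfolding positive_op_def by (auto simp: complex_is_Real_iff)
  have sw: "cinner (B x) y = cnj (cinner y (B x))" by (rule cinner_commute)
  have "Im (cinner x (B y)) = - Im (cinner y (B x))"
    using im[of "x + y"] im[of x] im[of y] by (simp add: bounded_clinearD[OF lin] cinner_simps)
  moreover have "Re (cinner x (B y)) = Re (cinner y (B x))"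
    using im[of "x + \<i> *\<^sub>C y"] im[of x] im[of y] by (simp add: bounded_clinearD[OF lin] cinner_simps)
  ultimately show ?thesis unfolding sw by (simp add: complex_eq_iff)
qed

text \<open>Discriminant argument: with a phase \<open>c\<close> making the cross term real, the
  form along the real line \<open>x + t c y\<close> is a nonnegative polynomial of degree at most
  two in \<open>t\<close>.\<close>

lemma positive_op_cauchy_schwarz:
  assumes "positive_op B"
  shows "(cmod (cinner x (B y)))\<^sup>2 \<le> Re (cinner x (B x)) * Re (cinner y (B y))"
proof -
  have lin: "bounded_clinear B" using assms by (simp add: positive_op_def)
  define a b s where "a = Re (cinner x (B x))" and "b = Re (cinner y (B y))"
    and "s = cmod (cinner x (B y))"
  have ab: "0 \<le> a" "0 \<le> b" using positive_op_cinner[OF assms] by (auto simp: a_def b_def)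
  obtain c where c: "cmod c = 1" "c * cinner x (B y) = of_real s"
    using ex_phase unfolding s_def by blast
  have c1: "cnj c * c = 1" using c(1) by (metis complex_norm_square mult.commute of_real_1 one_power2)
  have p: "0 \<le> a + 2 * t * s + t\<^sup>2 * b" for t
  proof -
    define z where "z = x + t *\<^sub>R c *\<^sub>C y"
    have yx: "cnj c * cinner y (B x) = of_real s"
      using arg_cong[OF c(2), of cnj] positive_op_selfadjoint[OF assms, of y x]
        cinner_commute[of "B y" x] cinner_commute[of x "B y"]
      by (metis complex_cnj_complex_of_real complex_cnj_mult cinner_commute)
    have "cinner z (B z) = cinner x (B x) + of_real t * (c * cinner x (B y))
        + of_real t * (cnj c * cinner y (B x)) + of_real (t\<^sup>2) * (cnj c * c) * cinner y (B y)"
      by (simp add: z_def bounded_clinearD[OF lin] cinner_simps algebra_simps power2_eq_square)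
    also have "Re \<dots> = a + 2 * t * s + t\<^sup>2 * b"
      unfolding c yx c1 by (simp add: a_def b_def power2_eq_square)
    finally show ?thesis using positive_op_cinner(2)[OF assms, of z] by simp
  qed
  have "s\<^sup>2 \<le> a * b"
  proof (cases "b = 0")
    case True
    have "s = 0"
    proof (rule ccontr)
      assume "s \<noteq> 0"
      \<comment> \<open>For \<open>b = 0\<close> the polynomial is affine; this choice of
        \<open>t\<close> makes its value \<open>- a - 2\<close>, which is negative.\<close>
      have "a + 2 * (- (a + 1) / s) * s = - a - 2" using \<open>s \<noteq> 0\<close> by simp
      then show False using p[of "- (a + 1) / s"] ab True by simp
    qed
    then show ?thesis using ab by simp
  next
    case False
    \<comment> \<open>The quadratic polynomial is evaluated at its minimum.\<close>
    then show ?thesis using p[of "- s / b"] ab by (simp add: field_simps power2_eq_square)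
  qed
  then show ?thesis by (simp add: a_def b_def s_def)
qed

text \<open>Cauchy-Schwarz for the form, at the pair \<open>B y\<close> and \<open>y\<close>. In
  particular a vanishing diagonal value forces \<open>B y = 0\<close>, which is how null directions
  of the form are recognised below.\<close>

lemma positive_op_norm_square_le:
  assumes "positive_op B" "\<And>x. norm (B x) \<le> K * norm x"
  shows "(norm (B y))\<^sup>2 \<le> K * Re (cinner y (B y))"
proof (cases "B y = 0")
  case False
  define N where "N = (norm (B y))\<^sup>2"
  have N: "N > 0" using False by (simp add: N_def)
  have "N\<^sup>2 = (cmod (cinner (B y) (B y)))\<^sup>2" by (simp add: N_def cinner_self norm_power)
  also have "\<dots> \<le> Re (cinner (B y) (B (B y))) * Re (cinner y (B y))"
    by (rule positive_op_cauchy_schwarz[OF assms(1)])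
  also have "\<dots> \<le> K * N * Re (cinner y (B y))"
  proof (intro mult_right_mono positive_op_cinner(2)[OF assms(1)])
    have "Re (cinner (B y) (B (B y))) \<le> norm (B y) * norm (B (B y))"
      using complex_Re_le_cmod norm_cinner_le order_trans by blast
    also have "\<dots> \<le> norm (B y) * (K * norm (B y))" by (intro mult_left_mono assms) simp
    finally show "Re (cinner (B y) (B (B y))) \<le> K * N" by (simp add: N_def power2_eq_square mult_ac)
  qed
  finally have "N * N \<le> N * (K * Re (cinner y (B y)))" by (simp add: power2_eq_square mult_ac)
  then have "N \<le> K * Re (cinner y (B y))" using N by (rule mult_left_le_imp_le)
  then show ?thesis by (simp add: N_def)
next
  case True
  then show ?thesis using positive_op_cinner(2)[OF assms(1), of y] by simp
qed

subsection \<open>Trace class operators as sums of rank one operators\<close>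

text \<open>\<open>D\<close> is the Schur complement of \<open>C\<close> at \<open>a\<close>. Since
  \<open>|\<langle>v, x\<rangle>|\<^sup>2 = |\<langle>x, C a\<rangle>|\<^sup>2 / \<langle>a, C
  a\<rangle>\<close>, Cauchy-Schwarz for \<open>C\<close> keeps it positive. If
  \<open>\<langle>a, C a\<rangle> = 0\<close>, division by zero makes \<open>v = 0\<close> and
  \<open>D = C\<close>, and then \<open>C a = 0\<close> holds already.\<close>

lemma cholesky_step:
  fixes C :: "'a::complex_inner \<Rightarrow> 'a"
  assumes C: "positive_op C" and v: "v = (1 / sqrt (Re (cinner a (C a)))) *\<^sub>R C a"
  defines "D \<equiv> \<lambda>x. C x - cinner v x *\<^sub>C v"
  shows "positive_op D"
    and "Re (cinner x (D x)) = Re (cinner x (C x)) - (cmod (cinner v x))\<^sup>2"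
    and "D a = 0" and "C y = 0 \<Longrightarrow> D y = 0"
proof -
  have lin: "bounded_clinear C" using C by (simp add: positive_op_def)
  obtain K where K: "K \<ge> 0" "\<And>x. norm (C x) \<le> K * norm x"
    using lin bounded_clinear_bound by blast
  define d where "d = Re (cinner a (C a))"
  have d: "0 \<le> d" using positive_op_cinner(2)[OF C] by (simp add: d_def)
  have v: "v = (1 / sqrt d) *\<^sub>R C a" unfolding v d_def ..
  have xD: "cinner x (D x) = cinner x (C x) - of_real ((cmod (cinner v x))\<^sup>2)" for x
    using cinner_commute[of x v]
    by (simp add: D_def cinner_simps complex_norm_square del: of_real_power)
  then show ReD: "Re (cinner x (D x)) = Re (cinner x (C x)) - (cmod (cinner v x))\<^sup>2" for x
    by simp
  have "norm (D x) \<le> norm x * (K + norm v * norm v)" for x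
  proof -
    have "norm (D x) \<le> norm (C x) + cmod (cinner v x) * norm v"
      unfolding D_def using norm_triangle_ineq4[of "C x" "cinner v x *\<^sub>C v"] by (simp add: norm_scaleC)
    also have "\<dots> \<le> K * norm x + norm v * norm x * norm v"
      by (intro add_mono mult_right_mono K norm_cinner_le) simp
    finally show ?thesis by (simp add: algebra_simps)
  qed
  then have "bounded_clinear D"
    by (intro bounded_clinearI)
      (simp_all add: D_def bounded_clinearD[OF lin] cinner_simps scaleC_add_left
        complex_vector.scale_right_diff_distrib scaleC_scaleC)
  moreover have "(cmod (cinner v x))\<^sup>2 \<le> Re (cinner x (C x))" for x
  proof (cases "d = 0")
    case True
    then show ?thesis using positive_op_cinner(2)[OF C] by (simp add: v)
  next
    case False
    have "(cmod (cinner v x))\<^sup>2 = (cmod (cinner x (C a)))\<^sup>2 / d"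
      using d by (simp add: v cinner_simps norm_mult norm_divide power_mult_distrib power_divide
          norm_cinner_commute[of x])
    also have "\<dots> \<le> Re (cinner x (C x)) * d / d"
      using positive_op_cauchy_schwarz[OF C, of x a] d
      by (intro divide_right_mono) (auto simp: d_def)
    finally show ?thesis using False by simp
  qed
  ultimately show "positive_op D"
    using positive_op_cinner[OF C]
    by (auto simp: positive_op_def complex_is_Real_iff xD) (metis Im_complex_of_real)
  show "D a = 0"
  proof (cases "d = 0")
    case True
    then have "(norm (C a))\<^sup>2 \<le> 0"
      using positive_op_norm_square_le[OF C K(2), of a] by (simp add: d_def)
    then show ?thesis by (simp add: D_def v)
  next
    case False
    have "cinner (C a) a = of_real d"
      using positive_op_selfadjoint[OF C] positive_op_cinner(1)[OF C, of a] by (simp add: d_def)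
    then have "cinner v a *\<^sub>C v = (1 / sqrt d * d * (1 / sqrt d)) *\<^sub>R C a"
      by (simp only: v cinner_simps scaleC_scaleC complex_cnj_complex_of_real of_real_mult
          flip: scaleC_of_real)
    also have "1 / sqrt d * d * (1 / sqrt d) = 1" using False d by (simp add: real_sqrt_divide field_simps)
    finally show ?thesis by (simp add: D_def)
  qed
  show "D y = 0" if "C y = 0"
    using that positive_op_selfadjoint[OF C, of a y]
    by (simp add: D_def v cinner_simps)
qed

text \<open>Gram--Schmidt with respect to the semi-inner product \<open>\<langle>x, B y\<rangle>\<close>: \<open>chol B e n x\<close> is the
  remainder of \<open>x\<close> after elimination of \<open>e\<^sub>0, \<dots>, e\<^bsub>n-1\<^esub>\<close>, and \<open>chol_vec B e n\<close> is the
  normalised remainder of \<open>e\<^sub>n\<close> (zero if it has seminorm zero, as \<open>1 / 0 = 0\<close>).\<close>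

primrec chol :: "('a::complex_inner \<Rightarrow> 'a) \<Rightarrow> (nat \<Rightarrow> 'a) \<Rightarrow> nat \<Rightarrow> 'a \<Rightarrow> 'a" where
  "chol B e 0 x = x"
| "chol B e (Suc n) x = chol B e n x -
    cinner (B ((1 / sqrt (Re (cinner (e n) (B (chol B e n (e n)))))) *\<^sub>R chol B e n (e n))) x *\<^sub>C
      ((1 / sqrt (Re (cinner (e n) (B (chol B e n (e n)))))) *\<^sub>R chol B e n (e n))"

definition chol_vec :: "('a::complex_inner \<Rightarrow> 'a) \<Rightarrow> (nat \<Rightarrow> 'a) \<Rightarrow> nat \<Rightarrow> 'a" where
  "chol_vec B e n = (1 / sqrt (Re (cinner (e n) (B (chol B e n (e n)))))) *\<^sub>R chol B e n (e n)"

lemma chol_eq_sum: "chol B e n x = x - (\<Sum>k<n. cinner (B (chol_vec B e k)) x *\<^sub>C chol_vec B e k)"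
  by (induction n) (simp_all add: chol_vec_def)

text \<open>\<open>B (chol B e n x)\<close> is the n-th Schur complement of \<open>B\<close>, so
  each induction step is \<open>cholesky_step\<close> at \<open>e n\<close>. The diagonal values
  telescope, and a direction once eliminated stays in the kernel.\<close>

lemma chol_positive:
  assumes B: "positive_op B"
  shows "positive_op (\<lambda>x. B (chol B e n x)) \<and>
    (\<forall>x. Re (cinner x (B (chol B e n x))) =
      Re (cinner x (B x)) - (\<Sum>k<n. (cmod (cinner (B (chol_vec B e k)) x))\<^sup>2)) \<and>
    (\<forall>k<n. B (chol B e n (e k)) = 0)"
proof (induction n)
  case 0
  then show ?case using B by simp
next
  case (Suc n)
  have lin: "bounded_clinear B" using B by (simp add: positive_op_def)
  define C where "C = (\<lambda>x. B (chol B e n x))"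
  define v where "v = B (chol_vec B e n)"
  have v: "v = (1 / sqrt (Re (cinner (e n) (C (e n))))) *\<^sub>R C (e n)"
    by (simp add: v_def chol_vec_def C_def bounded_clinearD[OF lin])
  have step: "(\<lambda>x. B (chol B e (Suc n) x)) = (\<lambda>x. C x - cinner v x *\<^sub>C v)"
    by (simp add: C_def v_def bounded_clinearD[OF lin] flip: chol_vec_def)
  have C: "positive_op C" using Suc by (simp add: C_def)
  note * = cholesky_step[OF C v, folded step]
  show ?case
  proof (intro conjI allI impI)
    show "positive_op (\<lambda>x. B (chol B e (Suc n) x))" by (rule *(1))
    show "Re (cinner x (B (chol B e (Suc n) x))) = Re (cinner x (B x))
        - (\<Sum>k<Suc n. (cmod (cinner (B (chol_vec B e k)) x))\<^sup>2)" for x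
      using *(2)[of x] Suc fun_cong[OF step, of x] by (simp add: C_def v_def del: chol.simps)
    show "B (chol B e (Suc n) (e k)) = 0" if "k < Suc n" for k
    proof (cases "k = n")
      case True
      then show ?thesis using *(3) fun_cong[OF step, of "e n"] by simp
    next
      case False
      then have "C (e k) = 0" using that Suc by (simp add: C_def)
      from *(4)[OF this] show ?thesis using fun_cong[OF step, of "e k"] by simp
    qed
  qed
qed

text \<open>Parseval spreads each squared norm over the basis. Positivity of the remainder bounds
  the first \<open>n\<close> contributions at a basis vector by the diagonal value of
  \<open>B\<close> there, so the trace of \<open>B\<close> bounds every partial sum.\<close>

lemma chol_vec_summable:
  assumes B: "positive_op B" and E: "is_onb E" and tr: "(\<lambda>x. cinner x (B x)) summable_on E"
  shows "summable (\<lambda>k. (norm (B (chol_vec B e k)))\<^sup>2)"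
proof (rule summableI_nonneg_bounded)
  define w where "w k = B (chol_vec B e k)" for k
  have tr': "(\<lambda>x. Re (cinner x (B x))) summable_on E"
    using summable_on_bounded_linear[OF bounded_linear_Re tr] by (simp add: o_def)
  fix n
  have "((\<lambda>x. \<Sum>k<n. (cmod (cinner x (w k)))\<^sup>2) has_sum (\<Sum>k<n. (norm (w k))\<^sup>2)) E"
  proof (induction n)
    case (Suc n)
    from has_sum_add[OF this onb_parseval_norm[OF E, of "w n"]] show ?case by simp
  qed simp
  moreover have "(\<Sum>k<n. (cmod (cinner x (w k)))\<^sup>2) \<le> Re (cinner x (B x))" for x
  proof -
    have "0 \<le> Re (cinner x (B (chol B e n x)))"
      using chol_positive[OF B, of e n] positive_op_cinner(2) by blast
    then show ?thesis
      using chol_positive[OF B, of e n] by (simp add: w_def norm_cinner_commute[of x])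
  qed
  ultimately show "(\<Sum>k<n. (norm (w k))\<^sup>2) \<le> (\<Sum>\<^sub>\<infinity>x\<in>E. Re (cinner x (B x)))"
    using has_sum_mono[OF _ has_sum_infsum[OF tr']] by blast
qed simp

text \<open>Convergence on the basis extends to the closed span because the remainders share the
  bound \<open>K\<close>. Basis vectors outside \<open>range e\<close> are annihilated by
  \<open>B\<close>, which is why a sequence can exhaust a basis not known to be countable.\<close>

lemma chol_tendsto_0:
  assumes B: "positive_op B" and E: "is_onb E"
    and e: "\<And>x. x \<in> E \<Longrightarrow> B x \<noteq> 0 \<Longrightarrow> x \<in> range e"
  shows "(\<lambda>n. B (chol B e n x)) \<longlonglongrightarrow> 0"
proof -
  have lin: "bounded_clinear B" using B by (simp add: positive_op_def)
  obtain K where K: "K \<ge> 0" "\<And>x. norm (B x) \<le> K * norm x"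
    using lin bounded_clinear_bound by blast
  define C where "C n = (\<lambda>x. B (chol B e n x))" for n
  have C: "positive_op (C n)" for n using chol_positive[OF B] by (simp add: C_def)
  have linC: "bounded_clinear (C n)" for n using C by (simp add: positive_op_def)
  have CB: "Re (cinner x (C n x)) \<le> Re (cinner x (B x))" for n x
    using chol_positive[OF B, of e n] by (simp add: C_def sum_nonneg)
  have BK: "Re (cinner x (B x)) \<le> K * (norm x)\<^sup>2" for x
  proof -
    have "Re (cinner x (B x)) \<le> norm x * norm (B x)"
      using complex_Re_le_cmod norm_cinner_le order_trans by blast
    also have "\<dots> \<le> norm x * (K * norm x)" by (intro mult_left_mono K) simp
    finally show ?thesis by (simp add: power2_eq_square mult_ac)
  qed
  \<comment> \<open>\<open>C n\<close> lies below \<open>B\<close> as a form; Cauchy-Schwarz for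
    \<open>C n\<close> at the pair \<open>C n x\<close>, \<open>x\<close> turns this into a norm
    bound.\<close>
  have CK: "norm (C n x) \<le> K * norm x" for n x
  proof (cases "C n x = 0")
    case True then show ?thesis using K by simp
  next
    case False
    define N where "N = norm (C n x)"
    have "(N * N)\<^sup>2 = (cmod (cinner (C n x) (C n x)))\<^sup>2"
      unfolding cinner_self norm_of_real by (simp add: N_def power2_eq_square)
    also have "\<dots> \<le> Re (cinner (C n x) (C n (C n x))) * Re (cinner x (C n x))"
      by (rule positive_op_cauchy_schwarz[OF C])
    also have "\<dots> \<le> (K * N\<^sup>2) * (K * (norm x)\<^sup>2)"
      unfolding N_def using positive_op_cinner(2)[OF C, of "C n x" n] positive_op_cinner(2)[OF C, of x n] K
      by (intro mult_mono order_trans[OF CB BK]) auto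
    also have "\<dots> = (N * (K * norm x))\<^sup>2" by (simp add: power2_eq_square mult_ac)
    finally have "N * N \<le> N * (K * norm x)"
      by (rule power2_le_imp_le) (use K in \<open>simp add: N_def\<close>)
    moreover have "N > 0" using False by (simp add: N_def)
    ultimately show ?thesis unfolding N_def by (rule mult_left_le_imp_le)
  qed
  define S where "S = {x. (\<lambda>n. C n x) \<longlonglongrightarrow> 0}"
  have "x \<in> S" if x: "x \<in> E" for x
  proof (cases "B x = 0")
    case True
    have "C n x = 0" for n
    proof -
      have "(norm (C n x))\<^sup>2 \<le> K * Re (cinner x (C n x))"
        by (rule positive_op_norm_square_le[OF C CK])
      also have "\<dots> \<le> K * 0" using CB[of x n] True K by (intro mult_left_mono) auto
      finally show ?thesis by simp
    qed
    then show ?thesis by (simp add: S_def)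
  next
    case False
    then obtain k where k: "x = e k" using e x by blast
    have "\<forall>\<^sub>F n in sequentially. C n x = 0"
      using eventually_gt_at_top[of k]
    proof eventually_elim
      case (elim n)
      then show ?case using chol_positive[OF B, of e n] k by (simp add: C_def)
    qed
    then show ?thesis by (simp add: S_def tendsto_eventually)
  qed
  moreover have "complex_vector.subspace S"
    unfolding complex_vector.subspace_def S_def
  proof (intro conjI ballI allI; simp add: bounded_clinearD[OF linC])
    show "(\<lambda>n. C n x + C n y) \<longlonglongrightarrow> 0" if "(\<lambda>n. C n x) \<longlonglongrightarrow> 0" "(\<lambda>n. C n y) \<longlonglongrightarrow> 0" for x y
      using tendsto_add[OF that] by simp
    show "(\<lambda>n. c *\<^sub>C C n x) \<longlonglongrightarrow> 0" if "(\<lambda>n. C n x) \<longlonglongrightarrow> 0" for x c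
      using tendsto_mult_right_zero[OF tendsto_norm_zero[OF that], of "cmod c"]
      by - (rule tendsto_norm_zero_cancel, simp add: norm_scaleC)
  qed
  ultimately have sp: "complex_vector.span E \<subseteq> S" by (intro complex_vector.span_minimal) auto
  have "(\<lambda>n. C n x) \<longlonglongrightarrow> 0"
  proof (rule LIMSEQ_I)
    fix \<epsilon> :: real assume \<epsilon>: "0 < \<epsilon>"
    have "x \<in> closure (complex_vector.span E)" using E by (simp add: is_onb_def)
    \<comment> \<open>\<open>K + 1\<close> keeps the denominator positive when
      \<open>K = 0\<close>.\<close>
    moreover have "0 < \<epsilon> / (2 * (K + 1))" using \<epsilon> K by simp
    ultimately obtain y where y: "y \<in> complex_vector.span E" "dist y x < \<epsilon> / (2 * (K + 1))"
      using closure_approachable by blast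
    have "(\<lambda>n. C n y) \<longlonglongrightarrow> 0" using sp y(1) by (auto simp: S_def)
    then obtain N where N: "\<And>n. n \<ge> N \<Longrightarrow> norm (C n y) < \<epsilon> / 2"
      using LIMSEQ_D[of "\<lambda>n. C n y" 0 "\<epsilon> / 2"] \<epsilon> by auto
    have "norm (C n x - 0) < \<epsilon>" if "n \<ge> N" for n
    proof -
      have "norm (C n (x - y)) \<le> (K + 1) * norm (x - y)"
        by (rule order_trans[OF CK]) (intro mult_right_mono, auto)
      also have "\<dots> \<le> \<epsilon> / 2"
        using y(2) K by (simp add: dist_norm norm_minus_commute field_simps)
      finally have "norm (C n (x - y)) \<le> \<epsilon> / 2" .
      moreover have "C n x = C n y + C n (x - y)" by (simp add: bounded_clinearD[OF linC])
      ultimately show ?thesis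
        using N[OF that] norm_triangle_ineq[of "C n y" "C n (x - y)"] by simp
    qed
    then show "\<exists>N. \<forall>n\<ge>N. norm (C n x - 0) < \<epsilon>" by blast
  qed
  then show ?thesis by (simp add: C_def)
qed

text \<open>With Cholesky vectors \<open>w\<^sub>k\<close>, take
  \<open>u\<^sub>k = A w\<^sub>k\<close> and \<open>v\<^sub>k = B w\<^sub>k\<close>, where
  \<open>B\<close> is the absolute value of \<open>A\<close>. The identity
  \<open>norm (A x) = norm (B x)\<close> carries both the square summability and the decay of the
  remainder from \<open>B\<close> over to \<open>A\<close>.\<close>

theorem trace_class_rank_one_sum:
  fixes A :: "'a::chilbert_space \<Rightarrow> 'a"
  assumes "trace_class A"
  obtains u v :: "nat \<Rightarrow> 'a"
  where "summable (\<lambda>k. (norm (u k))\<^sup>2)" "summable (\<lambda>k. (norm (v k))\<^sup>2)"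
    "\<And>x. (\<lambda>k. cinner (v k) x *\<^sub>C u k) sums A x"
proof -
  let ?E = "some_onb :: 'a set"
  from assms obtain B where A: "bounded_clinear A" and B: "positive_op B"
    and BA: "B \<circ> B = cadjoint A \<circ> A" and tr: "(\<lambda>x. cinner x (B x)) summable_on ?E"
    unfolding trace_class_def by blast
  have lin: "bounded_clinear B" using B by (simp add: positive_op_def)
  have nAB: "norm (A x) = norm (B x)" for x
  proof -
    have "cinner (A x) (A x) = cinner x (B (B x))"
      using cinner_cadjoint[OF A] BA by (simp add: fun_eq_iff)
    also have "\<dots> = cinner (B x) (B x)" by (simp add: positive_op_selfadjoint[OF B])
    finally have "(norm (A x))\<^sup>2 = (norm (B x))\<^sup>2" unfolding cinner_self by (simp only: of_real_eq_iff)
    then show ?thesis by simp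
  qed
  obtain K where K: "K \<ge> 0" "\<And>x. norm (B x) \<le> K * norm x"
    using lin bounded_clinear_bound by blast
  \<comment> \<open>A summable family has countable support, and a zero diagonal value means
    \<open>B x = 0\<close>; so \<open>e\<close> hits every basis vector that \<open>B\<close> does
    not annihilate.\<close>
  define E0 where "E0 = {x \<in> ?E. cinner x (B x) \<noteq> 0}"
  define e where "e = from_nat_into E0"
  have "countable E0" using summable_countable_complex[OF tr] by (simp add: E0_def)
  then have "E0 \<subseteq> range e"
    using subset_range_from_nat_into by (auto simp: e_def)
  moreover have "x \<in> E0" if "x \<in> ?E" "B x \<noteq> 0" for x
  proof -
    have "(norm (B x))\<^sup>2 \<le> K * Re (cinner x (B x))"
      by (rule positive_op_norm_square_le[OF B K(2)])
    then show ?thesis using that by (auto simp: E0_def)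
  qed
  ultimately have e: "\<And>x. x \<in> ?E \<Longrightarrow> B x \<noteq> 0 \<Longrightarrow> x \<in> range e" by blast
  define w where "w = chol_vec B e"
  have sB: "summable (\<lambda>k. (norm (B (w k)))\<^sup>2)"
    unfolding w_def by (rule chol_vec_summable[OF B is_onb_some_onb tr])
  show thesis
  proof (rule that[of "\<lambda>k. A (w k)" "\<lambda>k. B (w k)"])
    fix x
    have "A x - (\<Sum>k<n. cinner (B (w k)) x *\<^sub>C A (w k)) = A (chol B e n x)" for n
    proof -
      have "A (\<Sum>k<n. cinner (B (w k)) x *\<^sub>C w k) = (\<Sum>k<n. cinner (B (w k)) x *\<^sub>C A (w k))"
        by (induction n) (simp_all add: bounded_clinearD[OF A])
      then show ?thesis by (simp add: chol_eq_sum bounded_clinearD[OF A] w_def)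
    qed
    moreover have "(\<lambda>n. B (chol B e n x)) \<longlonglongrightarrow> 0"
      by (rule chol_tendsto_0[OF B is_onb_some_onb]) (rule e)
    then have "(\<lambda>n. norm (A (chol B e n x))) \<longlonglongrightarrow> 0"
      unfolding nAB by (rule tendsto_norm_zero)
    then have "(\<lambda>n. A (chol B e n x)) \<longlonglongrightarrow> 0" by (rule tendsto_norm_zero_cancel)
    ultimately have "(\<lambda>n. A x - (\<Sum>k<n. cinner (B (w k)) x *\<^sub>C A (w k))) \<longlonglongrightarrow> 0" by simp
    from tendsto_diff[OF tendsto_const this, of "A x"]
    show "(\<lambda>k. cinner (B (w k)) x *\<^sub>C A (w k)) sums A x" by (simp add: sums_def)
  qed (use sB in \<open>simp_all add: nAB\<close>)
qed

text \<open>The double family over \<open>k\<close> and the basis is absolutely summable by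
  \<open>onb_norm_product_le\<close>. Summed over the basis first it gives
  \<open>\<langle>v\<^sub>k, W u\<^sub>k\<rangle>\<close>, over \<open>k\<close> first the diagonal
  of \<open>A \<circ> W\<close>. \<open>W'\<close> is the adjoint of \<open>W\<close>; the
  application is \<open>W = weyl (- z)\<close>, \<open>W' = weyl z\<close>.\<close>

lemma op_trace_rank_one_sum:
  fixes A :: "'a::chilbert_space \<Rightarrow> 'a"
  assumes u: "summable (\<lambda>k. (norm (u k))\<^sup>2)" and v: "summable (\<lambda>k. (norm (v k))\<^sup>2)"
    and A: "\<And>x. (\<lambda>k. cinner (v k) x *\<^sub>C u k) sums A x"
    and W: "\<And>x y. cinner (W' x) y = cinner x (W y)" "\<And>x. norm (W' x) \<le> norm x"
  shows "(\<lambda>k. cinner (v k) (W (u k))) sums op_trace (A \<circ> W)"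
proof -
  let ?E = "some_onb :: 'a set"
  note E = is_onb_some_onb[where 'a = 'a]
  define f where "f k e = cinner (W' (v k)) e * cinner e (u k)" for k e
  let ?b = "\<lambda>k. ((norm (v k))\<^sup>2 + (norm (u k))\<^sup>2) / 2"
  have sb: "summable ?b" using u v by (intro summable_divide summable_add)
  have le: "(\<Sum>\<^sub>\<infinity>e\<in>?E. cmod (f k e)) \<le> ?b k" for k
  proof -
    have "(\<Sum>\<^sub>\<infinity>e\<in>?E. cmod (f k e)) \<le> ((norm (W' (v k)))\<^sup>2 + (norm (u k))\<^sup>2) / 2"
      unfolding f_def by (rule onb_norm_product_le(2)[OF E])
    also have "\<dots> \<le> ?b k"
      using power_mono[OF W(2)[of "v k"], of 2] by simp
    finally show ?thesis .
  qed
  have s1: "(\<lambda>e. cmod (f k e)) summable_on ?E" for k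
    unfolding f_def by (rule onb_norm_product_le(1)[OF E])
  have "summable (\<lambda>k. \<Sum>\<^sub>\<infinity>e\<in>?E. cmod (f k e))"
  proof (rule summable_comparison_test'[OF sb, of 0])
    show "norm (\<Sum>\<^sub>\<infinity>e\<in>?E. cmod (f k e)) \<le> ?b k" for k
      unfolding real_norm_def using le[of k] by (subst abs_of_nonneg) (auto intro: infsum_nonneg)
  qed
  then have s2: "(\<lambda>k. \<Sum>\<^sub>\<infinity>e\<in>?E. cmod (f k e)) summable_on UNIV"
    by (intro norm_summable_imp_summable_on) (simp add: infsum_nonneg)
  have abs: "(\<lambda>p. norm (case p of (k, e) \<Rightarrow> f k e)) summable_on UNIV \<times> ?E"
    unfolding Infinite_Sum.abs_summable_on_Sigma_iff using s1 s2 by (simp add: infsum_nonneg)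
  then have swap: "(\<Sum>\<^sub>\<infinity>k. \<Sum>\<^sub>\<infinity>e\<in>?E. f k e) = (\<Sum>\<^sub>\<infinity>e\<in>?E. \<Sum>\<^sub>\<infinity>k. f k e)"
    by (rule infsum_swap_banach[OF abs_summable_summable])
  have inner: "(\<Sum>\<^sub>\<infinity>e\<in>?E. f k e) = cinner (v k) (W (u k))" for k
    unfolding f_def using infsumI[OF onb_parseval[OF E, of "W' (v k)" "u k"]] by (simp add: W)
  have outer: "(\<Sum>\<^sub>\<infinity>k. f k e) = cinner e (A (W e))" if "e \<in> ?E" for e
  proof -
    have "(\<lambda>k. f k e) sums cinner e (A (W e))"
      using bounded_linear.sums[OF bounded_linear_cinner A[of "W e"], of e]
      by (simp add: f_def W cinner_scaleC_right)
    moreover have "summable (\<lambda>k. cmod (f k e))"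
    proof (rule summable_comparison_test'[OF \<open>summable (\<lambda>k. \<Sum>\<^sub>\<infinity>e\<in>?E. cmod (f k e))\<close>, of 0])
      fix k
      show "norm (cmod (f k e)) \<le> (\<Sum>\<^sub>\<infinity>e\<in>?E. cmod (f k e))"
        using finite_sum_le_infsum[OF s1[of k], of "{e}"] that by simp
    qed
    ultimately show ?thesis by (intro infsumI norm_summable_imp_has_sum)
  qed
  have ab: "op_trace (A \<circ> W) = (\<Sum>\<^sub>\<infinity>k. cinner (v k) (W (u k)))"
    unfolding op_trace_def inner[symmetric] swap by (intro infsum_cong) (simp add: outer)
  have "summable (\<lambda>k. norm (cinner (v k) (W (u k))))"
  proof (rule summable_comparison_test'[OF sb, of 0])
    fix k
    have "cmod (cinner (v k) (W (u k))) \<le> norm (W' (v k)) * norm (u k)"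
      unfolding W(1)[symmetric] by (rule norm_cinner_le)
    also have "\<dots> \<le> norm (v k) * norm (u k)" by (intro mult_right_mono W) simp
    also have "\<dots> \<le> ?b k" using sum_squares_bound[of "norm (v k)" "norm (u k)"] by simp
    finally show "norm (norm (cinner (v k) (W (u k)))) \<le> ?b k" by simp
  qed
  then show ?thesis unfolding ab
    by (intro has_sum_imp_sums has_sum_infsum norm_summable_imp_summable_on)
qed

subsection \<open>Mixtures of rank one projections\<close>

text \<open>Dominated convergence speaks of sequences, hence the countability: the family is moved
  to the naturals along \<open>to_nat_on I\<close> and padded by zero. The bound on finite norm sums
  also makes the integrals absolutely summable, which turns the sequential limit back into an
  unordered sum.\<close>

lemma has_sum_integral:
  fixes f :: "'i \<Rightarrow> 'w \<Rightarrow> 'b::{banach, second_countable_topology}"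
  assumes I: "countable I" and f: "\<And>i. i \<in> I \<Longrightarrow> integrable M (f i)" and B: "integrable M B"
    and le: "\<And>F x. finite F \<Longrightarrow> F \<subseteq> I \<Longrightarrow> (\<Sum>i\<in>F. norm (f i x)) \<le> B x"
    and S: "\<And>x. ((\<lambda>i. f i x) has_sum S x) I"
  shows "((\<lambda>i. \<integral>x. f i x \<partial>M) has_sum (\<integral>x. S x \<partial>M)) I"
proof -
  define h where "h n x = (if n \<in> to_nat_on I ` I then f (from_nat_into I n) x else 0)" for n x
  have bij: "bij_betw (to_nat_on I) I (to_nat_on I ` I)"
    using inj_on_to_nat_on[OF I] by (simp add: bij_betw_def)
  have h0: "h n = (\<lambda>_. 0)" if "n \<notin> to_nat_on I ` I" for n
    using that by (simp add: h_def[abs_def])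
  have h_to: "h (to_nat_on I i) x = f i x" if "i \<in> I" for i x
    using that I by (simp add: h_def)
  have tr: "((\<lambda>n. g n) has_sum s) UNIV \<longleftrightarrow> ((\<lambda>i. g (to_nat_on I i)) has_sum s) I"
    if "\<And>n. n \<notin> to_nat_on I ` I \<Longrightarrow> g n = 0" for g :: "nat \<Rightarrow> 'b" and s
  proof -
    have "(g has_sum s) UNIV \<longleftrightarrow> (g has_sum s) (to_nat_on I ` I)"
      using that by (intro has_sum_cong_neutral) auto
    also have "\<dots> \<longleftrightarrow> ((\<lambda>i. g (to_nat_on I i)) has_sum s) I"
      using has_sum_reindex_bij_betw[OF bij, of g s] by simp
    finally show ?thesis by simp
  qed
  have hint: "integrable M (h n)" for n
    unfolding h_def[abs_def] using f I by (cases "n \<in> to_nat_on I ` I") auto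
  have hle: "(\<Sum>n<N. norm (h n x)) \<le> B x" for N x
  proof -
    let ?F = "{i \<in> I. to_nat_on I i < N}"
    have fin: "finite ?F"
      using finite_imageD[of "to_nat_on I" ?F] inj_on_subset[OF inj_on_to_nat_on[OF I], of ?F]
        finite_subset[of "to_nat_on I ` ?F" "{..<N}"] by auto
    have "(\<Sum>n<N. norm (h n x)) = (\<Sum>n\<in>to_nat_on I ` ?F. norm (h n x))"
      by (intro sum.mono_neutral_right) (auto simp: h_def)
    also have "\<dots> = (\<Sum>i\<in>?F. norm (f i x))"
      by (subst sum.reindex) (auto simp: h_to intro: inj_on_subset[OF inj_on_to_nat_on[OF I]])
    also have "\<dots> \<le> B x" using fin by (intro le) auto
    finally show ?thesis .
  qed
  have hS: "((\<lambda>n. h n x) has_sum S x) UNIV" for x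
    by (subst tr) (auto simp: h_def[of _ x] S I cong: has_sum_cong)
  have "(\<lambda>N. \<integral>x. (\<Sum>n<N. h n x) \<partial>M) \<longlonglongrightarrow> (\<integral>x. S x \<partial>M)"
  proof (rule integral_dominated_convergence[where w = B])
    show lim: "AE x in M. (\<lambda>N. \<Sum>n<N. h n x) \<longlonglongrightarrow> S x"
      using has_sum_imp_sums[OF hS] by (simp add: sums_def)
    show "(\<lambda>x. \<Sum>n<N. h n x) \<in> borel_measurable M" for N
      using hint by (intro borel_measurable_sum) auto
    show "S \<in> borel_measurable M"
      by (rule borel_measurable_LIMSEQ_metric[of "\<lambda>N x. \<Sum>n<N. h n x"])
        (use hint has_sum_imp_sums[OF hS] in \<open>auto simp: sums_def intro!: borel_measurable_sum\<close>)
    show "AE x in M. norm (\<Sum>n<N. h n x) \<le> B x" for N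
      by (intro AE_I2 order_trans[OF norm_sum hle])
  qed (rule B)
  then have sums: "(\<lambda>n. \<integral>x. h n x \<partial>M) sums (\<integral>x. S x \<partial>M)"
    unfolding sums_def using hint by (simp add: Bochner_Integration.integral_sum)
  have "summable (\<lambda>n. norm (\<integral>x. h n x \<partial>M))"
  proof (rule summableI_nonneg_bounded)
    fix N
    have "(\<Sum>n<N. norm (\<integral>x. h n x \<partial>M)) \<le> (\<Sum>n<N. \<integral>x. norm (h n x) \<partial>M)"
      by (intro sum_mono integral_norm_bound)
    also have "\<dots> = (\<integral>x. (\<Sum>n<N. norm (h n x)) \<partial>M)"
      using hint by (subst Bochner_Integration.integral_sum) auto
    also have "\<dots> \<le> (\<integral>x. B x \<partial>M)"
      using hint B hle by (intro integral_mono) auto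
    finally show "(\<Sum>n<N. norm (\<integral>x. h n x \<partial>M)) \<le> (\<integral>x. B x \<partial>M)" .
  qed simp
  from norm_summable_imp_has_sum[OF this sums]
  have "((\<lambda>i. \<integral>x. h (to_nat_on I i) x \<partial>M) has_sum (\<integral>x. S x \<partial>M)) I"
    by (subst (asm) tr) (simp_all add: h0 del: image_iff)
  then show ?thesis by (simp add: h_to cong: has_sum_cong)
qed

text \<open>Setting for the average of the operators
  \<open>|\<phi> \<omega>\<rangle>\<langle>\<phi> \<omega>|\<close>, treated weakly: measurability
  is asked of the scalar functions \<open>cinner x (\<phi> \<omega>)\<close>.\<close>

locale vector_mixture = prob_space M
  for M :: "'w measure" and \<phi> :: "'w \<Rightarrow> 'a::chilbert_space" +
  assumes measurable_cinner: "\<And>x. (\<lambda>\<omega>. cinner x (\<phi> \<omega>)) \<in> borel_measurable M"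
    and norm_le_1: "\<And>\<omega>. norm (\<phi> \<omega>) \<le> 1"

text \<open>An operator is determined by its matrix elements (\<open>cinner_eqI\<close>), so
  \<open>SOME\<close> selects a definite one as soon as existence is known.\<close>

definition mixture :: "'w measure \<Rightarrow> ('w \<Rightarrow> 'a::chilbert_space) \<Rightarrow> 'a \<Rightarrow> 'a" where
  "mixture M \<phi> = (SOME A. bounded_clinear A \<and>
    (\<forall>x y. cinner x (A y) = (\<integral>\<omega>. cinner x (\<phi> \<omega>) * cinner (\<phi> \<omega>) y \<partial>M)))"

context vector_mixture
begin

lemma measurable_cinner_left: "(\<lambda>\<omega>. cinner (\<phi> \<omega>) x) \<in> borel_measurable M"
proof -
  have "(\<lambda>\<omega>. cnj (cinner x (\<phi> \<omega>))) \<in> borel_measurable M"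
    by (rule borel_measurable_continuous_on[OF continuous_on_cnj[OF continuous_on_id] measurable_cinner])
  then show ?thesis by (simp flip: cinner_commute)
qed

lemma norm_cinner_mixed_le: "cmod (cinner x (\<phi> \<omega>) * cinner (\<phi> \<omega>) y) \<le> norm x * norm y"
proof -
  have "cmod (cinner x (\<phi> \<omega>)) \<le> norm x" "cmod (cinner (\<phi> \<omega>) y) \<le> norm y"
    using norm_cinner_le[of x "\<phi> \<omega>"] norm_cinner_le[of "\<phi> \<omega>" y] norm_le_1[of \<omega>]
      mult_left_mono[OF norm_le_1[of \<omega>], of "norm x"] mult_right_mono[OF norm_le_1[of \<omega>], of "norm y"]
    by auto
  then show ?thesis by (simp add: norm_mult mult_mono)
qed

lemma integrable_cinner_mixed: "integrable M (\<lambda>\<omega>. cinner x (\<phi> \<omega>) * cinner (\<phi> \<omega>) y)"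
  by (rule integrable_const_bound[where B = "norm x * norm y"])
    (auto intro!: borel_measurable_times measurable_cinner measurable_cinner_left norm_cinner_mixed_le)

lemma bounded_clinear_mixture: "bounded_clinear (mixture M \<phi>)"
  and cinner_mixture: "cinner x (mixture M \<phi> y) = (\<integral>\<omega>. cinner x (\<phi> \<omega>) * cinner (\<phi> \<omega>) y \<partial>M)"
proof -
  have "\<exists>A. bounded_clinear A \<and>
    (\<forall>x y. cinner x (A y) = (\<integral>\<omega>. cinner x (\<phi> \<omega>) * cinner (\<phi> \<omega>) y \<partial>M))"
  proof (rule sesquilinear_op[where K = 1])
    fix x x' y y' :: 'a and c
    show "cmod (\<integral>\<omega>. cinner x (\<phi> \<omega>) * cinner (\<phi> \<omega>) y \<partial>M) \<le> 1 * norm x * norm y"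
    proof -
      have "cmod (\<integral>\<omega>. cinner x (\<phi> \<omega>) * cinner (\<phi> \<omega>) y \<partial>M) \<le> (\<integral>\<omega>. norm x * norm y \<partial>M)"
        by (rule order_trans[OF integral_norm_bound], rule integral_mono)
          (auto intro: integrable_cinner_mixed norm_cinner_mixed_le)
      then show ?thesis by (simp add: prob_space)
    qed
  qed (simp_all add: cinner_simps distrib_left distrib_right integrable_cinner_mixed mult.assoc
      mult.left_commute[of _ "_ :: complex"])
  from someI_ex[OF this] show "bounded_clinear (mixture M \<phi>)"
    "cinner x (mixture M \<phi> y) = (\<integral>\<omega>. cinner x (\<phi> \<omega>) * cinner (\<phi> \<omega>) y \<partial>M)"
    unfolding mixture_def by auto
qed

lemma cinner_mixture_self:
  "cinner x (mixture M \<phi> x) = of_real (\<integral>\<omega>. (cmod (cinner x (\<phi> \<omega>)))\<^sup>2 \<partial>M)"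
proof -
  have "cinner x (\<phi> \<omega>) * cinner (\<phi> \<omega>) x = of_real ((cmod (cinner x (\<phi> \<omega>)))\<^sup>2)" for \<omega>
    unfolding complex_norm_square by (subst (2) cinner_commute) simp
  then show ?thesis
    unfolding cinner_mixture by (simp only: integral_complex_of_real)
qed

lemma positive_op_mixture: "positive_op (mixture M \<phi>)"
  unfolding positive_op_def cinner_mixture_self using bounded_clinear_mixture by simp

lemma integrable_cmod_square: "integrable M (\<lambda>\<omega>. (cmod (cinner x (\<phi> \<omega>)))\<^sup>2)"
proof (rule integrable_const_bound[where B = "(norm x)\<^sup>2"])
  show "AE \<omega> in M. norm ((cmod (cinner x (\<phi> \<omega>)))\<^sup>2) \<le> (norm x)\<^sup>2"
    using norm_cinner_mixed_le[of x _ x] norm_cinner_commute[of x]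
    by (simp add: norm_mult power2_eq_square)
qed (use measurable_cinner in measurable)

text \<open>Bessel under the integral: finite diagonal sums are at most the mean of
  \<open>(norm (\<phi> \<omega>))\<^sup>2\<close>, hence at most 1.\<close>

lemma mixture_trace_summable: "(\<lambda>e. cinner e (mixture M \<phi> e)) summable_on some_onb"
proof -
  have "(\<Sum>e\<in>F. \<integral>\<omega>. (cmod (cinner e (\<phi> \<omega>)))\<^sup>2 \<partial>M) \<le> 1" if F: "finite F" "F \<subseteq> some_onb" for F
  proof -
    have "(\<Sum>e\<in>F. \<integral>\<omega>. (cmod (cinner e (\<phi> \<omega>)))\<^sup>2 \<partial>M) = (\<integral>\<omega>. (\<Sum>e\<in>F. (cmod (cinner e (\<phi> \<omega>)))\<^sup>2) \<partial>M)"
      by (simp add: integrable_cmod_square)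
    also have "\<dots> \<le> (\<integral>\<omega>. 1 \<partial>M)"
    proof (intro integral_mono)
      fix \<omega>
      have "(\<Sum>e\<in>F. (cmod (cinner e (\<phi> \<omega>)))\<^sup>2) \<le> (norm (\<phi> \<omega>))\<^sup>2"
        by (rule onb_bessel(1)[OF is_onb_some_onb F])
      also have "\<dots> \<le> 1" using norm_le_1 by (simp add: power_le_one)
      finally show "(\<Sum>e\<in>F. (cmod (cinner e (\<phi> \<omega>)))\<^sup>2) \<le> 1" .
    qed (simp_all add: integrable_cmod_square)
    finally show ?thesis by (simp add: prob_space)
  qed
  then have "(\<lambda>e. \<integral>\<omega>. (cmod (cinner e (\<phi> \<omega>)))\<^sup>2 \<partial>M) summable_on some_onb"
    by (intro nonneg_bdd_above_summable_on) (auto intro!: bdd_aboveI2)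
  from summable_on_bounded_linear[OF bounded_linear_of_real this] show ?thesis
    by (simp add: cinner_mixture_self o_def)
qed

text \<open>A positive operator is its own absolute value, so the witness demanded by
  \<open>trace_class\<close> is the mixture itself.\<close>

lemma trace_class_mixture: "trace_class (mixture M \<phi>)"
proof -
  have "cadjoint (mixture M \<phi>) = mixture M \<phi>"
    by (intro cadjoint_eqI bounded_clinear_mixture positive_op_selfadjoint positive_op_mixture)
  then show ?thesis
    unfolding trace_class_def
    using bounded_clinear_mixture positive_op_mixture mixture_trace_summable by auto
qed

lemma hilbert_schmidt_mixture: "hilbert_schmidt (mixture M \<phi>)"
proof -
  obtain K where K: "\<And>x. norm (mixture M \<phi> x) \<le> K * norm x"
    using bounded_clinear_bound[OF bounded_clinear_mixture] by blast
  have "(\<lambda>e. Re (cinner e (mixture M \<phi> e))) summable_on some_onb"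
    using summable_on_bounded_linear[OF bounded_linear_Re mixture_trace_summable] by (simp add: o_def)
  then have "(\<lambda>e. K * Re (cinner e (mixture M \<phi> e))) summable_on some_onb"
    by (rule summable_on_cmult_right)
  then have "(\<lambda>e. (norm (mixture M \<phi> e))\<^sup>2) summable_on some_onb"
    by (rule summable_on_comparison_test)
      (auto intro: positive_op_norm_square_le[OF positive_op_mixture K])
  then show ?thesis using bounded_clinear_mixture by (simp add: hilbert_schmidt_def)
qed

text \<open>For each \<open>\<omega>\<close>, Parseval evaluates the basis sum of
  \<open>\<langle>W' \<phi>, e\<rangle> \<langle>e, \<phi>\<rangle>\<close>;
  \<open>has_sum_integral\<close> moves the sum through the integral.\<close>

lemma op_trace_mixture:
  assumes cnt: "countable (some_onb :: 'a set)"
    and W: "\<And>x y. cinner (W' x) y = cinner x (W y)" "\<And>x. norm (W' x) \<le> norm x"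
  shows "op_trace (mixture M \<phi> \<circ> W) = (\<integral>\<omega>. cinner (\<phi> \<omega>) (W (\<phi> \<omega>)) \<partial>M)"
proof -
  have "((\<lambda>e. \<integral>\<omega>. cinner (W' (\<phi> \<omega>)) e * cinner e (\<phi> \<omega>) \<partial>M) has_sum
      (\<integral>\<omega>. cinner (W' (\<phi> \<omega>)) (\<phi> \<omega>) \<partial>M)) some_onb"
  proof (rule has_sum_integral[where B = "\<lambda>_. 1", OF cnt])
    show "integrable M (\<lambda>\<omega>. cinner (W' (\<phi> \<omega>)) e * cinner e (\<phi> \<omega>))" for e
      using integrable_cinner_mixed[of e "W e"] by (simp add: W mult.commute)
    show "(\<Sum>e\<in>F. norm (cinner (W' (\<phi> \<omega>)) e * cinner e (\<phi> \<omega>))) \<le> 1"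
      if F: "finite F" "F \<subseteq> some_onb" for F \<omega>
    proof -
      have "(norm (W' (\<phi> \<omega>)))\<^sup>2 \<le> 1" "(norm (\<phi> \<omega>))\<^sup>2 \<le> 1"
        using norm_le_1[of \<omega>] W(2)[of "\<phi> \<omega>"] by (auto simp: power_le_one)
      then show ?thesis
        using onb_norm_product_le(3)[OF is_onb_some_onb F, of "W' (\<phi> \<omega>)" "\<phi> \<omega>"] by simp
    qed
  qed (auto intro: onb_parseval is_onb_some_onb)
  moreover have "cinner e ((mixture M \<phi> \<circ> W) e) = (\<integral>\<omega>. cinner (W' (\<phi> \<omega>)) e * cinner e (\<phi> \<omega>) \<partial>M)" for e
    by (simp add: cinner_mixture W mult.commute)
  ultimately show ?thesis unfolding op_trace_def by (simp add: infsumI W)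
qed

end

text \<open>For vectors of the unit ball, \<open>|\<phi>\<rangle>\<langle>\<phi>| -
  |\<psi>\<rangle>\<langle>\<psi>|\<close> has Hilbert-Schmidt norm at most
  \<open>2 * norm (\<phi> - \<psi>)\<close>, whence the factor 4; the average is handled by
  convexity of the square.\<close>

lemma hs_norm_mixture_diff_le:
  assumes "vector_mixture M \<phi>" "vector_mixture M \<psi>"
    and meas: "(\<lambda>\<omega>. norm (\<phi> \<omega> - \<psi> \<omega>)) \<in> borel_measurable M"
  shows "(hs_norm (\<lambda>x. mixture M \<phi> x - mixture M \<psi> x))\<^sup>2 \<le> 4 * (\<integral>\<omega>. (norm (\<phi> \<omega> - \<psi> \<omega>))\<^sup>2 \<partial>M)"
proof -
  interpret \<phi>: vector_mixture M \<phi> by fact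
  interpret \<psi>: vector_mixture M \<psi> by fact
  define D where "D x = mixture M \<phi> x - mixture M \<psi> x" for x
  define n where "n \<omega> = norm (\<phi> \<omega> - \<psi> \<omega>)" for \<omega>
  have n: "n \<in> borel_measurable M" "\<And>\<omega>. 0 \<le> n \<omega>" using meas by (auto simp: n_def[abs_def])
  have n2: "n \<omega> \<le> 2" for \<omega>
    using norm_triangle_ineq4[of "\<phi> \<omega>" "\<psi> \<omega>"] \<phi>.norm_le_1[of \<omega>] \<psi>.norm_le_1[of \<omega>]
    by (simp add: n_def)
  then have n4: "(n \<omega>)\<^sup>2 \<le> 4" for \<omega> using power_mono[OF n2 n(2), of \<omega> 2] by simp
  have n_int: "integrable M (\<lambda>\<omega>. (n \<omega>)\<^sup>2)"
    by (rule \<phi>.integrable_const_bound[where B = 4]) (use n n4 in auto)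
  \<comment> \<open>\<open>g e\<close> bounds the squared norm of the difference of rank one
    operators applied to \<open>e\<close>: write that vector as \<open>\<langle>\<phi> - \<psi>,
    e\<rangle> \<phi> + \<langle>\<psi>, e\<rangle> (\<phi> - \<psi>)\<close> and use
    \<open>(a + b)\<^sup>2 \<le> 2 a\<^sup>2 + 2 b\<^sup>2\<close>. By Bessel the sum over
    \<open>e\<close> is at most \<open>4 * (n \<omega>)\<^sup>2\<close>.\<close>
  define g where "g e \<omega> = 2 * (cmod (cinner e (\<phi> \<omega> - \<psi> \<omega>)))\<^sup>2 + 2 * ((cmod (cinner e (\<psi> \<omega>)))\<^sup>2 * (n \<omega>)\<^sup>2)" for e \<omega>
  have g_int: "integrable M (g e)" for e
  proof (rule \<phi>.integrable_const_bound)
    have a: "(cmod (cinner e (\<phi> \<omega> - \<psi> \<omega>)))\<^sup>2 \<le> (norm e)\<^sup>2 * 4" for \<omega>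
    proof -
      have "(cmod (cinner e (\<phi> \<omega> - \<psi> \<omega>)))\<^sup>2 \<le> (norm e * n \<omega>)\<^sup>2"
        unfolding n_def by (intro power_mono norm_cinner_le) simp
      also have "\<dots> \<le> (norm e)\<^sup>2 * 4" unfolding power_mult_distrib by (intro mult_left_mono n4) simp
      finally show ?thesis .
    qed
    have b: "(cmod (cinner e (\<psi> \<omega>)))\<^sup>2 * (n \<omega>)\<^sup>2 \<le> (norm e)\<^sup>2 * 4" for \<omega>
    proof -
      have "cmod (cinner e (\<psi> \<omega>)) \<le> norm e"
        using norm_cinner_le[of e "\<psi> \<omega>"] mult_left_mono[OF \<psi>.norm_le_1[of \<omega>], of "norm e"] by simp
      then show ?thesis using n4 by (intro mult_mono power_mono) auto
    qed
    have "g e \<omega> \<le> 4 * ((norm e)\<^sup>2 * 4)" for \<omega>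
      unfolding g_def using a[of \<omega>] b[of \<omega>] by linarith
    then show "AE \<omega> in M. norm (g e \<omega>) \<le> 4 * ((norm e)\<^sup>2 * 4)"
      by (auto simp: g_def)
    show "g e \<in> borel_measurable M"
      unfolding g_def[abs_def] cinner_diff_right
      using \<phi>.measurable_cinner[of e] \<psi>.measurable_cinner[of e] n(1) by measurable
  qed
  have De: "(norm (D e))\<^sup>2 \<le> (\<integral>\<omega>. g e \<omega> \<partial>M)" for e
  proof -
    define h where "h \<omega> = cinner (D e) (\<phi> \<omega>) * cinner (\<phi> \<omega>) e - cinner (D e) (\<psi> \<omega>) * cinner (\<psi> \<omega>) e" for \<omega>
    have h_int: "integrable M h"
      unfolding h_def[abs_def] by (intro Bochner_Integration.integrable_diff \<phi>.integrable_cinner_mixed \<psi>.integrable_cinner_mixed)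
    have "cinner (D e) (D e) = (\<integral>\<omega>. h \<omega> \<partial>M)"
      unfolding h_def
      by (simp add: \<phi>.integrable_cinner_mixed \<psi>.integrable_cinner_mixed D_def[of e, THEN arg_cong, of "cinner _"]
          cinner_diff_right \<phi>.cinner_mixture \<psi>.cinner_mixture)
    then have "(norm (D e))\<^sup>2 = Re (\<integral>\<omega>. h \<omega> \<partial>M)" unfolding cinner_self by (metis Re_complex_of_real)
    also have "\<dots> = (\<integral>\<omega>. Re (h \<omega>) \<partial>M)" using h_int by simp
    \<comment> \<open>Jensen's inequality in disguise: the term
      \<open>(norm (D e))\<^sup>2 / 2\<close> is absorbed by the left-hand side at the end.\<close>
    also have "\<dots> \<le> (\<integral>\<omega>. (norm (D e))\<^sup>2 / 2 + g e \<omega> / 2 \<partial>M)"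
    proof (intro integral_mono)
      fix \<omega>
      define x where "x = cinner (\<phi> \<omega>) e *\<^sub>C \<phi> \<omega> - cinner (\<psi> \<omega>) e *\<^sub>C \<psi> \<omega>"
      have "x = cinner (\<phi> \<omega> - \<psi> \<omega>) e *\<^sub>C \<phi> \<omega> + cinner (\<psi> \<omega>) e *\<^sub>C (\<phi> \<omega> - \<psi> \<omega>)"
        by (simp add: x_def cinner_simps complex_vector.scale_left_diff_distrib
            complex_vector.scale_right_diff_distrib)
      then have "norm x \<le> cmod (cinner (\<phi> \<omega> - \<psi> \<omega>) e) * norm (\<phi> \<omega>) + cmod (cinner (\<psi> \<omega>) e) * n \<omega>"
        using norm_triangle_ineq[of "cinner (\<phi> \<omega> - \<psi> \<omega>) e *\<^sub>C \<phi> \<omega>" "cinner (\<psi> \<omega>) e *\<^sub>C (\<phi> \<omega> - \<psi> \<omega>)"]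
        by (simp add: norm_scaleC n_def)
      also have "\<dots> \<le> cmod (cinner e (\<phi> \<omega> - \<psi> \<omega>)) + cmod (cinner e (\<psi> \<omega>)) * n \<omega>"
        using mult_left_mono[OF \<phi>.norm_le_1[of \<omega>], of "cmod (cinner (\<phi> \<omega> - \<psi> \<omega>) e)"]
        by (simp add: norm_cinner_commute[of e])
      finally have "(norm x)\<^sup>2 \<le> (cmod (cinner e (\<phi> \<omega> - \<psi> \<omega>)) + cmod (cinner e (\<psi> \<omega>)) * n \<omega>)\<^sup>2"
        by (rule power_mono) simp
      also have "\<dots> \<le> g e \<omega>"
        using sum_squares_bound[of "cmod (cinner e (\<phi> \<omega> - \<psi> \<omega>))" "cmod (cinner e (\<psi> \<omega>)) * n \<omega>"]
        by (simp add: g_def power2_sum power_mult_distrib algebra_simps)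
      finally have x: "(norm x)\<^sup>2 \<le> g e \<omega>" .
      have "Re (h \<omega>) = Re (cinner (D e) x)" by (simp add: h_def x_def cinner_simps mult.commute)
      also have "\<dots> \<le> norm (D e) * norm x" using complex_Re_le_cmod norm_cinner_le order_trans by blast
      also have "\<dots> \<le> (norm (D e))\<^sup>2 / 2 + (norm x)\<^sup>2 / 2"
        using sum_squares_bound[of "norm (D e)" "norm x"] by simp
      finally show "Re (h \<omega>) \<le> (norm (D e))\<^sup>2 / 2 + g e \<omega> / 2" using x by simp
    qed (use h_int g_int in auto)
    also have "\<dots> = (norm (D e))\<^sup>2 / 2 + (\<integral>\<omega>. g e \<omega> \<partial>M) / 2"
      using g_int by (simp add: \<phi>.prob_space)
    finally show ?thesis by simp
  qed
  have fin: "(\<Sum>e\<in>F. (norm (D e))\<^sup>2) \<le> 4 * (\<integral>\<omega>. (n \<omega>)\<^sup>2 \<partial>M)" if F: "finite F" "F \<subseteq> some_onb" for F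
  proof -
    have "(\<Sum>e\<in>F. (norm (D e))\<^sup>2) \<le> (\<Sum>e\<in>F. \<integral>\<omega>. g e \<omega> \<partial>M)" by (intro sum_mono De)
    also have "\<dots> = (\<integral>\<omega>. (\<Sum>e\<in>F. g e \<omega>) \<partial>M)" using g_int by simp
    also have "\<dots> \<le> (\<integral>\<omega>. 4 * (n \<omega>)\<^sup>2 \<partial>M)"
    proof (intro integral_mono)
      fix \<omega>
      note bessel = onb_bessel(1)[OF is_onb_some_onb F]
      have "(\<Sum>e\<in>F. (cmod (cinner e (\<psi> \<omega>)))\<^sup>2) \<le> 1"
        using bessel[of "\<psi> \<omega>"] power_le_one[OF norm_ge_zero \<psi>.norm_le_1[of \<omega>], of 2] by simp
      from mult_right_mono[OF this, of "(n \<omega>)\<^sup>2"] bessel[of "\<phi> \<omega> - \<psi> \<omega>"]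
      show "(\<Sum>e\<in>F. g e \<omega>) \<le> 4 * (n \<omega>)\<^sup>2"
        by (simp add: g_def sum.distrib n_def flip: sum_distrib_left sum_distrib_right)
    qed (use g_int n_int in auto)
    finally show ?thesis by simp
  qed
  have "hilbert_schmidt D"
    unfolding D_def[abs_def] by (intro hs_diff \<phi>.hilbert_schmidt_mixture \<psi>.hilbert_schmidt_mixture)
  then have "(\<lambda>e. (norm (D e))\<^sup>2) summable_on some_onb" by (simp add: hilbert_schmidt_def)
  from infsum_le_finite_sums[OF this fin]
  show ?thesis by (simp add: hs_norm_def D_def n_def infsum_nonneg)
qed

section \<open>Gaussian integrals and Fourier uniqueness\<close>

lemma lborel_prod_integral:
  fixes f :: "'a::euclidean_space \<Rightarrow> real \<Rightarrow> complex"
  assumes f: "\<And>b. b \<in> Basis \<Longrightarrow> integrable lborel (f b)"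
  shows "integrable lborel (\<lambda>x::'a. \<Prod>b\<in>Basis. f b (x \<bullet> b))"
    and "(\<integral>x. (\<Prod>b\<in>Basis. f b (x \<bullet> b)) \<partial>lborel) = (\<Prod>b\<in>Basis. \<integral>t. f b t \<partial>lborel)"
proof -
  interpret product_sigma_finite "\<lambda>_::'a. lborel :: real measure" ..
  have [measurable]: "f b \<in> borel_measurable borel" if "b \<in> Basis" for b
    using f[OF that] by auto
  have eq: "(\<Prod>b\<in>Basis. f b ((\<Sum>c\<in>Basis. x c *\<^sub>R c) \<bullet> b)) = (\<Prod>b\<in>Basis. f b (x b))" for x
    by (intro prod.cong) simp_all
  have int: "integrable (\<Pi>\<^sub>M b\<in>Basis. lborel) (\<lambda>x. \<Prod>b\<in>Basis. f b (x b))"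
    by (rule product_integrable_prod) (use f in auto)
  show "integrable lborel (\<lambda>x::'a. \<Prod>b\<in>Basis. f b (x \<bullet> b))"
    unfolding lborel_eq[where 'a = 'a]
    by (subst integrable_distr_eq) (simp_all add: eq int)
  show "(\<integral>x. (\<Prod>b\<in>Basis. f b (x \<bullet> b)) \<partial>lborel) = (\<Prod>b\<in>Basis. \<integral>t. f b t \<partial>lborel)"
    unfolding lborel_eq[where 'a = 'a]
    by (subst integral_distr) (simp_all add: eq product_integral_prod f)
qed

lemma integrable_scaleR_iff:
  fixes f :: "'w \<Rightarrow> 'b::{banach, second_countable_topology}"
  assumes "c \<noteq> 0"
  shows "integrable M (\<lambda>x. c *\<^sub>R f x) \<longleftrightarrow> integrable M f"
  using integrable_scaleR_right[of "1 / c" M "\<lambda>x. c *\<^sub>R f x"] assms by auto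

lemma lborel_integral_affine:
  fixes f :: "'a::euclidean_space \<Rightarrow> 'b::{banach, second_countable_topology}"
  assumes c: "c \<noteq> 0" and [measurable]: "f \<in> borel_measurable borel"
  shows "(\<integral>x. f x \<partial>lborel) = \<bar>c\<bar> ^ DIM('a) *\<^sub>R (\<integral>x. f (t + c *\<^sub>R x) \<partial>lborel)"
    and "integrable lborel f \<longleftrightarrow> integrable lborel (\<lambda>x. f (t + c *\<^sub>R x))"
proof -
  show "(\<integral>x. f x \<partial>lborel) = \<bar>c\<bar> ^ DIM('a) *\<^sub>R (\<integral>x. f (t + c *\<^sub>R x) \<partial>lborel)"
    using c by (subst lborel_affine[OF c, of t]) (simp add: integral_density integral_distr)
  show "integrable lborel f \<longleftrightarrow> integrable lborel (\<lambda>x. f (t + c *\<^sub>R x))"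
    using c by (subst lborel_affine[OF c, of t])
      (simp add: integrable_density integrable_distr_eq integrable_scaleR_iff)
qed

text \<open>Variance 1/2 in each coordinate. With this normalisation \<open>sqrt (gauss x)\<close>
  is the ground state wave function, annihilated by every \<open>annihilation j\<close>, and on
  phase space \<open>gauss\<close> is the Glauber-Sudarshan weight of mean photon number
  one.\<close>

definition gauss :: "'a::euclidean_space \<Rightarrow> real" where
  "gauss x = exp (- (norm x)\<^sup>2) / sqrt pi ^ DIM('a)"

lemma gauss_pos: "0 < gauss x"
  by (simp add: gauss_def)

lemma gauss_nonneg [simp]: "0 \<le> gauss x"
  using gauss_pos[of x] by simp

lemma gauss_minus [simp]: "gauss (- x) = gauss x"
  by (simp add: gauss_def)

lemma borel_measurable_gauss [measurable]: "gauss \<in> borel_measurable borel"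
  unfolding gauss_def[abs_def] by measurable

lemma gauss_prod: "gauss (x::'a::euclidean_space) = (\<Prod>b\<in>Basis. gauss (x \<bullet> b))"
proof -
  have "(norm x)\<^sup>2 = (\<Sum>b\<in>Basis. (x \<bullet> b)\<^sup>2)"
    unfolding power2_norm_eq_inner by (subst euclidean_inner) (simp add: power2_eq_square)
  then show ?thesis by (simp add: gauss_def prod_dividef exp_sum flip: sum_negf)
qed

lemma gauss_real:
  fixes t :: real
  shows "integrable lborel (gauss :: real \<Rightarrow> real)"
    and "(\<integral>x. of_real (gauss x) * cis (t * x) \<partial>lborel) = of_real (exp (- t\<^sup>2 / 4))"
proof -
  have dens: "gauss x = normal_density 0 (1 / sqrt 2) x" for x :: real
    by (simp add: gauss_def normal_density_def power_divide)
  have dens': "gauss x = sqrt 2 * std_normal_density (sqrt 2 * x)" for x :: real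
    by (simp add: gauss_def normal_density_def power_mult_distrib real_sqrt_mult)
  show "integrable lborel (gauss :: real \<Rightarrow> real)" unfolding dens by simp
  have "complex_of_real (exp (- (t / sqrt 2)\<^sup>2 / 2)) = char std_normal_distribution (t / sqrt 2)"
    unfolding char_std_normal_distribution ..
  also have "\<dots> = (\<integral>x. std_normal_density x *\<^sub>R iexp (t / sqrt 2 * x) \<partial>lborel)"
    unfolding char_def by (subst integral_density) auto
  also have "\<dots> = sqrt 2 *\<^sub>R (\<integral>x. std_normal_density (sqrt 2 * x) *\<^sub>R iexp (t * x) \<partial>lborel)"
    by (subst lborel_integral_affine(1)[where c = "sqrt 2" and t = 0]) auto
  also have "\<dots> = (\<integral>x. of_real (gauss x) * cis (t * x) \<partial>lborel)"
    by (subst integral_scaleR_right[symmetric], simp, intro Bochner_Integration.integral_cong)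
      (simp_all add: dens' cis_conv_exp scaleR_conv_of_real mult.assoc)
  finally show "(\<integral>x. of_real (gauss x) * cis (t * x) \<partial>lborel) = of_real (exp (- t\<^sup>2 / 4))"
    by (simp add: power_divide)
qed

lemma gauss_char:
  fixes q :: "'a::euclidean_space"
  shows "integrable lborel (gauss :: 'a \<Rightarrow> real)"
    and "(\<integral>x. of_real (gauss x) * cis (q \<bullet> x) \<partial>lborel) = of_real (exp (- (norm q)\<^sup>2 / 4))"
proof -
  define f where "f q b t = complex_of_real (gauss t) * cis (q \<bullet> b * t)" for q b :: 'a and t :: real
  have f_int: "integrable lborel (f q b)" for q b
  proof (rule Bochner_Integration.integrable_bound[OF gauss_real(1)])
    show "f q b \<in> borel_measurable lborel" unfolding f_def[abs_def] cis_conv_exp by measurable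
  qed (simp add: f_def norm_mult)
  have prod: "(\<Prod>b\<in>Basis. f q b (x \<bullet> b)) = of_real (gauss x) * cis (q \<bullet> x)" for q x
  proof -
    have "(\<Prod>b\<in>Basis. cis (q \<bullet> b * (x \<bullet> b))) = cis (q \<bullet> x)"
      unfolding cis_conv_exp euclidean_inner[of q x]
      by (simp add: sum_distrib_left flip: exp_sum)
    then show ?thesis unfolding f_def by (simp add: prod.distrib gauss_prod[of x])
  qed
  have "integrable lborel (\<lambda>x. complex_of_real (gauss (x :: 'a)))"
    using lborel_prod_integral(1)[of "f 0", OF f_int] by (simp add: prod)
  then show "integrable lborel (gauss :: 'a \<Rightarrow> real)" by (simp only: complex_of_real_integrable_eq)
  have "(norm q)\<^sup>2 = (\<Sum>b\<in>Basis. (q \<bullet> b)\<^sup>2)"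
    unfolding power2_norm_eq_inner by (subst euclidean_inner) (simp add: power2_eq_square)
  then have "(\<Prod>b\<in>Basis. exp (- (q \<bullet> b)\<^sup>2 / 4)) = exp (- (norm q)\<^sup>2 / 4)"
    by (simp add: sum_negf sum_divide_distrib flip: exp_sum)
  then show "(\<integral>x. of_real (gauss x) * cis (q \<bullet> x) \<partial>lborel) = of_real (exp (- (norm q)\<^sup>2 / 4))"
    using lborel_prod_integral(2)[of "f q", OF f_int]
    unfolding prod by (simp add: f_def gauss_real flip: of_real_prod)
qed

lemma integral_gauss: "(\<integral>x. gauss (x::'a::euclidean_space) \<partial>lborel) = 1"
proof -
  have "complex_of_real (\<integral>x. gauss (x::'a) \<partial>lborel) = 1"
    using gauss_char(2)[of "0::'a"] by simp
  then show ?thesis by (simp only: of_real_eq_1_iff)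
qed

text \<open>Integrating against a Gaussian in the frequency variable turns the characters into Gaussians.\<close>

lemma fourier_zero_gauss:
  fixes h :: "'a::euclidean_space \<Rightarrow> complex"
  assumes h: "integrable lborel h" and zero: "\<And>q. (\<integral>x. h x * cis (q \<bullet> x) \<partial>lborel) = 0"
  shows "(\<integral>x. h x * of_real (gauss (r *\<^sub>R (x - y))) \<partial>lborel) = 0"
proof -
  have [measurable]: "h \<in> borel_measurable borel" using h by auto
  \<comment> \<open>The transform of \<open>gauss\<close> at \<open>\<xi>\<close> is
    \<open>exp (- (norm \<xi>)\<^sup>2 / 4)\<close>; the frequency \<open>2 r (x - y)\<close>
    therefore produces \<open>exp (- (norm (r (x - y)))\<^sup>2)\<close>.\<close>
  define F where "F x w = h x * (of_real (gauss w) * cis ((2 * r) *\<^sub>R (x - y) \<bullet> w))" for x w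
  have F_meas: "case_prod F \<in> borel_measurable (lborel \<Otimes>\<^sub>M lborel)"
    unfolding F_def case_prod_beta' cis_conv_exp by measurable
  have "integrable (lborel \<Otimes>\<^sub>M lborel) (case_prod F)"
  proof (rule lborel_pair.Fubini_integrable[OF F_meas])
    have "(\<integral>w. norm (case_prod F (x, w)) \<partial>lborel) = norm (h x)" for x
      by (simp add: F_def norm_mult integral_gauss)
    then show "integrable lborel (\<lambda>x. \<integral>w. norm (case_prod F (x, w)) \<partial>lborel)" using h by simp
    have "integrable lborel (F x)" for x
      by (rule Bochner_Integration.integrable_bound[of _ "\<lambda>w. norm (h x) * gauss w"])
        (use gauss_char(1) in \<open>auto simp: F_def[abs_def] norm_mult cis_conv_exp\<close>)
    then show "AE x in lborel. integrable lborel (\<lambda>w. case_prod F (x, w))" by simp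
  qed
  from lborel_pair.Fubini_integral[OF this]
  have "(\<integral>w. (\<integral>x. F x w \<partial>lborel) \<partial>lborel) = (\<integral>x. (\<integral>w. F x w \<partial>lborel) \<partial>lborel)" .
  moreover have "(\<integral>x. F x w \<partial>lborel) = 0" for w
  proof -
    have "F x w = (of_real (gauss w) * cis (- ((2 * r) *\<^sub>R y \<bullet> w))) * (h x * cis ((2 * r) *\<^sub>R w \<bullet> x))" for x
    proof -
      have "cis ((2 * r) *\<^sub>R (x - y) \<bullet> w) = cis (- ((2 * r) *\<^sub>R y \<bullet> w)) * cis ((2 * r) *\<^sub>R w \<bullet> x)"
        unfolding cis_mult by (simp add: inner_diff_left inner_diff_right inner_commute algebra_simps)
      then show ?thesis by (simp add: F_def)
    qed
    then show ?thesis using zero[of "(2 * r) *\<^sub>R w"] by simp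
  qed
  moreover have "(\<integral>w. F x w \<partial>lborel) = h x * of_real (exp (- (norm (r *\<^sub>R (x - y)))\<^sup>2))" for x
  proof -
    have "(norm ((2 * r) *\<^sub>R (x - y)))\<^sup>2 / 4 = (norm (r *\<^sub>R (x - y)))\<^sup>2"
      by (simp add: power_mult_distrib)
    then show ?thesis
      unfolding F_def using gauss_char(2)[of "(2 * r) *\<^sub>R (x - y)"] by simp
  qed
  ultimately have "(\<integral>x. h x * of_real (exp (- (norm (r *\<^sub>R (x - y)))\<^sup>2)) \<partial>lborel) = 0" by simp
  then have "(\<integral>x. (h x * of_real (exp (- (norm (r *\<^sub>R (x - y)))\<^sup>2))) / of_real (sqrt pi ^ DIM('a)) \<partial>lborel) = 0"
    by (simp only: integral_divide_zero div_0)
  then show ?thesis by (simp add: gauss_def)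
qed

text \<open>The Gaussian mollification \<open>S r\<close> of \<open>s\<close> superposes the
  functions of \<open>fourier_zero_gauss\<close>, so by Fubini \<open>h\<close> integrates to zero
  against it. Boundedness of \<open>s\<close> then permits \<open>r\<close> to tend to
  infinity.\<close>

lemma fourier_zero_continuous:
  fixes h :: "'a::euclidean_space \<Rightarrow> complex" and s :: "'a \<Rightarrow> real"
  assumes h: "integrable lborel h" and zero: "\<And>q. (\<integral>x. h x * cis (q \<bullet> x) \<partial>lborel) = 0"
    and s: "continuous_on UNIV s" and bound: "\<And>x. \<bar>s x\<bar> \<le> C"
  shows "(\<integral>x. h x * of_real (s x) \<partial>lborel) = 0"
proof -
  have [measurable]: "h \<in> borel_measurable borel" using h by auto
  have [measurable]: "s \<in> borel_measurable borel" using s by (rule borel_measurable_continuous_onI)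
  have C: "0 \<le> C" using bound[of 0] by simp
  define S where "S r x = (\<integral>z. s (x + (1 / r) *\<^sub>R z) * gauss z \<partial>lborel)" for r x
  have s_int: "integrable lborel (\<lambda>z. s (x + c *\<^sub>R z) * gauss z)" for x c
    by (rule Bochner_Integration.integrable_bound[of _ "\<lambda>z. C * gauss z"])
      (use gauss_char(1) bound C in \<open>auto simp: abs_mult intro!: mult_right_mono\<close>)
  have s_abs_int: "integrable lborel (\<lambda>z. \<bar>s (x + c *\<^sub>R z)\<bar> * gauss z)" for x c
    using integrable_norm[OF s_int[of x c]] by (simp add: abs_mult)
  have S_bound: "\<bar>S r x\<bar> \<le> C" for r x
  proof -
    have "\<bar>S r x\<bar> \<le> (\<integral>z. \<bar>s (x + (1 / r) *\<^sub>R z) * gauss z\<bar> \<partial>lborel)"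
      unfolding S_def using integral_norm_bound[of lborel "\<lambda>z. s (x + (1 / r) *\<^sub>R z) * gauss z"] by simp
    also have "\<dots> \<le> (\<integral>z. C * gauss (z::'a) \<partial>lborel)"
      using s_abs_int[of x "1 / r"] gauss_char(1) bound
      by (intro Bochner_Integration.integral_mono) (auto simp: abs_mult intro!: mult_right_mono)
    finally show ?thesis by (simp add: integral_gauss)
  qed
  have S_meas [measurable]: "S r \<in> borel_measurable borel" for r
    unfolding S_def[abs_def] by measurable
  have hS: "(\<integral>x. h x * of_real (S r x) \<partial>lborel) = 0" if r: "r > 0" for r :: real
  proof -
    define F where "F x y = h x * of_real (s y * gauss (r *\<^sub>R (x - y)))" for x y
    have shift: "gauss (r *\<^sub>R (x - (x + (1 / r) *\<^sub>R z))) = gauss z" for x z :: 'a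
      using r by simp
    have F_meas: "case_prod F \<in> borel_measurable (lborel \<Otimes>\<^sub>M lborel)"
      unfolding F_def case_prod_beta' by measurable
    \<comment> \<open>The substitution \<open>y = x + z / r\<close> identifies the superposition of
      translated Gaussians with \<open>S r\<close>, up to the Jacobian.\<close>
    have aff: "(\<integral>y. k y * gauss (r *\<^sub>R (x - y)) \<partial>lborel) =
        (1 / r) ^ DIM('a) * (\<integral>z. k (x + (1 / r) *\<^sub>R z) * gauss z \<partial>lborel)"
      if [measurable]: "k \<in> borel_measurable borel" for k :: "'a \<Rightarrow> real" and x
      using r by (subst lborel_integral_affine(1)[where c = "1 / r" and t = x]) (simp_all add: shift)
    have aff_int: "integrable lborel (\<lambda>y. s y * gauss (r *\<^sub>R (x - y)))" for x
      using r s_int by (subst lborel_integral_affine(2)[where c = "1 / r" and t = x]) (simp_all add: shift)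
    have "integrable (lborel \<Otimes>\<^sub>M lborel) (case_prod F)"
    proof (rule lborel_pair.Fubini_integrable[OF F_meas])
      let ?k = "\<lambda>x. (1 / r) ^ DIM('a) * (\<integral>z. \<bar>s (x + (1 / r) *\<^sub>R z)\<bar> * gauss z \<partial>lborel)"
      have eq: "(\<integral>y. norm (case_prod F (x, y)) \<partial>lborel) = norm (h x) * ?k x" for x
        using aff[of "\<lambda>y. \<bar>s y\<bar>" x] by (simp add: F_def norm_mult abs_mult)
      have k: "\<bar>?k x\<bar> \<le> (1 / r) ^ DIM('a) * C" for x
      proof -
        have "(\<integral>z. \<bar>s (x + (1 / r) *\<^sub>R z)\<bar> * gauss z \<partial>lborel) \<le> (\<integral>z. C * gauss (z::'a) \<partial>lborel)"
          using s_abs_int[of x "1 / r"] gauss_char(1) bound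
          by (intro Bochner_Integration.integral_mono) (auto simp: abs_mult intro!: mult_right_mono)
        then show ?thesis
          using r by (simp add: abs_mult integral_gauss divide_right_mono)
      qed
      show "integrable lborel (\<lambda>x. \<integral>y. norm (case_prod F (x, y)) \<partial>lborel)"
        unfolding eq
      proof (rule Bochner_Integration.integrable_bound[of _ "\<lambda>x. norm (h x) * ((1 / r) ^ DIM('a) * C)"])
        show "AE x in lborel. norm (norm (h x) * ?k x) \<le> norm (norm (h x) * ((1 / r) ^ DIM('a) * C))"
        proof (intro AE_I2)
          fix x
          have "norm (norm (h x) * ?k x) = norm (h x) * \<bar>?k x\<bar>"
            by (subst norm_mult) (simp only: real_norm_def abs_norm_cancel)
          also have "\<dots> \<le> norm (h x) * ((1 / r) ^ DIM('a) * C)" by (intro mult_left_mono k) simp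
          also have "\<dots> \<le> norm (norm (h x) * ((1 / r) ^ DIM('a) * C))"
            by (simp only: real_norm_def abs_ge_self)
          finally show "norm (norm (h x) * ?k x) \<le> norm (norm (h x) * ((1 / r) ^ DIM('a) * C))" .
        qed
      qed (use h in auto)
      show "AE x in lborel. integrable lborel (\<lambda>y. case_prod F (x, y))"
        using aff_int by (simp add: F_def del: of_real_mult)
    qed
    from lborel_pair.Fubini_integral[OF this]
    have "(\<integral>y. (\<integral>x. F x y \<partial>lborel) \<partial>lborel) = (\<integral>x. (\<integral>y. F x y \<partial>lborel) \<partial>lborel)" .
    moreover have "(\<integral>x. F x y \<partial>lborel) = 0" for y
      using fourier_zero_gauss[OF h zero, of r y]
      by (simp add: F_def mult.left_commute[of "h _"])
    moreover have "(\<integral>y. F x y \<partial>lborel) = of_real ((1 / r) ^ DIM('a)) * (h x * of_real (S r x))" for x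
      unfolding F_def using aff[of s x] by (simp add: S_def del: of_real_mult) (simp add: mult_ac)
    ultimately show ?thesis using r by simp
  qed
  have "(\<lambda>n. \<integral>x. h x * of_real (S (real (Suc n)) x) \<partial>lborel) \<longlonglongrightarrow> (\<integral>x. h x * of_real (s x) \<partial>lborel)"
  proof (rule integral_dominated_convergence[where w = "\<lambda>x. norm (h x) * C"])
    have "(\<lambda>n. S (real (Suc n)) x) \<longlonglongrightarrow> (\<integral>z. s x * gauss (z::'a) \<partial>lborel)" for x
      unfolding S_def
    proof (rule integral_dominated_convergence[where w = "\<lambda>z. C * gauss z"])
      show "AE z in lborel. (\<lambda>n. s (x + (1 / real (Suc n)) *\<^sub>R z) * gauss z) \<longlonglongrightarrow> s x * gauss z"
      proof (intro AE_I2 tendsto_mult tendsto_const)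
        fix z
        have "(\<lambda>n. x + (1 / real (Suc n)) *\<^sub>R z) \<longlonglongrightarrow> x + 0 *\<^sub>R z"
          using LIMSEQ_inverse_real_of_nat by (intro tendsto_intros) (simp add: inverse_eq_divide)
        then show "(\<lambda>n. s (x + (1 / real (Suc n)) *\<^sub>R z)) \<longlonglongrightarrow> s x"
          using continuous_on_tendsto_compose[OF s] by simp
      qed
    qed (use gauss_char(1) bound in \<open>auto simp: abs_mult intro!: mult_right_mono\<close>)
    then show "AE x in lborel. (\<lambda>n. h x * of_real (S (real (Suc n)) x)) \<longlonglongrightarrow> h x * of_real (s x)"
      by (intro AE_I2 tendsto_mult tendsto_const tendsto_of_real) (simp add: integral_gauss)
    show "AE x in lborel. norm (h x * of_real (S (real (Suc n)) x)) \<le> norm (h x) * C" for n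
      using S_bound by (intro AE_I2) (simp add: norm_mult mult_left_mono)
  qed (use h in auto)
  then have "(\<lambda>n. 0) \<longlonglongrightarrow> (\<integral>x. h x * of_real (s x) \<partial>lborel)" using hS by simp
  then show ?thesis using LIMSEQ_unique tendsto_const by blast
qed

text \<open>The indicator of \<open>U\<close> is the pointwise limit of the continuous functions
  \<open>min 1 (n * dist)\<close>, with the distance taken to the complement.\<close>

lemma fourier_zero_open:
  fixes h :: "'a::euclidean_space \<Rightarrow> complex"
  assumes h: "integrable lborel h" and zero: "\<And>q. (\<integral>x. h x * cis (q \<bullet> x) \<partial>lborel) = 0"
    and U: "open U"
  shows "(LINT x:U|lborel. h x) = 0"
\<comment> \<open>\<open>infdist\<close> to the empty complement is 0 by convention, so the whole
  space is settled separately, by frequency zero.\<close>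
proof (cases "U = UNIV")
  case True
  then show ?thesis using zero[of 0] by (simp add: set_lebesgue_integral_def)
next
  case False
  have [measurable]: "h \<in> borel_measurable borel" using h by auto
  have U_meas [measurable]: "U \<in> sets borel" using U by simp
  define s where "s n x = min 1 (real n * infdist x (- U))" for n x
  have s1: "0 \<le> s n x \<and> s n x \<le> 1" for n x by (simp add: s_def infdist_nonneg)
  have cont: "continuous_on UNIV (s n)" for n
    unfolding s_def[abs_def] by (intro continuous_intros)
  have [measurable]: "s n \<in> borel_measurable borel" for n
    using cont by (rule borel_measurable_continuous_onI)
  have "(\<lambda>n. \<integral>x. h x * of_real (s n x) \<partial>lborel) \<longlonglongrightarrow> (\<integral>x. h x * of_real (indicator U x) \<partial>lborel)"
  proof (rule integral_dominated_convergence[where w = "\<lambda>x. norm (h x)"])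
    show "AE x in lborel. (\<lambda>n. h x * of_real (s n x)) \<longlonglongrightarrow> h x * of_real (indicator U x)"
    proof (intro AE_I2 tendsto_mult tendsto_const tendsto_of_real)
      fix x
      show "(\<lambda>n. s n x) \<longlonglongrightarrow> indicator U x"
      proof (cases "x \<in> U")
        case True
        have "infdist x (- U) > 0"
          using U True False by (metis ComplD Compl_empty_eq closed_Compl double_compl in_closed_iff_infdist_zero
              infdist_nonneg less_le)
        then have "\<forall>\<^sub>F n in sequentially. 1 \<le> real n * infdist x (- U)"
          using filterlim_tendsto_pos_mult_at_top
          by real_asymp
        then have "\<forall>\<^sub>F n in sequentially. s n x = indicator U x"
          by eventually_elim (simp add: s_def True)
        then show ?thesis by (rule tendsto_eventually)
      qed (simp add: s_def)
    qed
    show "AE x in lborel. norm (h x * of_real (s n x)) \<le> norm (h x)" for n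
      using s1 by (intro AE_I2) (simp add: norm_mult mult_left_le)
  qed (use h in auto)
  moreover have "(\<integral>x. h x * of_real (s n x) \<partial>lborel) = 0" for n
    by (rule fourier_zero_continuous[OF h zero cont, where C = 1]) (use s1 in \<open>simp add: abs_le_iff order_trans[of _ 0]\<close>)
  ultimately have "(\<lambda>n. 0) \<longlonglongrightarrow> (\<integral>x. h x * of_real (indicator U x) \<partial>lborel)" by simp
  then have "(\<integral>x. h x * of_real (indicator U x) \<partial>lborel) = 0"
    using LIMSEQ_unique tendsto_const by blast
  then show ?thesis
    by (simp add: set_lebesgue_integral_def scaleR_conv_of_real mult.commute)
qed

text \<open>Open sets form an intersection-stable generator of the Borel sets, so a Dynkin argument
  carries the vanishing of the set integrals of \<open>h\<close> to all Borel sets, and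
  \<open>h\<close> is zero almost everywhere.\<close>

theorem fourier_unique:
  fixes f g :: "'a::euclidean_space \<Rightarrow> complex"
  assumes f: "integrable lborel f" and g: "integrable lborel g"
    and eq: "\<And>q. (\<integral>x. f x * cis (q \<bullet> x) \<partial>lborel) = (\<integral>x. g x * cis (q \<bullet> x) \<partial>lborel)"
  shows "AE x in lborel. f x = g x"
proof -
  define h where "h x = f x - g x" for x
  have h: "integrable lborel h" unfolding h_def[abs_def] using f g by simp
  have cis_int: "integrable lborel (\<lambda>x. k x * cis (q \<bullet> x))" if k: "integrable lborel k" for k and q :: 'a
    by (rule Bochner_Integration.integrable_bound[OF k])
      (use k in \<open>auto simp: norm_mult cis_conv_exp\<close>)
  have zero: "(\<integral>x. h x * cis (q \<bullet> x) \<partial>lborel) = 0" for q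
    unfolding h_def left_diff_distrib using cis_int f g eq by simp
  have si: "set_integrable lborel A h" if "A \<in> sets borel" for A
    unfolding set_integrable_def using h that by (intro integrable_mult_indicator) auto
  have "(LINT x:A|lborel. h x) = 0" if A: "A \<in> sets borel" for A
  proof -
    have "Int_stable {S :: 'a set. open S}" by (auto simp: Int_stable_def)
    moreover have "{S :: 'a set. open S} \<subseteq> Pow UNIV" by simp
    moreover have "A \<in> sigma_sets UNIV {S. open S}" using A by (simp add: borel_def)
    ultimately show ?thesis
    proof (induction A rule: sigma_sets_induct_disjoint)
      case (basic A)
      then show ?case using fourier_zero_open[OF h zero] by simp
    next
      case empty
      then show ?case by (simp add: set_lebesgue_integral_def)
    next
      case (compl A)
      then have A: "A \<in> sets borel" by (simp add: borel_def)
      have "(LINT x:UNIV|lborel. h x) = 0" using fourier_zero_open[OF h zero open_UNIV] .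
      moreover have "(LINT x:A \<union> (UNIV - A)|lborel. h x) = (LINT x:A|lborel. h x) + (LINT x:UNIV - A|lborel. h x)"
        using A by (intro set_integral_Un si) auto
      ultimately show ?case using compl by simp
    next
      case (union A)
      then have A: "A i \<in> sets borel" for i by (auto simp: borel_def)
      have "(LINT x:(\<Union>i. A i)|lborel. h x) = (\<Sum>i. LINT x:A i|lborel. h x)"
        using A union(1) by (intro lebesgue_integral_countable_add si) (auto simp: disjoint_family_on_def)
      then show ?case using union by simp
    qed
  qed
  then have "AE x in lborel. h x = 0"
    using sigma_finite_measure.density_zero[OF sigma_finite_lborel h] by simp
  then show ?thesis by eventually_elim (simp add: h_def)
qed

section \<open>Weyl operators and coherent states\<close>

lemma rep_l2_measurable [measurable]: "rep_l2 f \<in> borel_measurable borel"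
  using square_integrable_rep[of f] by (simp add: square_integrable_def)

lemma abs_rep_l2 [simp]: "abs_l2 (rep_l2 f) = f"
  by (rule Quotient_abs_rep[OF Quotient_l2])

lemma cinner_l2_rep: "cinner f g = (\<integral>x. cnj (rep_l2 f x) * rep_l2 g x \<partial>lborel)"
  by (simp add: cinner_l2_def l2_cinner.rep_eq)

lemma cinner_abs_l2:
  assumes "square_integrable f" "square_integrable g"
  shows "cinner (abs_l2 f) (abs_l2 g) = (\<integral>x. cnj (f x) * g x \<partial>lborel)"
  unfolding cinner_l2_def by (rule l2_cinner.abs_eq) (use assms in \<open>auto intro: l2_rel_refl\<close>)

section \<open>Unitarity of the Weyl operators and the Weyl relations\<close>

lemma square_integrable_displacement:
  assumes "square_integrable f"
  shows "square_integrable (displacement z f)"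
proof -
  have [measurable]: "f \<in> borel_measurable borel" using assms by (simp add: square_integrable_def)
  have "integrable lborel (\<lambda>x. (norm (f (- sqrt 2 *\<^sub>R fst z + 1 *\<^sub>R x)))\<^sup>2)"
    by (subst lborel_integral_affine(2)[symmetric]) (use assms in \<open>auto simp: square_integrable_def\<close>)
  moreover have "displacement z f \<in> borel_measurable borel"
    unfolding displacement_def[abs_def] cis_conv_exp by measurable
  ultimately show ?thesis
    by (simp add: square_integrable_def displacement_def norm_mult add.commute[of "- _"])
qed

lemma weyl_abs_l2:
  assumes "square_integrable f"
  shows "weyl z (abs_l2 f) = abs_l2 (displacement z f)"
  by (rule weyl.abs_eq[OF l2_rel_refl[OF assms]])

lemma weyl_rep: "weyl z f = abs_l2 (displacement z (rep_l2 f))"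
  using weyl_abs_l2[OF square_integrable_rep, of z f] by simp

lemma scaleC_abs_l2:
  assumes "square_integrable f"
  shows "c *\<^sub>C abs_l2 f = abs_l2 (\<lambda>x. c * f x)"
  unfolding scaleC_l2_def by (rule l2_scale.abs_eq[OF l2_rel_refl[OF assms]])

lemma add_abs_l2:
  assumes "square_integrable f" "square_integrable g"
  shows "abs_l2 f + abs_l2 g = abs_l2 (\<lambda>x. f x + g x)"
  using assms by (intro plus_l2.abs_eq l2_rel_refl)

lemma weyl_add: "weyl z (f + g) = weyl z f + weyl z g"
proof -
  have "f + g = abs_l2 (\<lambda>x. rep_l2 f x + rep_l2 g x)"
    using add_abs_l2[OF square_integrable_rep square_integrable_rep, of f g] by simp
  then show ?thesis
    by (simp add: weyl_abs_l2 weyl_rep[of z f] weyl_rep[of z g] add_abs_l2 square_integrable_rep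
        square_integrable_add square_integrable_displacement)
      (simp add: displacement_def[abs_def] distrib_left)
qed

lemma weyl_scaleC: "weyl z (c *\<^sub>C f) = c *\<^sub>C weyl z f"
proof -
  have "c *\<^sub>C f = abs_l2 (\<lambda>x. c * rep_l2 f x)"
    using scaleC_abs_l2[OF square_integrable_rep, of c f] by simp
  then show ?thesis
    by (simp add: weyl_abs_l2 weyl_rep[of z f] scaleC_abs_l2 square_integrable_rep
        square_integrable_cmult square_integrable_displacement)
      (simp add: displacement_def[abs_def] mult.left_commute)
qed

text \<open>The canonical commutation relations in Weyl form; the phase is the symplectic form of
  the labels. It vanishes on proportional labels, so \<open>weyl (- z)\<close> inverts
  \<open>weyl z\<close>.\<close>

lemma weyl_weyl:
  "weyl z (weyl w f) = cis (fst w \<bullet> snd z - fst z \<bullet> snd w) *\<^sub>C weyl (z + w) f"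
proof -
  have "displacement z (displacement w g) =
      (\<lambda>x. cis (fst w \<bullet> snd z - fst z \<bullet> snd w) * displacement (z + w) g x)" for g :: "'a \<Rightarrow> complex"
  proof
    fix x :: 'a
    obtain p q p' q' where z: "z = (p, q)" and w: "w = (p', q')" by (cases z; cases w)
    have "sqrt 2 * (q \<bullet> x) - p \<bullet> q + (sqrt 2 * (q' \<bullet> (x - sqrt 2 *\<^sub>R p)) - p' \<bullet> q') =
        (p' \<bullet> q - p \<bullet> q') + (sqrt 2 * ((q + q') \<bullet> x) - (p + p') \<bullet> (q + q'))"
      by (simp add: inner_add_left inner_add_right inner_diff_right inner_commute[of q' p] algebra_simps)
    then show "displacement z (displacement w g) x =
        cis (fst w \<bullet> snd z - fst z \<bullet> snd w) * displacement (z + w) g x"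
      by (simp add: displacement_def z w scaleR_add_right diff_diff_eq cis_mult)
  qed
  then show ?thesis
    by (simp add: weyl_rep[of w f] weyl_rep[of "z + w" f] weyl_abs_l2 square_integrable_displacement
        square_integrable_rep scaleC_abs_l2)
qed

lemma weyl_0 [simp]: "weyl 0 f = f"
  by (simp add: weyl_rep displacement_def[abs_def])

lemma cinner_weyl_weyl: "cinner (weyl z f) (weyl z g) = cinner f g"
proof -
  define h where "h x = cnj (rep_l2 f x) * rep_l2 g x" for x
  have [measurable]: "h \<in> borel_measurable borel"
    using borel_measurable_integrable[OF integrable_cnj_mult[OF square_integrable_rep square_integrable_rep, of f g]]
    by (simp add: h_def[abs_def])
  have "cinner (weyl z f) (weyl z g) =
      (\<integral>x. cnj (displacement z (rep_l2 f) x) * displacement z (rep_l2 g) x \<partial>lborel)"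
    unfolding weyl_rep[of z] by (intro cinner_abs_l2 square_integrable_displacement square_integrable_rep)
  also have "\<dots> = (\<integral>x. h (- sqrt 2 *\<^sub>R fst z + 1 *\<^sub>R x) \<partial>lborel)"
  proof (intro Bochner_Integration.integral_cong refl)
    fix x
    have "cnj (cis a * u) * (cis a * v) = cnj u * v" for a u v
      by (simp add: cis_cnj mult_ac cis_mult flip: mult.assoc)
    then show "cnj (displacement z (rep_l2 f) x) * displacement z (rep_l2 g) x =
        h (- sqrt 2 *\<^sub>R fst z + 1 *\<^sub>R x)"
      unfolding displacement_def h_def by simp
  qed
  also have "\<dots> = (\<integral>x. h x \<partial>lborel)"
    by (subst lborel_integral_affine(1)[where c = 1 and t = "- sqrt 2 *\<^sub>R fst z", of h]) auto
  finally show ?thesis by (simp add: cinner_l2_rep h_def)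
qed

lemma weyl_uminus_weyl [simp]: "weyl z (weyl (- z) f) = f" "weyl (- z) (weyl z f) = f"
  by (simp_all add: weyl_weyl)

lemma cinner_weyl_left: "cinner (weyl z f) g = cinner f (weyl (- z) g)"
  using cinner_weyl_weyl[of z f "weyl (- z) g"] by simp

lemma norm_weyl [simp]: "norm (weyl z f) = norm f"
  using cinner_weyl_weyl[of z f f] unfolding cinner_self by (simp only: of_real_eq_iff) simp

lemma cadjoint_weyl: "cadjoint (weyl z) = weyl (- z)"
  by (intro cadjoint_eqI bounded_clinearI[where K = 1] cinner_weyl_left)
    (simp_all add: weyl_add weyl_scaleC)

section \<open>The vacuum and its displacements\<close>

definition vacuum :: "'a::euclidean_space l2" where
  "vacuum = abs_l2 (\<lambda>x. of_real (sqrt (gauss x)))"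

definition coherent :: "'a \<times> 'a \<Rightarrow> 'a::euclidean_space l2" where
  "coherent z = weyl z vacuum"

lemma square_integrable_vacuum:
  "square_integrable (\<lambda>x::'a::euclidean_space. complex_of_real (sqrt (gauss x)))"
  by (simp add: square_integrable_def gauss_char)

text \<open>The two Gaussian factors multiply to a Gaussian centred at the midpoint
  \<open>p / \<surd>2\<close>, times \<open>exp (- (norm p)\<^sup>2 / 2)\<close>. Recentring cancels
  the phase \<open>p \<bullet> q\<close>, and the Fourier transform at \<open>\<surd>2 q\<close>
  supplies the factor in \<open>q\<close>. This is the case \<open>m = 0\<close> of the thermal
  formula.\<close>

lemma cinner_vacuum_weyl:
  fixes z :: "'a::euclidean_space \<times> 'a"
  shows "cinner vacuum (weyl z vacuum) = of_real (exp (- (norm z)\<^sup>2 / 2))"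
proof -
  obtain p q where z: "z = (p, q)" by (cases z)
  define E where "E = exp (- (norm p)\<^sup>2 / 2)"
  let ?h = "\<lambda>x. complex_of_real E * (of_real (gauss (x - (1 / sqrt 2) *\<^sub>R p)) * cis (sqrt 2 * (q \<bullet> x) - p \<bullet> q))"
  have prod: "sqrt (gauss x) * sqrt (gauss (x - sqrt 2 *\<^sub>R p)) = gauss (x - (1 / sqrt 2) *\<^sub>R p) * E" for x
  proof -
    define p' where "p' = (1 / sqrt 2) *\<^sub>R p"
    have p': "sqrt 2 *\<^sub>R p = 2 *\<^sub>R p'" "(norm p)\<^sup>2 = 2 * (norm p')\<^sup>2"
      by (simp_all add: p'_def power_divide real_div_sqrt)
    have "(norm x)\<^sup>2 + (norm (x - sqrt 2 *\<^sub>R p))\<^sup>2 = 2 * (norm (x - (1 / sqrt 2) *\<^sub>R p))\<^sup>2 + (norm p)\<^sup>2"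
      unfolding p' p'_def[symmetric] unfolding power2_norm_eq_inner
      by (simp add: inner_diff_left inner_diff_right inner_commute[of p' x])
    then have "exp (- (norm x)\<^sup>2) * exp (- (norm (x - sqrt 2 *\<^sub>R p))\<^sup>2) =
        exp (- (norm (x - (1 / sqrt 2) *\<^sub>R p))\<^sup>2 * 2 - (norm p)\<^sup>2)"
      by (simp flip: exp_add)
    also have "\<dots> = (exp (- (norm (x - (1 / sqrt 2) *\<^sub>R p))\<^sup>2) * E)\<^sup>2"
      by (simp add: E_def power2_eq_square flip: exp_add)
    finally have "gauss x * gauss (x - sqrt 2 *\<^sub>R p) = (gauss (x - (1 / sqrt 2) *\<^sub>R p) * E)\<^sup>2"
      by (simp add: gauss_def power_divide power2_eq_square)
    then show ?thesis by (simp add: E_def abs_mult flip: real_sqrt_mult)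
  qed
  have h: "cnj (complex_of_real (sqrt (gauss x))) * displacement z (\<lambda>x. of_real (sqrt (gauss x))) x = ?h x" for x
  proof -
    have "cnj (complex_of_real (sqrt (gauss x))) * displacement z (\<lambda>x. of_real (sqrt (gauss x))) x =
        of_real (sqrt (gauss x) * sqrt (gauss (x - sqrt 2 *\<^sub>R p))) * cis (sqrt 2 * (q \<bullet> x) - p \<bullet> q)"
      by (simp add: displacement_def z mult.left_commute)
    then show ?thesis unfolding prod by (simp add: mult.left_commute)
  qed
  have "cinner vacuum (weyl z vacuum) = (\<integral>x. ?h x \<partial>lborel)"
    unfolding vacuum_def weyl_abs_l2[OF square_integrable_vacuum]
    by (subst cinner_abs_l2[OF square_integrable_vacuum square_integrable_displacement[OF square_integrable_vacuum]])
      (rule Bochner_Integration.integral_cong[OF refl h])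
  also have "\<dots> = (\<integral>x. of_real E * (of_real (gauss x) * cis (sqrt 2 *\<^sub>R q \<bullet> x)) \<partial>lborel)"
  proof -
    have "sqrt 2 * (q \<bullet> ((1 / sqrt 2) *\<^sub>R p + 1 *\<^sub>R x)) - p \<bullet> q = sqrt 2 *\<^sub>R q \<bullet> x" for x
      by (simp add: inner_add_right inner_commute distrib_left)
    then show ?thesis
      by (subst lborel_integral_affine(1)[where c = 1 and t = "(1 / sqrt 2) *\<^sub>R p"])
        (simp_all add: cis_conv_exp)
  qed
  also have "\<dots> = of_real (E * exp (- (norm q)\<^sup>2 / 2))"
    using gauss_char(2)[of "sqrt 2 *\<^sub>R q"] by (simp add: power_mult_distrib)
  also have "E * exp (- (norm q)\<^sup>2 / 2) = exp (- (norm z)\<^sup>2 / 2)"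
    by (simp add: E_def z norm_prod_def add_divide_distrib flip: exp_add)
  finally show ?thesis .
qed

lemma norm_coherent [simp]: "norm (coherent z) = 1"
proof -
  have "complex_of_real ((norm (vacuum :: 'a l2))\<^sup>2) = of_real 1"
    using cinner_vacuum_weyl[of "0 :: 'a \<times> 'a"] by (simp add: cinner_self)
  then have "(norm (vacuum :: 'a l2))\<^sup>2 = 1\<^sup>2" by (simp only: of_real_eq_iff one_power2)
  then have "norm (vacuum :: 'a l2) = 1" by (rule power2_eq_imp_eq) simp_all
  then show ?thesis by (simp add: coherent_def)
qed

lemma cinner_coherent:
  "cinner (coherent z) (coherent w) =
    cis (fst z \<bullet> snd w - fst w \<bullet> snd z) * of_real (exp (- (norm (w - z))\<^sup>2 / 2))"
  unfolding coherent_def cinner_weyl_left weyl_weyl cinner_scaleC_right cinner_vacuum_weyl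
  by (simp add: norm_minus_commute)

text \<open>Conjugating \<open>weyl (- z)\<close> by a displacement multiplies it by a phase, twice
  the symplectic form. Thus a coherent state has the characteristic function of the vacuum times a
  character in its label, and a Gaussian average over labels yields a Gaussian.\<close>

lemma cinner_coherent_weyl:
  "cinner (coherent w) (weyl (- z) (coherent w)) =
    cis (2 * (fst z \<bullet> snd w - fst w \<bullet> snd z)) * of_real (exp (- (norm z)\<^sup>2 / 2))"
proof -
  have "weyl (- w) (weyl (- z) (weyl w f)) = cis (2 * (fst z \<bullet> snd w - fst w \<bullet> snd z)) *\<^sub>C weyl (- z) f" for f
    by (simp add: weyl_weyl weyl_scaleC scaleC_scaleC cis_mult algebra_simps)
  then show ?thesis
    unfolding coherent_def cinner_weyl_left by (simp add: cinner_scaleC_right cinner_vacuum_weyl)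
qed

lemma norm_coherent_diff:
  "(norm (coherent z - coherent w))\<^sup>2 =
    2 - 2 * (cos (fst z \<bullet> snd w - fst w \<bullet> snd z) * exp (- (norm (w - z))\<^sup>2 / 2))"
  by (simp add: norm_diff_square cinner_coherent)

lemma continuous_on_coherent: "continuous_on UNIV (coherent :: 'a \<times> 'a \<Rightarrow> 'a::euclidean_space l2)"
proof (rule continuous_at_imp_continuous_on, rule ballI)
  fix z :: "'a \<times> 'a"
  have "((\<lambda>w. (norm (coherent w - coherent z))\<^sup>2) \<longlongrightarrow>
      2 - 2 * (cos (fst z \<bullet> snd z - fst z \<bullet> snd z) * exp (- (norm (z - z))\<^sup>2 / 2))) (at z)"
    unfolding norm_coherent_diff by (intro tendsto_intros) auto
  then have "((\<lambda>w. sqrt ((norm (coherent w - coherent z))\<^sup>2)) \<longlongrightarrow> sqrt 0) (at z)"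
    by (intro tendsto_real_sqrt) simp
  then have "((\<lambda>w. norm (coherent w - coherent z)) \<longlongrightarrow> 0) (at z)" by simp
  then show "isCont coherent z"
    unfolding isCont_def by (rule LIM_zero_cancel[OF tendsto_norm_zero_cancel])
qed

lemma continuous_on_cinner_coherent:
  assumes "continuous_on S f"
  shows "continuous_on S (\<lambda>w. cinner x (coherent (f w)))"
  by (rule continuous_on_compose2[OF linear_continuous_on[OF bounded_linear_cinner, of UNIV]
        continuous_on_compose2[OF continuous_on_coherent assms]]) auto

text \<open>Momentum displacements multiply the vacuum by characters, so orthogonality to them says
  that \<open>h\<close> has vanishing Fourier transform; the Gaussian factor in \<open>h\<close> has
  no zeros.\<close>

lemma coherent_total:
  fixes f :: "'a::euclidean_space l2"
  assumes "\<And>w. cinner (coherent w) f = 0"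
  shows "f = 0"
proof -
  define h where "h x = complex_of_real (sqrt (gauss x)) * rep_l2 f x" for x
  have h: "integrable lborel h"
    using integrable_cnj_mult[OF square_integrable_vacuum square_integrable_rep, of f]
    by (simp add: h_def[abs_def])
  have zero: "(\<integral>x. h x * cis (q \<bullet> x) \<partial>lborel) = 0" for q
  proof -
    \<comment> \<open>The label \<open>- q / \<surd>2\<close> undoes the factor
      \<open>\<surd>2\<close> in \<open>displacement\<close> and the conjugation in the inner
      product.\<close>
    have "coherent (0, (- 1 / sqrt 2) *\<^sub>R q) = abs_l2 (displacement (0, (- 1 / sqrt 2) *\<^sub>R q) (\<lambda>x. of_real (sqrt (gauss x))))"
      unfolding coherent_def vacuum_def by (rule weyl_abs_l2[OF square_integrable_vacuum])
    then have "cinner (coherent (0, (- 1 / sqrt 2) *\<^sub>R q)) (abs_l2 (rep_l2 f)) =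
        (\<integral>x. cnj (displacement (0, (- 1 / sqrt 2) *\<^sub>R q) (\<lambda>x. of_real (sqrt (gauss x))) x) * rep_l2 f x \<partial>lborel)"
      by (simp only:) (intro cinner_abs_l2 square_integrable_displacement square_integrable_vacuum square_integrable_rep)
    also have "\<dots> = (\<integral>x. h x * cis (q \<bullet> x) \<partial>lborel)"
      by (intro Bochner_Integration.integral_cong refl) (simp add: displacement_def h_def cis_cnj mult_ac)
    finally show ?thesis using assms by simp
  qed
  have "AE x in lborel. h x = 0"
    by (rule fourier_unique[OF h]) (simp_all add: zero)
  then have "AE x in lborel. rep_l2 f x = 0"
    by eventually_elim (use gauss_pos in \<open>auto simp: h_def less_le\<close>)
  then have "cinner f f = (\<integral>x. 0 \<partial>(lborel :: 'a measure))"
    unfolding cinner_l2_rep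
    by (intro integral_cong_AE borel_measurable_integrable[OF integrable_cnj_mult] square_integrable_rep) auto
  then show ?thesis by (simp add: cinner_self)
qed

text \<open>By Parseval each coherent vector is orthogonal to all but countably many basis elements.
  An element orthogonal to the coherent vectors over a countable dense set of labels is, by
  continuity, orthogonal to all of them, hence zero.\<close>

lemma countable_onb_l2:
  fixes E :: "'a::euclidean_space l2 set"
  assumes E: "is_onb E"
  shows "countable E"
proof -
  obtain D :: "('a \<times> 'a) set" where D: "countable D"
    and dense: "\<And>X. open X \<Longrightarrow> X \<noteq> {} \<Longrightarrow> \<exists>d\<in>D. d \<in> X"
    using countable_dense_setE by metis
  have clD: "closure D = UNIV"
    using dense[of "- closure D"] closure_subset[of D] by (auto simp: open_Compl)
  have "countable {e \<in> E. cinner e (coherent d) \<noteq> 0}" for d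
  proof -
    have "(\<lambda>e. (cmod (cinner e (coherent d)))\<^sup>2) summable_on E"
      using onb_parseval_norm[OF E] summable_on_def by blast
    from summable_countable_real[OF this] show ?thesis by simp
  qed
  then have "countable (\<Union>d\<in>D. {e \<in> E. cinner e (coherent d) \<noteq> 0})" using D by blast
  moreover have "E \<subseteq> (\<Union>d\<in>D. {e \<in> E. cinner e (coherent d) \<noteq> 0})"
  proof (rule ccontr)
    assume "\<not> ?thesis"
    then obtain e where e: "e \<in> E" "D \<subseteq> {w. cinner e (coherent w) = 0}" by auto
    have "closed {w. cinner e (coherent w) = 0}"
      by (intro closed_Collect_eq continuous_on_cinner_coherent continuous_on_const continuous_on_id)
    from closure_minimal[OF e(2) this] have "cinner e (coherent w) = 0" for w
      unfolding clD by blast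
    then have "cinner (coherent w) e = 0" for w
      by (subst cinner_commute) simp
    then have "e = 0" by (rule coherent_total)
    then show False using onb_orth[OF E e(1) e(1)] by simp
  qed
  ultimately show ?thesis by (rule countable_subset[rotated])
qed

section \<open>Injectivity of the Fourier--Weyl transform on trace class operators\<close>

text \<open>Cauchy-Schwarz for the moduli of \<open>f\<close> and \<open>g\<close>, whose classes
  have the same norms.\<close>

lemma integral_norm_cnj_mult_le:
  assumes f: "square_integrable f" and g: "square_integrable g"
  shows "(\<integral>x. norm (cnj (f x) * g x) \<partial>lborel) \<le> norm (abs_l2 f) * norm (abs_l2 g)"
proof -
  have sq: "square_integrable (\<lambda>x. complex_of_real (norm (h x)))"
    and norm: "norm (abs_l2 (\<lambda>x. complex_of_real (norm (h x)))) = norm (abs_l2 h)"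
    if h: "square_integrable h" for h :: "'a \<Rightarrow> complex"
  proof -
    show sq: "square_integrable (\<lambda>x. complex_of_real (norm (h x)))"
      using h by (auto simp: square_integrable_def)
    show "norm (abs_l2 (\<lambda>x. complex_of_real (norm (h x)))) = norm (abs_l2 h)"
      using norm_abs_l2[OF sq] norm_abs_l2[OF h] by simp
  qed
  have "complex_of_real (\<integral>x. norm (cnj (f x) * g x) \<partial>lborel) =
      cinner (abs_l2 (\<lambda>x. complex_of_real (norm (f x)))) (abs_l2 (\<lambda>x. complex_of_real (norm (g x))))"
    by (subst cinner_abs_l2[OF sq[OF f] sq[OF g]])
      (simp add: norm_mult flip: integral_complex_of_real)
  then have "\<bar>\<integral>x. norm (cnj (f x) * g x) \<partial>lborel\<bar> \<le> norm (abs_l2 f) * norm (abs_l2 g)"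
    using norm_cinner_le norm[OF f] norm[OF g] by (metis norm_of_real)
  then show ?thesis by linarith
qed

lemma summable_mult_of_squares:
  fixes a b :: "nat \<Rightarrow> real"
  assumes "summable (\<lambda>k. (a k)\<^sup>2)" "summable (\<lambda>k. (b k)\<^sup>2)"
  shows "summable (\<lambda>k. a k * b k)"
proof (rule summable_comparison_test'[of "\<lambda>k. (a k)\<^sup>2 + (b k)\<^sup>2" 0])
  fix k
  show "norm (a k * b k) \<le> (a k)\<^sup>2 + (b k)\<^sup>2"
  proof -
    have "0 \<le> \<bar>a k\<bar> * \<bar>b k\<bar>" by simp
    then show ?thesis
      using sum_squares_bound[of "\<bar>a k\<bar>" "\<bar>b k\<bar>"] by (simp only: real_norm_def abs_mult power2_abs)
  qed
qed (use assms in \<open>rule summable_add\<close>)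

lemma AE_summable_norm:
  fixes f :: "nat \<Rightarrow> 'w \<Rightarrow> 'b::{banach, second_countable_topology}"
  assumes f: "\<And>k. integrable M (f k)" and s: "summable (\<lambda>k. \<integral>x. norm (f k x) \<partial>M)"
  shows "AE x in M. summable (\<lambda>k. norm (f k x))"
proof -
  have [measurable]: "f k \<in> borel_measurable M" for k using f by auto
  have "(\<integral>\<^sup>+x. (\<Sum>k. ennreal (norm (f k x))) \<partial>M) = (\<Sum>k. \<integral>\<^sup>+x. ennreal (norm (f k x)) \<partial>M)"
    by (rule nn_integral_suminf) measurable
  also have "\<dots> = (\<Sum>k. ennreal (\<integral>x. norm (f k x) \<partial>M))"
    using f by (intro arg_cong[where f = suminf] ext nn_integral_eq_integral) auto
  also have "\<dots> \<noteq> \<infinity>" using s by (simp add: ennreal_suminf_neq_top)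
  finally have "AE x in M. (\<Sum>k. ennreal (norm (f k x))) \<noteq> \<infinity>"
    by (intro nn_integral_PInf_AE) auto
  then show ?thesis by eventually_elim (auto intro: summable_suminf_not_top)
qed

text \<open>For \<open>A = \<Sum>\<^sub>k |u\<^sub>k\<rangle>\<langle>v\<^sub>k|\<close> with integral kernel \<open>K\<close>, this is \<open>x \<mapsto> K (x + \<surd>2 p, x)\<close>;
  its Fourier transform is the characteristic function of \<open>A\<close> at \<open>(p, \<cdot>)\<close> up to a phase.\<close>

definition shifted_kernel ::
  "(nat \<Rightarrow> 'a::euclidean_space l2) \<Rightarrow> (nat \<Rightarrow> 'a l2) \<Rightarrow> 'a \<Rightarrow> 'a \<Rightarrow> complex" where
  "shifted_kernel u v p x = (\<Sum>k. cnj (rep_l2 (v k) x) * rep_l2 (u k) (x + sqrt 2 *\<^sub>R p))"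

lemma borel_measurable_cnj [measurable]:
  "f \<in> borel_measurable M \<Longrightarrow> (\<lambda>x. cnj (f x)) \<in> borel_measurable M"
  by (rule borel_measurable_continuous_on[OF continuous_on_cnj[OF continuous_on_id]])

lemma shifted_kernel_measurable [measurable]:
  "(\<lambda>(p, x). shifted_kernel u v p x) \<in> borel_measurable (borel \<Otimes>\<^sub>M borel)"
  unfolding shifted_kernel_def by measurable

context
  fixes u v :: "nat \<Rightarrow> 'a::euclidean_space l2"
  assumes u: "summable (\<lambda>k. (norm (u k))\<^sup>2)" and v: "summable (\<lambda>k. (norm (v k))\<^sup>2)"
begin

lemma summable_norm_uv: "summable (\<lambda>k. norm (v k) * norm (u k))"
  by (rule summable_mult_of_squares[OF v u])

text \<open>Translation by \<open>\<surd>2 p\<close> is the displacement \<open>(- p, 0)\<close>, an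
  isometry. Hence the k-th term has integral norm at most \<open>norm (v k) * norm (u k)\<close> for
  every \<open>p\<close>, and everything follows by summability of these products.\<close>

lemma
  fixes p :: 'a
  defines "g k x \<equiv> cnj (rep_l2 (v k) x) * rep_l2 (u k) (x + sqrt 2 *\<^sub>R p)"
  shows integrable_kernel_term: "integrable lborel (g k)"
    and summable_kernel_term: "summable (\<lambda>k. \<integral>x. norm (g k x) \<partial>lborel)"
    and AE_summable_kernel_term: "AE x in lborel. summable (\<lambda>k. norm (g k x))"
    and integrable_shifted_kernel: "integrable lborel (shifted_kernel u v p)"
proof -
  have shift: "(\<lambda>x. f (x + sqrt 2 *\<^sub>R p)) = displacement (- p, 0) f" for f
    by (simp add: displacement_def[abs_def])
  have sq: "square_integrable (\<lambda>x. rep_l2 (u k) (x + sqrt 2 *\<^sub>R p))" for k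
    unfolding shift by (intro square_integrable_displacement square_integrable_rep)
  have n: "norm (abs_l2 (\<lambda>x. rep_l2 (u k) (x + sqrt 2 *\<^sub>R p))) = norm (u k)" for k
    unfolding shift weyl_rep[symmetric] by simp
  show int: "integrable lborel (g k)" for k
    unfolding g_def by (intro integrable_cnj_mult square_integrable_rep sq)
  have "(\<integral>x. norm (g k x) \<partial>lborel) \<le> norm (v k) * norm (u k)" for k
    using integral_norm_cnj_mult_le[OF square_integrable_rep sq, of "v k" k] by (simp add: g_def n)
  then show s: "summable (\<lambda>k. \<integral>x. norm (g k x) \<partial>lborel)"
    by (intro summable_comparison_test'[OF summable_norm_uv, of 0]) (simp add: integral_nonneg_AE)
  show ae: "AE x in lborel. summable (\<lambda>k. norm (g k x))"
    by (rule AE_summable_norm[OF int s])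
  show "integrable lborel (shifted_kernel u v p)"
    using integrable_suminf[OF int ae s] by (simp add: shifted_kernel_def[abs_def] g_def)
qed

lemma shifted_kernel_fourier:
  "(\<lambda>k. cinner (v k) (weyl (- (p, q)) (u k))) sums
    (cis (- (p \<bullet> q)) * (\<integral>x. shifted_kernel u v p x * cis (- (sqrt 2 *\<^sub>R q) \<bullet> x) \<partial>lborel))"
proof -
  define g where "g k x = cnj (rep_l2 (v k) x) * rep_l2 (u k) (x + sqrt 2 *\<^sub>R p)" for k x
  note g = integrable_kernel_term[of _ p, folded g_def] summable_kernel_term[of p, folded g_def]
    AE_summable_kernel_term[of p, folded g_def]
  let ?c = "\<lambda>x. cis (- (sqrt 2 *\<^sub>R q) \<bullet> x)"
  have cmeas: "?c \<in> borel_measurable borel" unfolding cis_conv_exp by measurable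
  have gc: "integrable lborel (\<lambda>x. g k x * ?c x)" for k
    by (rule Bochner_Integration.integrable_bound[OF g(1)[of k]])
      (use g(1)[of k] cmeas in \<open>auto simp: norm_mult intro!: borel_measurable_times\<close>)
  \<comment> \<open>The character has modulus one, so the absolute summability of the
    \<open>g k\<close> justifies the exchange.\<close>
  have "(\<lambda>k. \<integral>x. g k x * ?c x \<partial>lborel) sums (\<integral>x. (\<Sum>k. g k x * ?c x) \<partial>lborel)"
    by (rule sums_integral[OF gc]) (use g in \<open>simp_all add: norm_mult\<close>)
  also have "(\<integral>x. (\<Sum>k. g k x * ?c x) \<partial>lborel) = (\<integral>x. shifted_kernel u v p x * ?c x \<partial>lborel)"
  proof (rule integral_cong_AE)
    show "AE x in lborel. (\<Sum>k. g k x * ?c x) = shifted_kernel u v p x * ?c x"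
      using g(3)
    proof eventually_elim
      case (elim x)
      from suminf_mult2[OF summable_norm_cancel[OF elim], of "?c x"]
      show ?case by (simp add: shifted_kernel_def g_def)
    qed
    have [measurable]: "g k \<in> borel_measurable borel" for k using g(1)[of k] by auto
    show "(\<lambda>x. \<Sum>k. g k x * ?c x) \<in> borel_measurable lborel" using cmeas by measurable
    show "(\<lambda>x. shifted_kernel u v p x * ?c x) \<in> borel_measurable lborel"
      using cmeas by measurable
  qed
  finally have s: "(\<lambda>k. \<integral>x. g k x * ?c x \<partial>lborel) sums (\<integral>x. shifted_kernel u v p x * ?c x \<partial>lborel)" .
  have "cinner (v k) (weyl (- (p, q)) (u k)) = cis (- (p \<bullet> q)) * (\<integral>x. g k x * ?c x \<partial>lborel)" for k
  proof -
    have "cinner (abs_l2 (rep_l2 (v k))) (weyl (- (p, q)) (u k)) =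
        (\<integral>x. cnj (rep_l2 (v k) x) * displacement (- (p, q)) (rep_l2 (u k)) x \<partial>lborel)"
      unfolding weyl_rep by (intro cinner_abs_l2 square_integrable_displacement square_integrable_rep)
    also have "\<dots> = (\<integral>x. cis (- (p \<bullet> q)) * (g k x * ?c x) \<partial>lborel)"
    proof (intro Bochner_Integration.integral_cong refl)
      fix x
      have "displacement (- (p, q)) (rep_l2 (u k)) x =
          cis (- (p \<bullet> q)) * ?c x * rep_l2 (u k) (x + sqrt 2 *\<^sub>R p)"
        by (simp add: displacement_def cis_mult add.commute
            minus_diff_commute[of "sqrt 2 * (q \<bullet> x)" "p \<bullet> q"])
      then show "cnj (rep_l2 (v k) x) * displacement (- (p, q)) (rep_l2 (u k)) x =
          cis (- (p \<bullet> q)) * (g k x * ?c x)"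
        by (simp add: g_def)
    qed
    finally show ?thesis by simp
  qed
  then show ?thesis using sums_mult[OF s, of "cis (- (p \<bullet> q))"] by simp
qed

text \<open>The matrix element is the double integral of \<open>cnj (f y) K(y, x) g x\<close>;
  substituting \<open>y = x + \<surd>2 p\<close> gives the Jacobian. The variable \<open>p\<close>
  is integrated last because Fourier uniqueness identifies the kernels for each fixed
  \<open>p\<close>, almost everywhere in \<open>x\<close>.\<close>

lemma shifted_kernel_matrix_element:
  assumes A: "\<And>x. (\<lambda>k. cinner (v k) x *\<^sub>C u k) sums A x"
  shows "cinner f (A g) = of_real (sqrt 2 ^ DIM('a)) *
    (\<integral>p. (\<integral>x. cnj (rep_l2 f (x + sqrt 2 *\<^sub>R p)) * rep_l2 g x * shifted_kernel u v p x \<partial>lborel) \<partial>lborel)"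
proof -
  define C where "C = sqrt 2 ^ DIM('a)"
  have C: "C > 0" by (simp add: C_def)
  define a where "a k x = cnj (rep_l2 (v k) x) * rep_l2 g x" for k x
  define b where "b k x = cnj (rep_l2 f x) * rep_l2 (u k) x" for k x
  have [measurable]: "a k \<in> borel_measurable borel" "b k \<in> borel_measurable borel" for k
    unfolding a_def[abs_def] b_def[abs_def] by measurable
  have a: "integrable lborel (a k)" and b: "integrable lborel (b k)" for k
    unfolding a_def[abs_def] b_def[abs_def] by (intro integrable_cnj_mult square_integrable_rep)+
  have an: "(\<integral>x. norm (a k x) \<partial>lborel) \<le> norm (v k) * norm g" for k
    using integral_norm_cnj_mult_le[OF square_integrable_rep square_integrable_rep, of "v k" g]
    by (simp add: a_def)
  have bn: "(\<integral>x. norm (b k x) \<partial>lborel) \<le> norm f * norm (u k)" for k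
    using integral_norm_cnj_mult_le[OF square_integrable_rep square_integrable_rep, of f "u k"]
    by (simp add: b_def)
  have aff: "(\<integral>p. h (x + sqrt 2 *\<^sub>R p) \<partial>lborel) = (1 / C) *\<^sub>R (\<integral>p. h p \<partial>lborel)"
    if "h \<in> borel_measurable borel" for h :: "'a \<Rightarrow> 'b::{banach, second_countable_topology}" and x
    using lborel_integral_affine(1)[of "sqrt 2" h x] that C by (simp add: C_def)
  \<comment> \<open>In these variables a rank one term is a product whose double integral factors
    into \<open>\<langle>v\<^sub>k, g\<rangle> \<langle>f, u\<^sub>k\<rangle> / C\<close>.\<close>
  define F where "F k x p = a k x * b k (x + sqrt 2 *\<^sub>R p)" for k x p
  have nF: "(\<integral>p. norm (F k x p) \<partial>lborel) = norm (a k x) * ((\<integral>p. norm (b k p) \<partial>lborel) / C)" for k x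
    using aff[of "\<lambda>p. norm (b k p)" x] by (simp add: F_def norm_mult)
  have F_int: "integrable (lborel \<Otimes>\<^sub>M lborel) (case_prod (F k))" for k
  proof (rule lborel_pair.Fubini_integrable)
    show "case_prod (F k) \<in> borel_measurable (lborel \<Otimes>\<^sub>M lborel)"
      unfolding F_def case_prod_beta' by measurable
    show "integrable lborel (\<lambda>x. \<integral>p. norm (case_prod (F k) (x, p)) \<partial>lborel)"
      using a[of k] by (simp add: nF)
    have "integrable lborel (\<lambda>p. b k (x + sqrt 2 *\<^sub>R p))" for x
      using b[of k] by (subst lborel_integral_affine(2)[symmetric]) auto
    then show "AE x in lborel. integrable lborel (\<lambda>p. case_prod (F k) (x, p))"
      by (simp add: F_def)
  qed
  have "(\<integral>z. norm (case_prod (F k) z) \<partial>(lborel \<Otimes>\<^sub>M lborel)) =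
      (\<integral>x. norm (a k x) \<partial>lborel) * ((\<integral>p. norm (b k p) \<partial>lborel) / C)" for k
    using lborel_pair.integral_fst'[OF integrable_norm[OF F_int[of k]]] by (simp add: nF)
  moreover have "(\<integral>x. norm (a k x) \<partial>lborel) * ((\<integral>p. norm (b k p) \<partial>lborel) / C) \<le>
      (norm g * norm f / C) * (norm (v k) * norm (u k))" for k
  proof -
    have "(\<integral>x. norm (a k x) \<partial>lborel) * ((\<integral>p. norm (b k p) \<partial>lborel) / C) \<le>
        (norm (v k) * norm g) * ((norm f * norm (u k)) / C)"
      using C by (intro mult_mono divide_right_mono an bn) (auto simp: integral_nonneg_AE)
    then show ?thesis by (simp add: mult_ac)
  qed
  ultimately have le: "(\<integral>z. norm (case_prod (F k) z) \<partial>(lborel \<Otimes>\<^sub>M lborel)) \<le>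
      (norm g * norm f / C) * (norm (v k) * norm (u k))" for k
    by simp
  have s: "summable (\<lambda>k. \<integral>z. norm (case_prod (F k) z) \<partial>(lborel \<Otimes>\<^sub>M lborel))"
  proof (rule summable_comparison_test'[OF summable_mult[OF summable_norm_uv, of "norm g * norm f / C"], of 0])
    show "norm (\<integral>z. norm (case_prod (F k) z) \<partial>(lborel \<Otimes>\<^sub>M lborel)) \<le>
        (norm g * norm f / C) * (norm (v k) * norm (u k))" for k
      unfolding real_norm_def using le[of k] by (subst abs_of_nonneg) (auto intro: integral_nonneg_AE)
  qed
  note ae = AE_summable_norm[OF F_int s]
  have G_int: "integrable (lborel \<Otimes>\<^sub>M lborel) (\<lambda>(x, p). \<Sum>k. F k x p)"
    using integrable_suminf[OF F_int ae s] by (simp add: case_prod_beta')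
  have "(\<lambda>k. \<integral>z. case_prod (F k) z \<partial>(lborel \<Otimes>\<^sub>M lborel)) sums
      (\<integral>z. (\<Sum>k. case_prod (F k) z) \<partial>(lborel \<Otimes>\<^sub>M lborel))"
    by (rule sums_integral[OF F_int ae s])
  moreover have "(\<integral>z. case_prod (F k) z \<partial>(lborel \<Otimes>\<^sub>M lborel)) = cinner (v k) g * cinner f (u k) / of_real C" for k
  proof -
    have "(\<integral>z. case_prod (F k) z \<partial>(lborel \<Otimes>\<^sub>M lborel)) = (\<integral>x. (\<integral>p. F k x p \<partial>lborel) \<partial>lborel)"
      using lborel_pair.integral_fst'[OF F_int[of k]] by simp
    also have "\<dots> = (\<integral>x. a k x \<partial>lborel) * ((\<integral>p. b k p \<partial>lborel) / of_real C)"
      using aff[of "b k"] by (simp add: F_def scaleR_conv_of_real)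
    finally show ?thesis by (simp add: cinner_l2_rep a_def b_def)
  qed
  moreover have "(\<integral>z. (\<Sum>k. case_prod (F k) z) \<partial>(lborel \<Otimes>\<^sub>M lborel)) =
      (\<integral>p. (\<integral>x. cnj (rep_l2 f (x + sqrt 2 *\<^sub>R p)) * rep_l2 g x * shifted_kernel u v p x \<partial>lborel) \<partial>lborel)"
  proof -
    have "(\<integral>x. (\<Sum>k. F k x p) \<partial>lborel) =
        (\<integral>x. cnj (rep_l2 f (x + sqrt 2 *\<^sub>R p)) * rep_l2 g x * shifted_kernel u v p x \<partial>lborel)" for p
    proof (rule integral_cong_AE)
      show "(\<lambda>x. \<Sum>k. F k x p) \<in> borel_measurable lborel" unfolding F_def by measurable
      show "(\<lambda>x. cnj (rep_l2 f (x + sqrt 2 *\<^sub>R p)) * rep_l2 g x * shifted_kernel u v p x) \<in> borel_measurable lborel"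
        by measurable
      show "AE x in lborel. (\<Sum>k. F k x p) =
          cnj (rep_l2 f (x + sqrt 2 *\<^sub>R p)) * rep_l2 g x * shifted_kernel u v p x"
        using AE_summable_kernel_term[of p]
      proof eventually_elim
        case (elim x)
        from suminf_mult[OF summable_norm_cancel[OF elim], of "cnj (rep_l2 f (x + sqrt 2 *\<^sub>R p)) * rep_l2 g x"]
        show ?case by (simp add: shifted_kernel_def F_def a_def b_def mult_ac)
      qed
    qed
    then show ?thesis
      using lborel_pair.integral_snd[OF G_int] by (simp add: case_prod_beta')
  qed
  ultimately have "(\<lambda>k. cinner (v k) g * cinner f (u k) / of_real C) sums
      (\<integral>p. (\<integral>x. cnj (rep_l2 f (x + sqrt 2 *\<^sub>R p)) * rep_l2 g x * shifted_kernel u v p x \<partial>lborel) \<partial>lborel)"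
    by simp
  from sums_mult[OF this, of "of_real C"]
  have "(\<lambda>k. cinner (v k) g * cinner f (u k)) sums (of_real C *
      (\<integral>p. (\<integral>x. cnj (rep_l2 f (x + sqrt 2 *\<^sub>R p)) * rep_l2 g x * shifted_kernel u v p x \<partial>lborel) \<partial>lborel))"
    using C by simp
  moreover have "(\<lambda>k. cinner (v k) g * cinner f (u k)) sums cinner f (A g)"
    using bounded_linear.sums[OF bounded_linear_cinner A[of g], of f] by (simp add: cinner_scaleC_right)
  ultimately show ?thesis unfolding C_def by (rule sums_unique2[symmetric])
qed

end

theorem char_fun_inject:
  fixes A B :: "'a::euclidean_space l2 \<Rightarrow> 'a l2"
  assumes "trace_class A" "trace_class B" and eq: "\<And>z. char_fun A z = char_fun B z"
  shows "A = B"
proof -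
  obtain u v where uv: "summable (\<lambda>k. (norm (u k))\<^sup>2)" "summable (\<lambda>k. (norm (v k))\<^sup>2)"
    and A: "\<And>x. (\<lambda>k. cinner (v k) x *\<^sub>C u k) sums A x"
    using trace_class_rank_one_sum[OF assms(1)] by blast
  obtain u' v' where uv': "summable (\<lambda>k. (norm (u' k))\<^sup>2)" "summable (\<lambda>k. (norm (v' k))\<^sup>2)"
    and B: "\<And>x. (\<lambda>k. cinner (v' k) x *\<^sub>C u' k) sums B x"
    using trace_class_rank_one_sum[OF assms(2)] by blast
  have char: "char_fun T (p, q) =
      cis (- (p \<bullet> q)) * (\<integral>x. shifted_kernel s t p x * cis (- (sqrt 2 *\<^sub>R q) \<bullet> x) \<partial>lborel)"
    if st: "summable (\<lambda>k. (norm (s k))\<^sup>2)" "summable (\<lambda>k. (norm (t k))\<^sup>2)"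
      and T: "\<And>x. (\<lambda>k. cinner (t k) x *\<^sub>C s k) sums T x" for s t T and p q :: 'a
    unfolding char_fun_def cadjoint_weyl
    by (rule sums_unique2[OF op_trace_rank_one_sum[OF st T, where W' = "weyl (p, q)"] shifted_kernel_fourier[OF st]])
      (simp_all add: cinner_weyl_left)
  have ae: "AE x in lborel. shifted_kernel u v p x = shifted_kernel u' v' p x" for p
  proof (rule fourier_unique)
    show "integrable lborel (shifted_kernel u v p)" "integrable lborel (shifted_kernel u' v' p)"
      by (rule integrable_shifted_kernel[OF uv] integrable_shifted_kernel[OF uv'])+
    fix q
    show "(\<integral>x. shifted_kernel u v p x * cis (q \<bullet> x) \<partial>lborel) = (\<integral>x. shifted_kernel u' v' p x * cis (q \<bullet> x) \<partial>lborel)"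
      \<comment> \<open>The label \<open>- q / \<surd>2\<close> undoes the scaling of the frequency
        in \<open>char\<close>; the phases agree on both sides and cancel, being nonzero.\<close>
      using eq[of "(p, (- 1 / sqrt 2) *\<^sub>R q)"] unfolding char[OF uv A] char[OF uv' B]
      by simp
  qed
  have "(\<integral>x. cnj (rep_l2 f (x + sqrt 2 *\<^sub>R p)) * rep_l2 g x * shifted_kernel u v p x \<partial>lborel) =
      (\<integral>x. cnj (rep_l2 f (x + sqrt 2 *\<^sub>R p)) * rep_l2 g x * shifted_kernel u' v' p x \<partial>lborel)"
    for f g :: "'a l2" and p
  proof (rule integral_cong_AE)
    show "AE x in lborel. cnj (rep_l2 f (x + sqrt 2 *\<^sub>R p)) * rep_l2 g x * shifted_kernel u v p x =
        cnj (rep_l2 f (x + sqrt 2 *\<^sub>R p)) * rep_l2 g x * shifted_kernel u' v' p x"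
      using ae[of p] by eventually_elim simp
  qed measurable
  then have "cinner f (A g) = cinner f (B g)" for f g
    by (simp only: shifted_kernel_matrix_element[OF uv A] shifted_kernel_matrix_element[OF uv' B])
  then show ?thesis by (intro ext cinner_eqI)
qed

section \<open>Thermal states\<close>

definition gauss_measure :: "'a::euclidean_space measure" where
  "gauss_measure = density lborel (\<lambda>x. ennreal (gauss x))"

lemma prob_space_gauss_measure: "prob_space (gauss_measure :: 'a::euclidean_space measure)"
proof
  have "(\<integral>\<^sup>+x. ennreal (gauss (x :: 'a)) \<partial>lborel) = ennreal 1"
    by (subst nn_integral_eq_integral) (simp_all add: gauss_char integral_gauss)
  then show "emeasure (gauss_measure :: 'a measure) (space gauss_measure) = 1"
    by (simp add: gauss_measure_def emeasure_density)
qed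

lemma vector_mixture_coherent: "vector_mixture gauss_measure (\<lambda>\<omega>. coherent (r *\<^sub>R \<omega>))"
proof -
  interpret prob_space "gauss_measure :: ('a \<times> 'a) measure" by (rule prob_space_gauss_measure)
  show ?thesis
  proof
    fix x :: "'a l2"
    have "(\<lambda>\<omega>. cinner x (coherent (r *\<^sub>R \<omega>))) \<in> borel_measurable borel"
      by (intro borel_measurable_continuous_onI continuous_on_cinner_coherent continuous_intros)
    then show "(\<lambda>\<omega>. cinner x (coherent (r *\<^sub>R \<omega>))) \<in> borel_measurable gauss_measure"
      by (simp add: gauss_measure_def)
  qed simp
qed

text \<open>The Glauber--Sudarshan representation: a thermal state is a Gaussian mixture of coherent states.\<close>

definition gaussian_mixture :: "real \<Rightarrow> 'a::euclidean_space l2 \<Rightarrow> 'a l2" where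
  "gaussian_mixture m = mixture gauss_measure (\<lambda>\<omega>. coherent (sqrt m *\<^sub>R \<omega>))"

lemma char_fun_gaussian_mixture:
  fixes z :: "'a::euclidean_space \<times> 'a"
  assumes m: "0 \<le> m"
  shows "char_fun (gaussian_mixture m) z = of_real (exp (- (m + 1 / 2) * (norm z)\<^sup>2))"
proof -
  interpret vector_mixture "gauss_measure :: ('a \<times> 'a) measure" "\<lambda>\<omega>. coherent (sqrt m *\<^sub>R \<omega>)"
    by (rule vector_mixture_coherent)
  obtain p q where z: "z = (p, q)" by (cases z)
  \<comment> \<open>\<open>\<zeta> \<bullet> \<omega>\<close> is twice the symplectic form of
    \<open>z\<close> and \<open>\<surd>m \<omega>\<close>. Since
    \<open>(norm \<zeta>)\<^sup>2 = 4 m (norm z)\<^sup>2\<close>, averaging contributes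
    \<open>exp (- m (norm z)\<^sup>2)\<close>; the remaining \<open>1 / 2\<close> in the exponent is
    the vacuum overlap.\<close>
  define \<zeta> where "\<zeta> = (2 * sqrt m) *\<^sub>R (- q, p)"
  have "char_fun (gaussian_mixture m) z =
      (\<integral>\<omega>. cinner (coherent (sqrt m *\<^sub>R \<omega>)) (weyl (- z) (coherent (sqrt m *\<^sub>R \<omega>))) \<partial>gauss_measure)"
    unfolding char_fun_def cadjoint_weyl gaussian_mixture_def
    by (rule op_trace_mixture[OF countable_onb_l2[OF is_onb_some_onb], where W' = "weyl z"])
      (simp_all add: cinner_weyl_left)
  also have "\<dots> = (\<integral>\<omega>. cis (\<zeta> \<bullet> \<omega>) * of_real (exp (- (norm z)\<^sup>2 / 2)) \<partial>gauss_measure)"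
  proof (intro Bochner_Integration.integral_cong refl)
    fix \<omega> :: "'a \<times> 'a"
    have "2 * (fst z \<bullet> snd (sqrt m *\<^sub>R \<omega>) - fst (sqrt m *\<^sub>R \<omega>) \<bullet> snd z) = \<zeta> \<bullet> \<omega>"
      by (cases \<omega>) (simp add: z \<zeta>_def inner_commute algebra_simps)
    then show "cinner (coherent (sqrt m *\<^sub>R \<omega>)) (weyl (- z) (coherent (sqrt m *\<^sub>R \<omega>))) =
        cis (\<zeta> \<bullet> \<omega>) * of_real (exp (- (norm z)\<^sup>2 / 2))"
      unfolding cinner_coherent_weyl by simp
  qed
  also have "\<dots> = (\<integral>\<omega>. cis (\<zeta> \<bullet> \<omega>) \<partial>gauss_measure) * of_real (exp (- (norm z)\<^sup>2 / 2))"
    by simp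
  also have "(\<integral>\<omega>. cis (\<zeta> \<bullet> \<omega>) \<partial>gauss_measure) = of_real (exp (- (norm \<zeta>)\<^sup>2 / 4))"
  proof -
    have "(\<lambda>\<omega>. cis (\<zeta> \<bullet> \<omega>)) \<in> borel_measurable lborel" unfolding cis_conv_exp by measurable
    then show ?thesis
      unfolding gauss_measure_def gauss_char(2)[of \<zeta>, symmetric]
      by (subst integral_density) (simp_all add: scaleR_conv_of_real)
  qed
  also have "(norm \<zeta>)\<^sup>2 = 4 * m * (norm z)\<^sup>2"
    using m by (simp add: \<zeta>_def z power_mult_distrib norm_prod_def algebra_simps)
  also have "of_real (exp (- (4 * m * (norm z)\<^sup>2) / 4)) * of_real (exp (- (norm z)\<^sup>2 / 2)) =
      complex_of_real (exp (- (m + 1 / 2) * (norm z)\<^sup>2))"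
    by (simp add: algebra_simps flip: of_real_mult exp_add)
  finally show ?thesis .
qed

text \<open>The mixture supplies existence and \<open>char_fun_inject\<close> uniqueness for the
  definite description.\<close>

lemma thermal_state_eq: "0 \<le> m \<Longrightarrow> thermal_state m = gaussian_mixture m"
  unfolding thermal_state_def
  using vector_mixture.trace_class_mixture[OF vector_mixture_coherent[of "sqrt m"]]
  by (intro the_equality)
    (auto simp: char_fun_gaussian_mixture gaussian_mixture_def[symmetric] intro!: char_fun_inject)

section \<open>Continuity in the mean photon number, and compactness\<close>

lemma hilbert_schmidt_gaussian_mixture: "hilbert_schmidt (gaussian_mixture m)"
  unfolding gaussian_mixture_def
  by (rule vector_mixture.hilbert_schmidt_mixture[OF vector_mixture_coherent])

text \<open>\<open>sqrt\<close> is total and continuous on the reals, so every real \<open>m\<close>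
  is covered, the end point \<open>m = 0\<close> included. The set \<open>S\<close> adapts the limit
  to the subspace topology of an interval.\<close>

lemma gaussian_mixture_continuous:
  fixes S :: "real set"
  shows "((\<lambda>m'. hs_norm (\<lambda>x. gaussian_mixture m x - gaussian_mixture m' x :: 'a::euclidean_space l2)) \<longlongrightarrow> 0)
    (at m within S)"
proof -
  interpret prob_space "gauss_measure :: ('a \<times> 'a) measure" by (rule prob_space_gauss_measure)
  define d where "d m' \<omega> = (norm (coherent (sqrt m *\<^sub>R \<omega>) - coherent (sqrt m' *\<^sub>R \<omega>) :: 'a l2))\<^sup>2" for m' \<omega>
  have coh: "continuous_on UNIV (\<lambda>\<omega>. coherent (r *\<^sub>R \<omega>) :: 'a l2)" for r
    by (rule continuous_on_compose2[OF continuous_on_coherent]) (auto intro: continuous_intros)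
  have meas: "(\<lambda>\<omega>. norm (coherent (sqrt m *\<^sub>R \<omega>) - coherent (sqrt m' *\<^sub>R \<omega>) :: 'a l2)) \<in> borel_measurable gauss_measure" for m'
  proof -
    have "(\<lambda>\<omega>. norm (coherent (sqrt m *\<^sub>R \<omega>) - coherent (sqrt m' *\<^sub>R \<omega>) :: 'a l2)) \<in> borel_measurable borel"
      by (intro borel_measurable_continuous_onI continuous_on_norm continuous_on_diff coh)
    then show ?thesis by (simp add: gauss_measure_def)
  qed
  have "((\<lambda>m'. \<integral>\<omega>. d m' \<omega> \<partial>gauss_measure) \<longlongrightarrow> 0) (at m within S)"
    unfolding tendsto_at_iff_sequentially
  proof (intro allI impI)
    fix X :: "nat \<Rightarrow> real" assume X: "X \<longlonglongrightarrow> m"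
    have "(\<lambda>i. \<integral>\<omega>. d (X i) \<omega> \<partial>gauss_measure) \<longlonglongrightarrow> (\<integral>\<omega>. 0 \<partial>(gauss_measure :: ('a \<times> 'a) measure))"
    proof (rule integral_dominated_convergence[where w = "\<lambda>_. 4"])
      show "AE \<omega> in gauss_measure. (\<lambda>i. d (X i) \<omega>) \<longlonglongrightarrow> 0"
      proof (rule AE_I2)
        fix \<omega> :: "'a \<times> 'a"
        have "(\<lambda>i. sqrt (X i) *\<^sub>R \<omega>) \<longlonglongrightarrow> sqrt m *\<^sub>R \<omega>" by (intro tendsto_intros X)
        moreover have "isCont (coherent :: 'a \<times> 'a \<Rightarrow> 'a l2) (sqrt m *\<^sub>R \<omega>)"
          using continuous_on_coherent continuous_on_eq_continuous_at[OF open_UNIV] by blast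
        ultimately have "(\<lambda>i. coherent (sqrt (X i) *\<^sub>R \<omega>) :: 'a l2) \<longlonglongrightarrow> coherent (sqrt m *\<^sub>R \<omega>)"
          using isCont_tendsto_compose by blast
        then have "(\<lambda>i. d (X i) \<omega>) \<longlonglongrightarrow> (norm (coherent (sqrt m *\<^sub>R \<omega>) - coherent (sqrt m *\<^sub>R \<omega>) :: 'a l2))\<^sup>2"
          unfolding d_def by (intro tendsto_intros)
        then show "(\<lambda>i. d (X i) \<omega>) \<longlonglongrightarrow> 0" by simp
      qed
      \<comment> \<open>Unit vectors are at distance at most 2, so the constant 4 dominates, and it
        is integrable for a probability measure.\<close>
      have "d m' \<omega> \<le> 2\<^sup>2" for m' \<omega>
        unfolding d_def
        using norm_triangle_ineq4[of "coherent (sqrt m *\<^sub>R \<omega>) :: 'a l2" "coherent (sqrt m' *\<^sub>R \<omega>)"]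
        by (intro power_mono) auto
      then show "AE \<omega> in gauss_measure. norm (d (X i) \<omega>) \<le> 4" for i
        by (auto simp: d_def)
      show "d (X i) \<in> borel_measurable gauss_measure" for i
        unfolding d_def[abs_def] using meas by measurable
    qed simp_all
    then show "((\<lambda>m'. \<integral>\<omega>. d m' \<omega> \<partial>gauss_measure) \<circ> X) \<longlonglongrightarrow> 0" by (simp add: o_def)
  qed
  then have "((\<lambda>m'. sqrt (4 * (\<integral>\<omega>. d m' \<omega> \<partial>gauss_measure))) \<longlongrightarrow> sqrt (4 * 0)) (at m within S)"
    by (intro tendsto_intros)
  then have lim: "((\<lambda>m'. sqrt (4 * (\<integral>\<omega>. d m' \<omega> \<partial>gauss_measure))) \<longlongrightarrow> 0) (at m within S)" by simp
  show ?thesis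
  proof (rule tendsto_sandwich[OF _ _ tendsto_const lim])
    have "(hs_norm (\<lambda>x. gaussian_mixture m x - gaussian_mixture m' x :: 'a l2))\<^sup>2 \<le>
        4 * (\<integral>\<omega>. d m' \<omega> \<partial>gauss_measure)" for m'
      unfolding gaussian_mixture_def d_def
      by (rule hs_norm_mixture_diff_le[OF vector_mixture_coherent vector_mixture_coherent meas])
    then show "\<forall>\<^sub>F m' in at m within S. hs_norm (\<lambda>x. gaussian_mixture m x - gaussian_mixture m' x :: 'a l2) \<le>
        sqrt (4 * (\<integral>\<omega>. d m' \<omega> \<partial>gauss_measure))"
      by (intro always_eventually allI real_le_rsqrt)
    show "\<forall>\<^sub>F m' in at m within S. 0 \<le> hs_norm (\<lambda>x. gaussian_mixture m x - gaussian_mixture m' x :: 'a l2)"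
      unfolding hs_norm_def by (intro always_eventually allI real_sqrt_ge_zero infsum_nonneg) auto
  qed
qed

lemma compactin_gaussian_mixture:
  "compactin hs_topology (gaussian_mixture ` {a..b} :: ('a::euclidean_space l2 \<Rightarrow> 'a l2) set)"
proof (rule image_compactin)
  interpret HS: Metric_space "{A :: 'a l2 \<Rightarrow> 'a l2. hilbert_schmidt A}" "\<lambda>A B. hs_norm (\<lambda>x. A x - B x)"
    by (rule Metric_space_hs)
  show "compactin (top_of_set {a..b}) {a..b}" by (simp add: compactin_subtopology)
  show "continuous_map (top_of_set {a..b}) hs_topology (gaussian_mixture :: real \<Rightarrow> 'a l2 \<Rightarrow> 'a l2)"
    unfolding hs_topology_def HS.continuous_map_to_metric
  proof (intro ballI allI impI)
    fix m \<epsilon> :: real assume m: "m \<in> topspace (top_of_set {a..b})" and \<epsilon>: "\<epsilon> > 0"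
    have "\<forall>\<^sub>F m' in at m within {a..b}. hs_norm (\<lambda>x. gaussian_mixture m x - gaussian_mixture m' x :: 'a l2) < \<epsilon>"
      using gaussian_mixture_continuous \<epsilon> by (rule order_tendstoD(2))
    then obtain \<delta> where \<delta>: "\<delta> > 0" "\<And>m'. m' \<in> {a..b} \<Longrightarrow> m' \<noteq> m \<Longrightarrow> dist m' m < \<delta> \<Longrightarrow>
        hs_norm (\<lambda>x. gaussian_mixture m x - gaussian_mixture m' x :: 'a l2) < \<epsilon>"
      unfolding eventually_at by blast
    show "\<exists>U. openin (top_of_set {a..b}) U \<and> m \<in> U \<and>
        (\<forall>m'\<in>U. gaussian_mixture m' \<in> HS.mball (gaussian_mixture m) \<epsilon>)"
    proof (intro exI[of _ "{a..b} \<inter> ball m \<delta>"] conjI ballI)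
      show "openin (top_of_set {a..b}) ({a..b} \<inter> ball m \<delta>)" by (intro openin_open_Int) simp
      show "m \<in> {a..b} \<inter> ball m \<delta>" using m \<delta> by simp
      fix m' assume "m' \<in> {a..b} \<inter> ball m \<delta>"
      then show "gaussian_mixture m' \<in> HS.mball (gaussian_mixture m) \<epsilon>"
        \<comment> \<open>\<open>at m within\<close> is a punctured filter, so the centre
          \<open>m' = m\<close> is a case of its own.\<close>
        using \<delta>(2)[of m'] \<epsilon> HS.mdist_zero[of "gaussian_mixture m"]
        by (cases "m' = m") (auto simp: HS.in_mball hilbert_schmidt_gaussian_mixture dist_commute)
    qed
  qed
qed

text \<open>A finite type is inhabited, so \<open>real ^ 'n\<close> ranges over the spaces of
  dimension at least one.\<close>

theorem proposition5p1:
  fixes nmin nmax :: real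
  assumes "0 \<le> nmin" and "nmin \<le> nmax"
  shows "precompact_in (hs_topology :: ((real ^ 'n::finite) l2 \<Rightarrow> (real ^ 'n) l2) topology)
    {thermal_state m | m. m \<in> {nmin..nmax}}"
proof -
  let ?F = "gaussian_mixture ` {nmin..nmax} :: ((real ^ 'n) l2 \<Rightarrow> (real ^ 'n) l2) set"
  interpret HS: Metric_space "{A :: (real ^ 'n) l2 \<Rightarrow> (real ^ 'n) l2. hilbert_schmidt A}"
    "\<lambda>A B. hs_norm (\<lambda>x. A x - B x)"
    by (rule Metric_space_hs)
  have F: "{thermal_state m | m. m \<in> {nmin..nmax}} = ?F"
    using assms(1) by (force simp: thermal_state_eq)
  have cpt: "compactin hs_topology ?F" by (rule compactin_gaussian_mixture)
  \<comment> \<open>A compact subset of a Hausdorff space is closed, so the family is its own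
    closure.\<close>
  then have "closedin hs_topology ?F"
    unfolding hs_topology_def by (rule compactin_imp_closedin[OF HS.Hausdorff_space_mtopology])
  then show ?thesis
    unfolding F precompact_in_def using cpt compactin_subset_topspace[OF cpt]
    by (simp add: closure_of_closedin)
qed

end
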